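(* Let $G$ be a finite group and $V$ a finite dimensional $\mathbb{C}G$-module. The isomorphism between the space of constant Hochschild $2$-cocycles $$\Big(\bigoplus_{g\in G}\overline g\otimes\textstyle\bigwedge^{2-\mathrm{codim}V^g}(V^g)^*\otimes\bigwedge^{\mathrm{codim}V^g}((V^g)^\perp)^*\Big)^G$$ and the parameter space of graded Hecke algebras is induced from the map $$\{\text{constant Hochschild 2-cocycles}\}\to\{\text{graded Hecke algebras}\},\qquad\alpha\mapsto(T(V)\#G)/I_\alpha,$$ where $I_\alpha$ is the ideal generated by $\{v\otimes w-w\otimes v-\alpha(v\wedge w)\mid v,w\in V\}$ and $\alpha$ is regarded as an element of $\mathrm{Hom}_{\mathbb C}(\bigwedge^2V,\mathbb{C}G)$. That is, each constant Hochschild 2-cocycle $\alpha$ defines a graded Hecke algebra with $\kappa(v,w)=\alpha(v\wedge w)$, and $\alpha\mapsto\kappa$ is an isomorphism onto the parameter space of graded Hecke algebras.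
   Context: Fix a $G$-invariant Hermitian inner product on $V$; $V^g=\{v:{}^gv=v\}$, $(V^g)^\perp=\mathrm{im}(1-g)$; via $V=V^g\oplus(V^g)^\perp$ regard $(V^g)^*,((V^g)^\perp)^*\subseteq V^*$ (negative exterior powers are $0$), so that the displayed space is a subspace of $\mathbb{C}G\otimes\bigwedge^2V^*\cong\mathrm{Hom}_{\mathbb C}(\bigwedge^2V,\mathbb{C}G)$, with $G$ acting on $\mathbb{C}G$ by conjugation. For an algebra $T$ with $G$ acting by automorphisms, the skew group algebra $T\#G$ is $T\otimes\mathbb{C}G$ with $(r\overline g)(s\overline h)=r({}^gs)\overline{gh}$, where $s\overline g=s\otimes g$. $T(V)$ is the tensor algebra and $S(V)$ the symmetric algebra of $V$. Graded Hecke algebra: for a bilinear skew-symmetric function $\kappa:V\times V\to\mathbb{C}G$, the quotient $\mathcal H=T(V)\#G/(v\otimes w-w\otimes v-\kappa(v,w)\mid v,w\in V)$ is a graded Hecke algebra if it satisfies the Poincaré–Birkhoff–Witt property: any linear splitting of the canonical projection $T(V)\to S(V)$ induces a vector space isomorphism $\mathcal H\cong S(V)\#G$. The parameter space of graded Hecke algebras is the set of all such $\kappa$ for which this holds.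
   Formalization: In the Poincaré–Birkhoff–Witt property, "any linear splitting" of T(V)→S(V) is read as any linear splitting respecting the degree filtrations; with arbitrary linear splittings even the Weyl algebra (G trivial, V=ℂ²) fails, via σ(1)=1−(v⊗w−w⊗v). *)

theory Defs
  imports
    Complex_Main
    "HOL-Library.Function_Algebras"
    "HOL-Combinatorics.Permutations"
    "HOL-Algebra.QuotRing"
    "HOL-Algebra.Module"
begin

section \<open>Representations, duals and exterior forms\<close>

text \<open>The vector space \<open>V\<close> is a type \<open>'v\<close> with a scalar multiplication \<open>scale\<close>; a
  \<open>\<complex>G\<close>-module structure is a linear action \<open>\<rho>\<close> of the group \<open>G\<close>.\<close>

definition linear_rep ::
  "('g, 'm) monoid_scheme \<Rightarrow> (complex \<Rightarrow> 'v::ab_group_add \<Rightarrow> 'v) \<Rightarrow> ('g \<Rightarrow> 'v \<Rightarrow> 'v) \<Rightarrow> bool" where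
  "linear_rep G scale \<rho> \<longleftrightarrow>
     (\<forall>g\<in>carrier G. Vector_Spaces.linear scale scale (\<rho> g)) \<and>
     \<rho> \<one>\<^bsub>G\<^esub> = id \<and>
     (\<forall>g\<in>carrier G. \<forall>h\<in>carrier G. \<rho> (g \<otimes>\<^bsub>G\<^esub> h) = \<rho> g \<circ> \<rho> h)"

definition invariant_inner_product ::
  "('g, 'm) monoid_scheme \<Rightarrow> (complex \<Rightarrow> 'v::ab_group_add \<Rightarrow> 'v) \<Rightarrow> ('g \<Rightarrow> 'v \<Rightarrow> 'v) \<Rightarrow>
     ('v \<Rightarrow> 'v \<Rightarrow> complex) \<Rightarrow> bool" where
  "invariant_inner_product G scale \<rho> ip \<longleftrightarrow>
     (\<forall>w. Vector_Spaces.linear scale (*) (\<lambda>v. ip v w)) \<and>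
     (\<forall>v w. ip w v = cnj (ip v w)) \<and>
     (\<forall>v. v \<noteq> 0 \<longrightarrow> Re (ip v v) > 0) \<and>
     (\<forall>g\<in>carrier G. \<forall>v w. ip (\<rho> g v) (\<rho> g w) = ip v w)"

definition fixed_space :: "('g \<Rightarrow> 'v \<Rightarrow> 'v) \<Rightarrow> 'g \<Rightarrow> 'v set" where
  "fixed_space \<rho> g = {v. \<rho> g v = v}"

definition orth_complement :: "('v \<Rightarrow> 'v \<Rightarrow> complex) \<Rightarrow> 'v set \<Rightarrow> 'v set" where
  "orth_complement ip U = {v. \<forall>u\<in>U. ip v u = 0}"

definition codim :: "(complex \<Rightarrow> 'v::ab_group_add \<Rightarrow> 'v) \<Rightarrow> 'v set \<Rightarrow> nat" where
  "codim scale U = vector_space.dim scale UNIV - vector_space.dim scale U"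

definition dual_space :: "(complex \<Rightarrow> 'v::ab_group_add \<Rightarrow> 'v) \<Rightarrow> ('v \<Rightarrow> complex) set" where
  "dual_space scale = {\<phi>. Vector_Spaces.linear scale (*) \<phi>}"

text \<open>For a decomposition \<open>V = U \<oplus> W\<close>, the subspace \<open>U\<^sup>*\<close> of \<open>V\<^sup>*\<close> consists of the functionals
  that vanish on \<open>W\<close>.\<close>

definition dual_vanishing_on ::
  "(complex \<Rightarrow> 'v::ab_group_add \<Rightarrow> 'v) \<Rightarrow> 'v set \<Rightarrow> ('v \<Rightarrow> complex) set" where
  "dual_vanishing_on scale W = {\<phi> \<in> dual_space scale. \<forall>w\<in>W. \<phi> w = 0}"

definition fun_scale :: "complex \<Rightarrow> ('a \<Rightarrow> complex) \<Rightarrow> 'a \<Rightarrow> complex" where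
  "fun_scale c f = (\<lambda>x. c * f x)"

text \<open>Elements of \<open>\<Lambda>\<^sup>k V\<^sup>*\<close> are represented as alternating forms on lists of \<open>k\<close> vectors, extended by
  zero to lists of other lengths, with the convention
  \<open>(\<phi>\<^sub>1 \<and> \<dots> \<and> \<phi>\<^sub>k)(v\<^sub>1 \<and> \<dots> \<and> v\<^sub>k) = det (\<phi>\<^sub>i v\<^sub>j)\<close>.\<close>

definition wedge :: "('v \<Rightarrow> complex) list \<Rightarrow> 'v list \<Rightarrow> complex" where
  "wedge \<phi>s vs =
     (if length vs = length \<phi>s
      then \<Sum>p | p permutes {..<length \<phi>s}.
             of_int (sign p) * (\<Prod>i<length \<phi>s. (\<phi>s ! i) (vs ! p i))
      else 0)"

text \<open>The image of \<open>\<Lambda>\<^sup>a A \<otimes> \<Lambda>\<^sup>b B\<close> in \<open>\<Lambda>\<^sup>a\<^sup>+\<^sup>b V\<^sup>*\<close> under the wedge product, for subspaces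
  \<open>A, B\<close> of \<open>V\<^sup>*\<close> (this map is injective if \<open>A \<inter> B = 0\<close>).\<close>

definition wedge_product_space ::
  "nat \<Rightarrow> ('v \<Rightarrow> complex) set \<Rightarrow> nat \<Rightarrow> ('v \<Rightarrow> complex) set \<Rightarrow> ('v list \<Rightarrow> complex) set" where
  "wedge_product_space a A b B =
     module.span fun_scale
       {wedge (\<phi>s @ \<psi>s) |\<phi>s \<psi>s. length \<phi>s = a \<and> set \<phi>s \<subseteq> A \<and> length \<psi>s = b \<and> set \<psi>s \<subseteq> B}"


section \<open>Constant Hochschild 2-cocycles\<close>

text \<open>The case distinction implements the convention that negative exterior powers vanish.\<close>

definition cocycle_component ::
  "(complex \<Rightarrow> 'v::ab_group_add \<Rightarrow> 'v) \<Rightarrow> ('g \<Rightarrow> 'v \<Rightarrow> 'v) \<Rightarrow> ('v \<Rightarrow> 'v \<Rightarrow> complex) \<Rightarrow> 'g \<Rightarrow>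
     ('v list \<Rightarrow> complex) set" where
  "cocycle_component scale \<rho> ip g =
     (let Vg = fixed_space \<rho> g; Vg_perp = orth_complement ip Vg; c = codim scale Vg
      in if c \<le> 2
         then wedge_product_space
                (2 - c) (dual_vanishing_on scale Vg_perp)
                c (dual_vanishing_on scale Vg)
         else {0})"

text \<open>An element \<open>\<Sum>\<^sub>g g \<otimes> \<alpha>\<^sub>g\<close> of \<open>\<complex>G \<otimes> \<Lambda>\<^sup>2 V\<^sup>*\<close> is the function \<open>\<lambda>g. \<alpha>\<^sub>g\<close>, extended by zero outside the
  carrier of \<open>G\<close>. The action is by conjugation on \<open>\<complex>G\<close> and contragredient on \<open>V\<^sup>*\<close>, that is
  \<open>h (g \<otimes> \<omega>) = hgh\<^sup>-\<^sup>1 \<otimes> \<omega>(h\<^sup>-\<^sup>1 _, h\<^sup>-\<^sup>1 _)\<close>.\<close>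

definition cochain_act ::
  "('g, 'm) monoid_scheme \<Rightarrow> ('g \<Rightarrow> 'v \<Rightarrow> 'v) \<Rightarrow> 'g \<Rightarrow>
     ('g \<Rightarrow> 'v list \<Rightarrow> complex) \<Rightarrow> 'g \<Rightarrow> 'v list \<Rightarrow> complex" where
  "cochain_act G \<rho> h \<alpha> = (\<lambda>g vs.
     if g \<in> carrier G
     then \<alpha> (inv\<^bsub>G\<^esub> h \<otimes>\<^bsub>G\<^esub> g \<otimes>\<^bsub>G\<^esub> h) (map (\<rho> (inv\<^bsub>G\<^esub> h)) vs) else 0)"

definition constant_cocycles ::
  "('g, 'm) monoid_scheme \<Rightarrow> (complex \<Rightarrow> 'v::ab_group_add \<Rightarrow> 'v) \<Rightarrow> ('g \<Rightarrow> 'v \<Rightarrow> 'v) \<Rightarrow>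
     ('v \<Rightarrow> 'v \<Rightarrow> complex) \<Rightarrow> ('g \<Rightarrow> 'v list \<Rightarrow> complex) set" where
  "constant_cocycles G scale \<rho> ip =
     {\<alpha>. (\<forall>g\<in>carrier G. \<alpha> g \<in> cocycle_component scale \<rho> ip g) \<and>
         (\<forall>g. g \<notin> carrier G \<longrightarrow> \<alpha> g = 0) \<and>
         (\<forall>h\<in>carrier G. cochain_act G \<rho> h \<alpha> = \<alpha>)}"

text \<open>The value \<open>\<alpha>(v \<and> w) \<in> \<complex>G\<close> of \<open>\<alpha> \<in> \<complex>G \<otimes> \<Lambda>\<^sup>2 V\<^sup>* \<cong> Hom(\<Lambda>\<^sup>2 V, \<complex>G)\<close>.\<close>

definition eval_wedge :: "('g \<Rightarrow> 'v list \<Rightarrow> complex) \<Rightarrow> 'v \<Rightarrow> 'v \<Rightarrow> 'g \<Rightarrow> complex" where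
  "eval_wedge \<alpha> v w = (\<lambda>g. \<alpha> g [v, w])"


section \<open>Algebras over the complex numbers\<close>

text \<open>A \<open>\<complex>\<close>-algebra is a ring with scalar multiplication, packed in the record type
  \<^typ>\<open>(complex, 'a) module\<close>.\<close>

definition quotient_algebra ::
  "(complex, 'a) module \<Rightarrow> 'a set \<Rightarrow> (complex, 'a set) module" where
  "quotient_algebra A I =
     ring.extend (A Quot I)
       (module.fields (\<lambda>c X. \<Union>x\<in>X. I +>\<^bsub>A\<^esub> (c \<odot>\<^bsub>A\<^esub> x)))"

definition linear_map ::
  "(complex, 'a) module \<Rightarrow> (complex, 'b) module \<Rightarrow> ('a \<Rightarrow> 'b) \<Rightarrow> bool" where
  "linear_map A B f \<longleftrightarrow>
     f \<in> carrier A \<rightarrow> carrier B \<and>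
     (\<forall>x\<in>carrier A. \<forall>y\<in>carrier A. f (x \<oplus>\<^bsub>A\<^esub> y) = f x \<oplus>\<^bsub>B\<^esub> f y) \<and>
     (\<forall>c. \<forall>x\<in>carrier A. f (c \<odot>\<^bsub>A\<^esub> x) = c \<odot>\<^bsub>B\<^esub> f x)"

definition vector_space_iso ::
  "(complex, 'a) module \<Rightarrow> (complex, 'b) module \<Rightarrow> ('a \<Rightarrow> 'b) \<Rightarrow> bool" where
  "vector_space_iso A B f \<longleftrightarrow> linear_map A B f \<and> bij_betw f (carrier A) (carrier B)"

text \<open>Skew group algebra \<open>A # G\<close>: the element \<open>\<Sum>\<^sub>g r\<^sub>g \<otimes> g\<close> of \<open>A \<otimes> \<complex>G\<close> is the function \<open>\<lambda>g. r\<^sub>g\<close>,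
  extended by zero outside the carrier of the finite group \<open>G\<close>. The multiplication is the bilinear
  extension of \<open>(r g)(s h) = r (g s) gh\<close>, where \<open>act\<close> is the action of \<open>G\<close> on \<open>A\<close>.\<close>

definition skew_group_algebra ::
  "('g, 'm) monoid_scheme \<Rightarrow> (complex, 'a) module \<Rightarrow> ('g \<Rightarrow> 'a \<Rightarrow> 'a) \<Rightarrow>
     (complex, 'g \<Rightarrow> 'a) module" where
  "skew_group_algebra G A act =
     \<lparr> carrier = {r. (\<forall>g\<in>carrier G. r g \<in> carrier A) \<and> (\<forall>g. g \<notin> carrier G \<longrightarrow> r g = \<zero>\<^bsub>A\<^esub>)},
       mult = (\<lambda>r s k. if k \<in> carrier G
                 then \<Oplus>\<^bsub>A\<^esub>g\<in>carrier G. r g \<otimes>\<^bsub>A\<^esub> act g (s (inv\<^bsub>G\<^esub> g \<otimes>\<^bsub>G\<^esub> k)) else \<zero>\<^bsub>A\<^esub>),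
       one = (\<lambda>g. if g = \<one>\<^bsub>G\<^esub> then \<one>\<^bsub>A\<^esub> else \<zero>\<^bsub>A\<^esub>),
       zero = (\<lambda>_. \<zero>\<^bsub>A\<^esub>),
       add = (\<lambda>r s g. r g \<oplus>\<^bsub>A\<^esub> s g),
       smult = (\<lambda>c r g. c \<odot>\<^bsub>A\<^esub> r g) \<rparr>"

definition alg_embed :: "('g, 'm) monoid_scheme \<Rightarrow> (complex, 'a) module \<Rightarrow> 'a \<Rightarrow> 'g \<Rightarrow> 'a" where
  "alg_embed G A r = (\<lambda>g. if g = \<one>\<^bsub>G\<^esub> then r else \<zero>\<^bsub>A\<^esub>)"

definition group_algebra_embed :: "(complex, 'a) module \<Rightarrow> ('g \<Rightarrow> complex) \<Rightarrow> 'g \<Rightarrow> 'a" where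
  "group_algebra_embed A a = (\<lambda>g. a g \<odot>\<^bsub>A\<^esub> \<one>\<^bsub>A\<^esub>)"

definition group_algebra_carrier :: "('g, 'm) monoid_scheme \<Rightarrow> ('g \<Rightarrow> complex) set" where
  "group_algebra_carrier G = {a. \<forall>g. g \<notin> carrier G \<longrightarrow> a g = 0}"


section \<open>Tensor and symmetric algebra\<close>

text \<open>Tensors are realised as multilinear forms on \<open>V\<^sup>*\<close>: the pure tensor \<open>v\<^sub>1 \<otimes> \<dots> \<otimes> v\<^sub>n\<close> sends
  \<open>(\<phi>\<^sub>1, \<dots>, \<phi>\<^sub>n)\<close> to \<open>\<phi>\<^sub>1 v\<^sub>1 \<cdots> \<phi>\<^sub>n v\<^sub>n\<close>, extended by zero to lists of other lengths
  and to lists with nonlinear entries. The map from \<open>V\<^sup>\<otimes>\<^sup>n\<close> to multilinear forms is injective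
  over a field, so that the span of all pure tensors is \<open>T(V) = \<Oplus>\<^sub>n V\<^sup>\<otimes>\<^sup>n\<close>. The product is
  concatenation of pure tensors (lemma \<open>pure_tensor_append\<close> below).\<close>

type_synonym 'v tensor = "('v \<Rightarrow> complex) list \<Rightarrow> complex"

definition pure_tensor :: "(complex \<Rightarrow> 'v::ab_group_add \<Rightarrow> 'v) \<Rightarrow> 'v list \<Rightarrow> 'v tensor" where
  "pure_tensor scale vs = (\<lambda>\<phi>s.
     if set \<phi>s \<subseteq> dual_space scale \<and> length \<phi>s = length vs
     then \<Prod>i<length vs. (\<phi>s ! i) (vs ! i) else 0)"

definition tensor_algebra ::
  "(complex \<Rightarrow> 'v::ab_group_add \<Rightarrow> 'v) \<Rightarrow> (complex, 'v tensor) module" where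
  "tensor_algebra scale =
     \<lparr> carrier = module.span fun_scale (range (pure_tensor scale)),
       mult = (\<lambda>s t \<phi>s. \<Sum>i\<le>length \<phi>s. s (take i \<phi>s) * t (drop i \<phi>s)),
       one = pure_tensor scale [],
       zero = 0,
       add = (+),
       smult = fun_scale \<rparr>"

definition tensors_up_to :: "(complex \<Rightarrow> 'v::ab_group_add \<Rightarrow> 'v) \<Rightarrow> nat \<Rightarrow> 'v tensor set" where
  "tensors_up_to scale n = module.span fun_scale {pure_tensor scale vs |vs. length vs \<le> n}"

text \<open>The action of \<open>G\<close> on \<open>T(V)\<close> by algebra automorphisms extending \<open>\<rho>\<close>
  (lemma \<open>tensor_act_pure_tensor\<close> below).\<close>

definition tensor_act :: "('g \<Rightarrow> 'v \<Rightarrow> 'v) \<Rightarrow> 'g \<Rightarrow> 'v tensor \<Rightarrow> 'v tensor" where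
  "tensor_act \<rho> g t = (\<lambda>\<phi>s. t (map (\<lambda>\<phi>. \<phi> \<circ> \<rho> g) \<phi>s))"

definition tensor_commutator ::
  "(complex \<Rightarrow> 'v::ab_group_add \<Rightarrow> 'v) \<Rightarrow> 'v \<Rightarrow> 'v \<Rightarrow> 'v tensor" where
  "tensor_commutator scale v w =
     pure_tensor scale [v, w] \<ominus>\<^bsub>tensor_algebra scale\<^esub> pure_tensor scale [w, v]"

definition symmetric_ideal :: "(complex \<Rightarrow> 'v::ab_group_add \<Rightarrow> 'v) \<Rightarrow> 'v tensor set" where
  "symmetric_ideal scale =
     Idl\<^bsub>tensor_algebra scale\<^esub> {tensor_commutator scale v w |v w. True}"

definition symmetric_algebra ::
  "(complex \<Rightarrow> 'v::ab_group_add \<Rightarrow> 'v) \<Rightarrow> (complex, 'v tensor set) module" where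
  "symmetric_algebra scale = quotient_algebra (tensor_algebra scale) (symmetric_ideal scale)"

definition symmetric_proj ::
  "(complex \<Rightarrow> 'v::ab_group_add \<Rightarrow> 'v) \<Rightarrow> 'v tensor \<Rightarrow> 'v tensor set" where
  "symmetric_proj scale t = symmetric_ideal scale +>\<^bsub>tensor_algebra scale\<^esub> t"

definition symmetric_act :: "('g \<Rightarrow> 'v \<Rightarrow> 'v) \<Rightarrow> 'g \<Rightarrow> 'v tensor set \<Rightarrow> 'v tensor set" where
  "symmetric_act \<rho> g X = tensor_act \<rho> g ` X"


section \<open>Graded Hecke algebras\<close>

definition tensor_skew ::
  "('g, 'm) monoid_scheme \<Rightarrow> (complex \<Rightarrow> 'v::ab_group_add \<Rightarrow> 'v) \<Rightarrow> ('g \<Rightarrow> 'v \<Rightarrow> 'v) \<Rightarrow>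
     (complex, 'g \<Rightarrow> 'v tensor) module" where
  "tensor_skew G scale \<rho> = skew_group_algebra G (tensor_algebra scale) (tensor_act \<rho>)"

definition symmetric_skew ::
  "('g, 'm) monoid_scheme \<Rightarrow> (complex \<Rightarrow> 'v::ab_group_add \<Rightarrow> 'v) \<Rightarrow> ('g \<Rightarrow> 'v \<Rightarrow> 'v) \<Rightarrow>
     (complex, 'g \<Rightarrow> 'v tensor set) module" where
  "symmetric_skew G scale \<rho> = skew_group_algebra G (symmetric_algebra scale) (symmetric_act \<rho>)"

text \<open>The ideal of \<open>T(V) # G\<close> generated by all \<open>v \<otimes> w - w \<otimes> v - \<kappa>(v,w)\<close>.\<close>

definition hecke_ideal ::
  "('g, 'm) monoid_scheme \<Rightarrow> (complex \<Rightarrow> 'v::ab_group_add \<Rightarrow> 'v) \<Rightarrow> ('g \<Rightarrow> 'v \<Rightarrow> 'v) \<Rightarrow>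
     ('v \<Rightarrow> 'v \<Rightarrow> 'g \<Rightarrow> complex) \<Rightarrow> ('g \<Rightarrow> 'v tensor) set" where
  "hecke_ideal G scale \<rho> \<kappa> =
     Idl\<^bsub>tensor_skew G scale \<rho>\<^esub>
       {alg_embed G (tensor_algebra scale) (tensor_commutator scale v w)
          \<ominus>\<^bsub>tensor_skew G scale \<rho>\<^esub> group_algebra_embed (tensor_algebra scale) (\<kappa> v w) |v w. True}"

definition hecke_quotient ::
  "('g, 'm) monoid_scheme \<Rightarrow> (complex \<Rightarrow> 'v::ab_group_add \<Rightarrow> 'v) \<Rightarrow> ('g \<Rightarrow> 'v \<Rightarrow> 'v) \<Rightarrow>
     ('v \<Rightarrow> 'v \<Rightarrow> 'g \<Rightarrow> complex) \<Rightarrow> (complex, ('g \<Rightarrow> 'v tensor) set) module" where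
  "hecke_quotient G scale \<rho> \<kappa> =
     quotient_algebra (tensor_skew G scale \<rho>) (hecke_ideal G scale \<rho> \<kappa>)"

text \<open>Linear splittings of \<open>T(V) \<rightarrow> S(V)\<close> are required to respect the degree filtrations. Without
  this, \<open>\<sigma>(1) = 1 - (v \<otimes> w - w \<otimes> v)\<close> would be allowed, which is zero in the quotient whenever
  \<open>\<kappa>(v,w) = 1\<close>, so that not even the Weyl algebra would have the PBW property.\<close>

definition filtered_splitting ::
  "(complex \<Rightarrow> 'v::ab_group_add \<Rightarrow> 'v) \<Rightarrow> ('v tensor set \<Rightarrow> 'v tensor) \<Rightarrow> bool" where
  "filtered_splitting scale \<sigma> \<longleftrightarrow>
     linear_map (symmetric_algebra scale) (tensor_algebra scale) \<sigma> \<and>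
     (\<forall>x\<in>carrier (symmetric_algebra scale). symmetric_proj scale (\<sigma> x) = x) \<and>
     (\<forall>n. \<forall>t\<in>tensors_up_to scale n. \<sigma> (symmetric_proj scale t) \<in> tensors_up_to scale n)"

definition pbw_property ::
  "('g, 'm) monoid_scheme \<Rightarrow> (complex \<Rightarrow> 'v::ab_group_add \<Rightarrow> 'v) \<Rightarrow> ('g \<Rightarrow> 'v \<Rightarrow> 'v) \<Rightarrow>
     ('v \<Rightarrow> 'v \<Rightarrow> 'g \<Rightarrow> complex) \<Rightarrow> bool" where
  "pbw_property G scale \<rho> \<kappa> \<longleftrightarrow>
     (\<forall>\<sigma>. filtered_splitting scale \<sigma> \<longrightarrow>
        vector_space_iso (symmetric_skew G scale \<rho>) (hecke_quotient G scale \<rho> \<kappa>)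
          (\<lambda>f. hecke_ideal G scale \<rho> \<kappa> +>\<^bsub>tensor_skew G scale \<rho>\<^esub> (\<lambda>g. \<sigma> (f g))))"

definition bilinear_skew ::
  "('g, 'm) monoid_scheme \<Rightarrow> (complex \<Rightarrow> 'v::ab_group_add \<Rightarrow> 'v) \<Rightarrow>
     ('v \<Rightarrow> 'v \<Rightarrow> 'g \<Rightarrow> complex) \<Rightarrow> bool" where
  "bilinear_skew G scale \<kappa> \<longleftrightarrow>
     (\<forall>v w. \<kappa> v w \<in> group_algebra_carrier G) \<and>
     (\<forall>w. Vector_Spaces.linear scale fun_scale (\<lambda>v. \<kappa> v w)) \<and>
     (\<forall>v. Vector_Spaces.linear scale fun_scale (\<lambda>w. \<kappa> v w)) \<and>
     (\<forall>v w. \<kappa> v w = - \<kappa> w v)"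

definition parameter_space ::
  "('g, 'm) monoid_scheme \<Rightarrow> (complex \<Rightarrow> 'v::ab_group_add \<Rightarrow> 'v) \<Rightarrow> ('g \<Rightarrow> 'v \<Rightarrow> 'v) \<Rightarrow>
     ('v \<Rightarrow> 'v \<Rightarrow> 'g \<Rightarrow> complex) set" where
  "parameter_space G scale \<rho> = {\<kappa>. bilinear_skew G scale \<kappa> \<and> pbw_property G scale \<rho> \<kappa>}"

definition graded_hecke_algebras ::
  "('g, 'm) monoid_scheme \<Rightarrow> (complex \<Rightarrow> 'v::ab_group_add \<Rightarrow> 'v) \<Rightarrow> ('g \<Rightarrow> 'v \<Rightarrow> 'v) \<Rightarrow>
     (complex, ('g \<Rightarrow> 'v tensor) set) module set" where
  "graded_hecke_algebras G scale \<rho> = hecke_quotient G scale \<rho> ` parameter_space G scale \<rho>"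

text \<open>\<open>(T(V) # G) / I\<^sub>\<alpha>\<close>, where \<open>I\<^sub>\<alpha>\<close> is generated by all \<open>v \<otimes> w - w \<otimes> v - \<alpha>(v \<and> w)\<close>.\<close>

definition cocycle_algebra ::
  "('g, 'm) monoid_scheme \<Rightarrow> (complex \<Rightarrow> 'v::ab_group_add \<Rightarrow> 'v) \<Rightarrow> ('g \<Rightarrow> 'v \<Rightarrow> 'v) \<Rightarrow>
     ('g \<Rightarrow> 'v list \<Rightarrow> complex) \<Rightarrow> (complex, ('g \<Rightarrow> 'v tensor) set) module" where
  "cocycle_algebra G scale \<rho> \<alpha> =
     quotient_algebra (tensor_skew G scale \<rho>)
       (Idl\<^bsub>tensor_skew G scale \<rho>\<^esub>
         {alg_embed G (tensor_algebra scale) (tensor_commutator scale v w)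
            \<ominus>\<^bsub>tensor_skew G scale \<rho>\<^esub>
              group_algebra_embed (tensor_algebra scale) (eval_wedge \<alpha> v w) |v w. True})"

section \<open>Well-definedness of the constructions\<close>

text \<open>\<open>T(V)\<close> and \<open>T(V) # G\<close> are rings, so that the ideals generated above are genuine ones (for a
  structure that is not a ring, \<open>genideal\<close> would be the whole type).\<close>

interpretation fs: vector_space fun_scale
  by unfold_locales (auto simp: fun_scale_def fun_eq_iff algebra_simps)

declare plus_fun_apply [simp del] zero_fun_apply [simp del]

definition tmul :: "'v tensor \<Rightarrow> 'v tensor \<Rightarrow> 'v tensor" where
  "tmul s t = (\<lambda>\<phi>s. \<Sum>i\<le>length \<phi>s. s (take i \<phi>s) * t (drop i \<phi>s))"

lemma tensor_algebra_simps [simp]: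
  "carrier (tensor_algebra scale) = fs.span (range (pure_tensor scale))"
  "s \<otimes>\<^bsub>tensor_algebra scale\<^esub> t = tmul s t"
  "\<one>\<^bsub>tensor_algebra scale\<^esub> = pure_tensor scale []"
  "\<zero>\<^bsub>tensor_algebra scale\<^esub> = 0"
  "s \<oplus>\<^bsub>tensor_algebra scale\<^esub> t = s + t"
  "c \<odot>\<^bsub>tensor_algebra scale\<^esub> t = fun_scale c t"
  by (simp_all add: tensor_algebra_def tmul_def)

lemma tmul_assoc: "tmul (tmul s t) u = tmul s (tmul t u)"
proof
  fix \<phi>s :: "('a \<Rightarrow> complex) list"
  let ?n = "length \<phi>s"
  let ?F = "\<lambda>i j. s (take i \<phi>s) * t (take j (drop i \<phi>s)) * u (drop (i + j) \<phi>s)"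
  have "tmul (tmul s t) u \<phi>s = (\<Sum>k\<le>?n. \<Sum>i\<le>k. ?F i (k - i))"
    by (auto simp: tmul_def sum_distrib_right min_def drop_take intro!: sum.cong)
  also have "\<dots> = (\<Sum>(i,j)\<in>{(i,j). i + j \<le> ?n}. ?F i j)"
    by (rule sum.triangle_reindex_eq [symmetric])
  also have "{(i,j). i + j \<le> ?n} = Sigma {..?n} (\<lambda>i. {..?n - i})"
    by auto
  also have "(\<Sum>(i,j)\<in>\<dots>. ?F i j) = (\<Sum>i\<le>?n. \<Sum>j\<le>?n - i. ?F i j)"
    by (rule sum.Sigma [symmetric]) auto
  also have "\<dots> = tmul s (tmul t u) \<phi>s"
    by (auto simp: tmul_def sum_distrib_left add.commute mult.assoc intro!: sum.cong)
  finally show "tmul (tmul s t) u \<phi>s = tmul s (tmul t u) \<phi>s" .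
qed

lemma tmul_linear:
  "tmul (s + s') t = tmul s t + tmul s' t" "tmul t (s + s') = tmul t s + tmul t s'"
  "tmul (fun_scale c s) t = fun_scale c (tmul s t)" "tmul t (fun_scale c s) = fun_scale c (tmul t s)"
  "tmul 0 t = 0" "tmul t 0 = 0"
  by (auto simp: tmul_def fun_scale_def fun_eq_iff sum.distrib sum_distrib_left algebra_simps
      plus_fun_apply zero_fun_apply)

lemma tmul_sum: "tmul (\<Sum>i\<in>A. f i) t = (\<Sum>i\<in>A. tmul (f i) t)"
  "tmul t (\<Sum>i\<in>A. f i) = (\<Sum>i\<in>A. tmul t (f i))"
  by (induction A rule: infinite_finite_induct) (auto simp: tmul_linear)

lemma pure_tensor_append:
  "pure_tensor scale vs \<otimes>\<^bsub>tensor_algebra scale\<^esub> pure_tensor scale ws = pure_tensor scale (vs @ ws)"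
proof
  fix \<phi>s :: "('a \<Rightarrow> complex) list"
  let ?P = "pure_tensor scale"
  have *: "?P vs (take i \<phi>s) * ?P ws (drop i \<phi>s) =
             (if i = length vs then ?P (vs @ ws) \<phi>s else 0)" if i: "i \<le> length \<phi>s" for i
  proof (cases "i = length vs")
    case False
    then show ?thesis using i by (simp add: pure_tensor_def)
  next
    case True
    have S: "set \<phi>s \<subseteq> D \<longleftrightarrow> set (take i \<phi>s) \<subseteq> D \<and> set (drop i \<phi>s) \<subseteq> D" for D
      by (metis append_take_drop_id set_append Un_subset_iff)
    have split: "(\<Prod>j<m + n. f j) = (\<Prod>j<m. f j) * (\<Prod>j<n. f (m + j))"
      for f :: "nat \<Rightarrow> complex" and m n
      by (induction n) (simp_all add: mult.assoc)
    show ?thesis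
    proof (cases "set \<phi>s \<subseteq> dual_space scale \<and> length \<phi>s = length vs + length ws")
      case False
      then show ?thesis using True i S [of "dual_space scale"] by (auto simp: pure_tensor_def)
    next
      case lin: True
      have "?P (vs @ ws) \<phi>s = (\<Prod>j<length vs + length ws. (\<phi>s ! j) ((vs @ ws) ! j))"
        using lin by (simp add: pure_tensor_def)
      also have "\<dots> = (\<Prod>j<length vs. (\<phi>s ! j) (vs ! j)) *
                     (\<Prod>j<length ws. (\<phi>s ! (length vs + j)) (ws ! j))"
        by (simp add: split nth_append)
      also have "\<dots> = ?P vs (take i \<phi>s) * ?P ws (drop i \<phi>s)"
        using lin True S [of "dual_space scale"] by (simp add: pure_tensor_def)
      finally show ?thesis using True by simp
    qed
  qed
  have "tmul (?P vs) (?P ws) \<phi>s = (\<Sum>i\<le>length \<phi>s. if i = length vs then ?P (vs @ ws) \<phi>s else 0)"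
    unfolding tmul_def by (rule sum.cong) (auto simp: *)
  also have "\<dots> = ?P (vs @ ws) \<phi>s"
    by (simp add: pure_tensor_def)
  finally show "(?P vs \<otimes>\<^bsub>tensor_algebra scale\<^esub> ?P ws) \<phi>s = ?P (vs @ ws) \<phi>s" by simp
qed

lemma tmul_closed:
  assumes "s \<in> carrier (tensor_algebra scale)" "t \<in> carrier (tensor_algebra scale)"
  shows "tmul s t \<in> carrier (tensor_algebra scale)"
proof -
  let ?P = "range (pure_tensor scale)"
  have 1: "tmul s (pure_tensor scale ws) \<in> fs.span ?P" if "s \<in> fs.span ?P" for s ws
    using that
  proof (induction rule: fs.span_induct_alt)
    case base
    then show ?case by (simp add: tmul_linear fs.span_zero)
  next
    case (step c x y)
    then show ?case using pure_tensor_append [of scale]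
      by (auto simp: tmul_linear intro!: fs.span_add fs.span_scale intro: fs.span_base)
  qed
  have "t \<in> fs.span ?P" using assms by simp
  then have "tmul s t \<in> fs.span ?P"
  proof (induction rule: fs.span_induct_alt)
    case base
    then show ?case by (simp add: tmul_linear fs.span_zero)
  next
    case (step c x y)
    then show ?case using 1 assms
      by (auto simp: tmul_linear intro!: fs.span_add fs.span_scale)
  qed
  then show ?thesis by simp
qed

lemma tmul_one:
  assumes "s \<in> carrier (tensor_algebra scale)"
  shows "tmul (pure_tensor scale []) s = s" "tmul s (pure_tensor scale []) = s"
proof -
  have "s \<in> fs.span (range (pure_tensor scale))" using assms by simp
  then have "tmul (pure_tensor scale []) s = s \<and> tmul s (pure_tensor scale []) = s"
  proof (induction rule: fs.span_induct_alt)
    case base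
    then show ?case by (simp add: tmul_linear)
  next
    case (step c x y)
    then show ?case using pure_tensor_append [of scale] by (auto simp: tmul_linear)
  qed
  then show "tmul (pure_tensor scale []) s = s" "tmul s (pure_tensor scale []) = s" by auto
qed

lemma tensor_algebra_ring: "ring (tensor_algebra scale)"
proof (rule ringI)
  show "abelian_group (tensor_algebra scale)"
  proof (rule abelian_groupI)
    fix x assume "x \<in> carrier (tensor_algebra scale)"
    then show "\<exists>y\<in>carrier (tensor_algebra scale). y \<oplus>\<^bsub>tensor_algebra scale\<^esub> x = \<zero>\<^bsub>tensor_algebra scale\<^esub>"
      by (intro bexI [of _ "- x"]) (auto intro: fs.span_neg)
  qed (auto intro: fs.span_add fs.span_zero simp: add.assoc add.commute)
  show "Group.monoid (tensor_algebra scale)"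
    by (rule monoidI) (use tmul_closed [of _ scale] tmul_one [of _ scale] in
        \<open>auto simp: tmul_assoc intro: fs.span_base\<close>)
qed (auto simp: tmul_linear)

lemma tensor_act_pure_tensor:
  fixes G (structure) and scale :: "complex \<Rightarrow> 'a::ab_group_add \<Rightarrow> 'a"
  assumes "group G" "linear_rep G scale \<rho>" "g \<in> carrier G"
  shows "tensor_act \<rho> g (pure_tensor scale vs) = pure_tensor scale (map (\<rho> g) vs)"
proof
  fix \<phi>s :: "('a \<Rightarrow> complex) list"
  interpret group G by fact
  have lin: "Vector_Spaces.linear scale scale (\<rho> h)" if "h \<in> carrier G" for h
    using assms that by (auto simp: linear_rep_def)
  have id: "\<rho> g \<circ> \<rho> (inv g) = id"
    using assms by (metis linear_rep_def inv_closed r_inv)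
  have "\<phi> \<circ> \<rho> g \<in> dual_space scale \<longleftrightarrow> \<phi> \<in> dual_space scale" for \<phi>
  proof
    assume "\<phi> \<circ> \<rho> g \<in> dual_space scale"
    then have "Vector_Spaces.linear scale (*) ((\<phi> \<circ> \<rho> g) \<circ> \<rho> (inv g))"
      using lin [of "inv g"] assms by (auto simp: dual_space_def intro: Vector_Spaces.linear_compose)
    then show "\<phi> \<in> dual_space scale" by (simp add: dual_space_def comp_assoc id)
  next
    assume "\<phi> \<in> dual_space scale"
    then show "\<phi> \<circ> \<rho> g \<in> dual_space scale"
      using lin [of g] assms by (auto simp: dual_space_def intro: Vector_Spaces.linear_compose)
  qed
  then show "tensor_act \<rho> g (pure_tensor scale vs) \<phi>s = pure_tensor scale (map (\<rho> g) vs) \<phi>s"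
    by (auto simp: tensor_act_def pure_tensor_def)
qed

lemma tensor_act_linear:
  "tensor_act \<rho> g (s + t) = tensor_act \<rho> g s + tensor_act \<rho> g t"
  "tensor_act \<rho> g (fun_scale c t) = fun_scale c (tensor_act \<rho> g t)"
  "tensor_act \<rho> g 0 = 0"
  by (auto simp: tensor_act_def fun_scale_def plus_fun_apply zero_fun_apply fun_eq_iff)

lemma tensor_act_sum: "tensor_act \<rho> g (\<Sum>i\<in>A. f i) = (\<Sum>i\<in>A. tensor_act \<rho> g (f i))"
  by (induction A rule: infinite_finite_induct) (auto simp: tensor_act_linear)

lemma tensor_act_tmul: "tensor_act \<rho> g (tmul s t) = tmul (tensor_act \<rho> g s) (tensor_act \<rho> g t)"
  by (auto simp: tensor_act_def tmul_def take_map drop_map)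

lemma tensor_act_closed:
  assumes "group G" "linear_rep G scale \<rho>" "g \<in> carrier G" "t \<in> carrier (tensor_algebra scale)"
  shows "tensor_act \<rho> g t \<in> carrier (tensor_algebra scale)"
proof -
  have "t \<in> fs.span (range (pure_tensor scale))" using assms by simp
  then have "tensor_act \<rho> g t \<in> fs.span (range (pure_tensor scale))"
  proof (induction rule: fs.span_induct_alt)
    case base
    then show ?case by (simp add: tensor_act_linear fs.span_zero)
  next
    case (step c x y)
    then show ?case
      by (auto simp: tensor_act_linear tensor_act_pure_tensor [OF assms(1-3)]
          intro!: fs.span_add fs.span_scale intro: fs.span_base)
  qed
  then show ?thesis by simp
qed

lemma tensor_act_one: "linear_rep G scale \<rho> \<Longrightarrow> tensor_act \<rho> \<one>\<^bsub>G\<^esub> t = t"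
  by (simp add: tensor_act_def linear_rep_def)

lemma tensor_act_mult:
  assumes "linear_rep G scale \<rho>" "g \<in> carrier G" "h \<in> carrier G"
  shows "tensor_act \<rho> (g \<otimes>\<^bsub>G\<^esub> h) t = tensor_act \<rho> g (tensor_act \<rho> h t)"
  using assms by (simp add: tensor_act_def linear_rep_def comp_def fun_eq_iff)

lemma finsum_tensor_algebra:
  assumes "finite A" "f \<in> A \<rightarrow> carrier (tensor_algebra scale)"
  shows "finsum (tensor_algebra scale) f A = (\<Sum>i\<in>A. f i)"
proof -
  interpret ring "tensor_algebra scale" by (rule tensor_algebra_ring)
  show ?thesis using assms by (induction A rule: finite_induct) (auto simp: finsum_insert)
qed

lemma tensor_skew_mult:
  assumes "group G" "finite (carrier G)" "linear_rep G scale \<rho>"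
    and "r \<in> carrier (tensor_skew G scale \<rho>)" "s \<in> carrier (tensor_skew G scale \<rho>)"
  shows "r \<otimes>\<^bsub>tensor_skew G scale \<rho>\<^esub> s =
    (\<lambda>k. if k \<in> carrier G
          then \<Sum>g\<in>carrier G. tmul (r g) (tensor_act \<rho> g (s (inv\<^bsub>G\<^esub> g \<otimes>\<^bsub>G\<^esub> k))) else 0)"
proof -
  interpret group G by fact
  have "finsum (tensor_algebra scale)
          (\<lambda>g. tmul (r g) (tensor_act \<rho> g (s (inv\<^bsub>G\<^esub> g \<otimes>\<^bsub>G\<^esub> k)))) (carrier G) =
        (\<Sum>g\<in>carrier G. tmul (r g) (tensor_act \<rho> g (s (inv\<^bsub>G\<^esub> g \<otimes>\<^bsub>G\<^esub> k))))"
    if "k \<in> carrier G" for k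
    using assms that
    by (intro finsum_tensor_algebra)
       (auto simp: tensor_skew_def skew_group_algebra_def simp del: tensor_algebra_simps(1)
          intro!: tmul_closed tensor_act_closed [OF assms(1,3)])
  then show ?thesis by (auto simp: tensor_skew_def skew_group_algebra_def fun_eq_iff)
qed

lemma tensor_skew_ring:
  fixes G (structure) and scale :: "complex \<Rightarrow> 'v::ab_group_add \<Rightarrow> 'v"
  assumes "group G" "finite (carrier G)" "linear_rep G scale \<rho>"
  shows "ring (tensor_skew G scale \<rho>)"
proof -
  interpret group G by fact
  interpret T: ring "tensor_algebra scale" by (rule tensor_algebra_ring)
  let ?T = "carrier (tensor_algebra scale)"
  let ?H = "tensor_skew G scale \<rho>"
  note [simp del] = tensor_algebra_simps(1)
  have car: "r \<in> carrier ?H \<longleftrightarrow> (\<forall>g\<in>carrier G. r g \<in> ?T) \<and> (\<forall>g. g \<notin> carrier G \<longrightarrow> r g = 0)" for r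
    by (simp add: tensor_skew_def skew_group_algebra_def)
  have ops: "\<zero>\<^bsub>?H\<^esub> = 0" "x \<oplus>\<^bsub>?H\<^esub> y = x + y"
    "\<one>\<^bsub>?H\<^esub> = (\<lambda>g. if g = \<one>\<^bsub>G\<^esub> then pure_tensor scale [] else 0)" for x y
    by (auto simp: tensor_skew_def skew_group_algebra_def fun_eq_iff plus_fun_apply zero_fun_apply)
  note mul = tensor_skew_mult [OF assms]
  have sum_closed: "(\<Sum>i\<in>A. f i) \<in> ?T" if "\<And>i. i \<in> A \<Longrightarrow> f i \<in> ?T" for A :: "'a set" and f :: "'a \<Rightarrow> 'v tensor"
    using that by (simp add: tensor_algebra_simps(1) fs.span_sum)
  have one_T: "pure_tensor scale [] \<in> ?T" using T.one_closed by simp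
  have zero_T: "0 \<in> ?T" using T.zero_closed by simp
  have add_T: "x + y \<in> ?T" if "x \<in> ?T" "y \<in> ?T" for x y
    using T.add.m_closed [OF that] by simp
  have one_H: "\<one>\<^bsub>?H\<^esub> \<in> carrier ?H" by (auto simp: car ops one_T zero_T)
  have mul_closed: "x \<otimes>\<^bsub>?H\<^esub> y \<in> carrier ?H" if "x \<in> carrier ?H" "y \<in> carrier ?H" for x y
    using that unfolding mul [OF that]
    by (auto simp: car intro!: sum_closed tmul_closed tensor_act_closed [OF assms(1,3)])
  show ?thesis
  proof (rule ringI)
    show "abelian_group ?H"
    proof (rule abelian_groupI)
      fix x assume x: "x \<in> carrier ?H"
      have "- x \<in> carrier ?H"
        using x by (auto simp: car tensor_algebra_simps(1) fun_eq_iff zero_fun_apply intro: fs.span_neg)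
      then show "\<exists>y\<in>carrier ?H. y \<oplus>\<^bsub>?H\<^esub> x = \<zero>\<^bsub>?H\<^esub>"
        by (intro bexI [of _ "- x"]) (auto simp: ops)
    qed (auto simp: ops car zero_T add_T plus_fun_apply zero_fun_apply add.assoc add.commute)
    show "Group.monoid ?H"
    proof (rule monoidI)
      fix x y z assume x: "x \<in> carrier ?H" and y: "y \<in> carrier ?H" and z: "z \<in> carrier ?H"
      show "x \<otimes>\<^bsub>?H\<^esub> y \<otimes>\<^bsub>?H\<^esub> z = x \<otimes>\<^bsub>?H\<^esub> (y \<otimes>\<^bsub>?H\<^esub> z)"
      proof
        fix k
        show "(x \<otimes>\<^bsub>?H\<^esub> y \<otimes>\<^bsub>?H\<^esub> z) k = (x \<otimes>\<^bsub>?H\<^esub> (y \<otimes>\<^bsub>?H\<^esub> z)) k"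
        proof (cases "k \<in> carrier G")
          case False
          then show ?thesis
            unfolding mul [OF mul_closed [OF x y] z] mul [OF x mul_closed [OF y z]] by simp
        next
          case k: True
          let ?a = "tensor_act \<rho>"
          have "(x \<otimes>\<^bsub>?H\<^esub> y \<otimes>\<^bsub>?H\<^esub> z) k =
            (\<Sum>g\<in>carrier G. \<Sum>h\<in>carrier G.
               tmul (tmul (x h) (?a h (y (inv h \<otimes> g)))) (?a g (z (inv g \<otimes> k))))"
            unfolding mul [OF mul_closed [OF x y] z] unfolding mul [OF x y]
            using k by (simp add: tmul_sum)
          also have "\<dots> = (\<Sum>h\<in>carrier G. \<Sum>g\<in>carrier G.
               tmul (tmul (x h) (?a h (y (inv h \<otimes> g)))) (?a g (z (inv g \<otimes> k))))"
            by (rule sum.swap)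
          also have "\<dots> = (\<Sum>h\<in>carrier G. \<Sum>l\<in>carrier G.
               tmul (tmul (x h) (?a h (y l))) (?a h (?a l (z (inv l \<otimes> (inv h \<otimes> k))))))"
          proof (rule sum.cong [OF refl])
            fix h assume h: "h \<in> carrier G"
            show "(\<Sum>g\<in>carrier G.
                tmul (tmul (x h) (?a h (y (inv h \<otimes> g)))) (?a g (z (inv g \<otimes> k)))) =
              (\<Sum>l\<in>carrier G.
                tmul (tmul (x h) (?a h (y l))) (?a h (?a l (z (inv l \<otimes> (inv h \<otimes> k))))))"
            proof (rule sum.reindex_bij_witness [of _ "\<lambda>l. h \<otimes> l" "\<lambda>g. inv h \<otimes> g"])
              fix g assume g: "g \<in> carrier G"
              have cancel: "h \<otimes> (inv h \<otimes> a) = a" if "a \<in> carrier G" for a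
                using h that by (simp add: m_assoc [symmetric])
              have "h \<otimes> (inv h \<otimes> g) = g" "inv (inv h \<otimes> g) \<otimes> (inv h \<otimes> k) = inv g \<otimes> k"
                using g h k by (simp_all add: inv_mult_group m_assoc cancel)
              then show "tmul (tmul (x h) (?a h (y (inv h \<otimes> g))))
                  (?a h (?a (inv h \<otimes> g) (z (inv (inv h \<otimes> g) \<otimes> (inv h \<otimes> k))))) =
                tmul (tmul (x h) (?a h (y (inv h \<otimes> g)))) (?a g (z (inv g \<otimes> k)))"
                using g h assms(3) tensor_act_mult [of G scale \<rho> h "inv h \<otimes> g"] by simp
            qed (use h in \<open>simp_all add: m_assoc [symmetric]\<close>)
          qed
          also have "\<dots> = (x \<otimes>\<^bsub>?H\<^esub> (y \<otimes>\<^bsub>?H\<^esub> z)) k"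
            unfolding mul [OF x mul_closed [OF y z]] unfolding mul [OF y z]
            using k by (simp add: tmul_sum tensor_act_sum tensor_act_tmul tmul_assoc)
          finally show ?thesis .
        qed
      qed
    next
      fix x assume x: "x \<in> carrier ?H"
      show "\<one>\<^bsub>?H\<^esub> \<otimes>\<^bsub>?H\<^esub> x = x"
      proof
        fix k
        have "(\<Sum>g\<in>carrier G. tmul (if g = \<one> then pure_tensor scale [] else 0)
                (tensor_act \<rho> g (x (inv g \<otimes> k)))) = x k" if k: "k \<in> carrier G"
        proof -
          have "(\<Sum>g\<in>carrier G. tmul (if g = \<one> then pure_tensor scale [] else 0)
                (tensor_act \<rho> g (x (inv g \<otimes> k)))) =
              (\<Sum>g\<in>carrier G. if g = \<one> then x k else 0)"
            using x k assms(3)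
            by (intro sum.cong) (auto simp: tmul_linear tensor_act_one car tmul_one)
          then show ?thesis using assms(2) by simp
        qed
        then show "(\<one>\<^bsub>?H\<^esub> \<otimes>\<^bsub>?H\<^esub> x) k = x k"
          unfolding mul [OF one_H x] unfolding ops(3) using x by (auto simp: car)
      qed
      show "x \<otimes>\<^bsub>?H\<^esub> \<one>\<^bsub>?H\<^esub> = x"
      proof
        fix k
        have act1: "tensor_act \<rho> g (pure_tensor scale []) = pure_tensor scale []"
          if "g \<in> carrier G" for g
          using tensor_act_pure_tensor [OF assms(1,3) that, of "[]"] by simp
        have "(\<Sum>g\<in>carrier G. tmul (x g) (tensor_act \<rho> g
                (if inv g \<otimes> k = \<one> then pure_tensor scale [] else 0))) = x k"
          if k: "k \<in> carrier G"
        proof -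
          have "inv g \<otimes> k = \<one> \<longleftrightarrow> g = k" if "g \<in> carrier G" for g
            using that k by (metis inv_closed inv_equality inv_inv l_inv)
          then have "(\<Sum>g\<in>carrier G. tmul (x g) (tensor_act \<rho> g
                (if inv g \<otimes> k = \<one> then pure_tensor scale [] else 0))) =
              (\<Sum>g\<in>carrier G. if g = k then x k else 0)"
            using x k
            by (intro sum.cong) (auto simp: tmul_linear tensor_act_linear act1 car tmul_one)
          then show ?thesis using assms(2) k by simp
        qed
        then show "(x \<otimes>\<^bsub>?H\<^esub> \<one>\<^bsub>?H\<^esub>) k = x k"
          unfolding mul [OF x one_H] unfolding ops(3) using x by (auto simp: car)
      qed
    qed (use one_H mul_closed in auto)
  next
    fix x y z assume "x \<in> carrier ?H" "y \<in> carrier ?H" "z \<in> carrier ?H"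
    note xyz = this
    have xy: "x + y \<in> carrier ?H"
      using xyz by (simp add: car add_T plus_fun_apply)
    show "(x \<oplus>\<^bsub>?H\<^esub> y) \<otimes>\<^bsub>?H\<^esub> z = x \<otimes>\<^bsub>?H\<^esub> z \<oplus>\<^bsub>?H\<^esub> y \<otimes>\<^bsub>?H\<^esub> z"
      "z \<otimes>\<^bsub>?H\<^esub> (x \<oplus>\<^bsub>?H\<^esub> y) = z \<otimes>\<^bsub>?H\<^esub> x \<oplus>\<^bsub>?H\<^esub> z \<otimes>\<^bsub>?H\<^esub> y"
      using mul [OF xy xyz(3)] mul [OF xyz(3) xy] mul [OF xyz(1,3)] mul [OF xyz(2,3)]
        mul [OF xyz(3,1)] mul [OF xyz(3,2)]
      by (simp_all add: ops fun_eq_iff plus_fun_apply zero_fun_apply tmul_linear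
          tensor_act_linear sum.distrib)
  qed
qed

end

theory Submission
  imports Defs "HOL-Algebra.Multiplicative_Group"
begin

text \<open>
  A skew form \<open>\<kappa> = \<Sum>\<^sub>g \<kappa>\<^sub>g g\<close> has the PBW property iff it is \<open>G\<close>-invariant and satisfies the Jacobi
  condition \<open>\<kappa>\<^sub>g(u,v)(gw - w) + \<kappa>\<^sub>g(v,w)(gu - u) + \<kappa>\<^sub>g(w,u)(gv - v) = 0\<close> for all \<open>g\<close>. Both conditions are
  necessary because their failure puts nonzero elements of degree at most 1 into the ideal.

  For sufficiency one needs a linear map on \<open>T(V) # G\<close> that kills the ideal and is the identity modulo
  symmetric relations and lower degree. On \<open>V\<^sup>\<otimes>\<^sup>n\<close> the prescribed differences between a tensor and its
  images under adjacent transpositions, defined through degree \<open>n - 2\<close>, satisfy the Coxeter relations of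
  a 1-cocycle of \<open>S\<^sub>n\<close>: the commutation relations amount to invariance and the braid relations to the
  Jacobi condition. In characteristic 0 the cocycle is a coboundary, by averaging over the cosets of
  \<open>S\<^sub>m\<close> in \<open>S\<^sub>m\<^sub>+\<^sub>1\<close> for \<open>m = 1, 2, \<dots>\<close>, so that no presentation of \<open>S\<^sub>n\<close> is needed.

  Finally, the Jacobi condition at \<open>g\<close> says that \<open>\<kappa>\<^sub>g \<and> \<chi> = 0\<close> for every functional \<open>\<chi>\<close> that vanishes
  on \<open>V\<^sup>g\<close>. This forces \<open>\<kappa>\<^sub>g\<close> to be divisible by all such \<open>\<chi>\<close>, which is the description of the
  component of the constant cocycles at \<open>g\<close>.
\<close>

text \<open>The obstacle to injectivity is that relations of high degree may cancel down to low
  degree, so the shape of the generators says little about the small elements of the ideal. A map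
  that is zero on the whole ideal and the identity up to lower terms turns the question into one
  about leading terms. To extend such a map from degree n - 2 to degree n, its values on a word and
  on the word with two neighbours exchanged must differ by its value on the contraction of this
  pair, where each group element h in \<kappa> is pushed to the right past the remaining vectors.
  The push is where the action enters. Of two disjoint contractions, the left one lets h act on the
  other pair, hence invariance. Around a braid hexagon, the spare third vector is moved by h exactly
  when it stands to the right of the contracted pair, hence the factors hw - w. Leading terms are
  taken modulo the whole symmetric ideal and not in a chosen complement, so the argument serves
  every filtered splitting at once. Surjectivity needs none of this: it holds for each skew form, by
  induction on the degree.\<close>

section \<open>Cocycles of the symmetric group\<close>

text \<open>Think of \<open>s i\<close> as the adjacent transpositions of \<open>S_{N+1}\<close> and
  of \<open>f i w\<close> as the prescribed value of \<open>F w - F (s i w)\<close>; the relations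
  on \<open>f\<close> say that the prescribed differences add up consistently around each Coxeter
  relation. \<open>P\<close> is a property that the solution has to keep, in the main application
  multilinearity and the leading term. \<open>P_avg\<close> asks for averages of total weight 1
  only, because having a given leading term is an affine condition.\<close>

lemma braid_cocycle_potential:
  fixes sc :: "complex \<Rightarrow> 'x::ab_group_add \<Rightarrow> 'x" and s :: "nat \<Rightarrow> 'w \<Rightarrow> 'w"
    and f :: "nat \<Rightarrow> 'w \<Rightarrow> 'x"
  assumes sc: "vector_space sc"
    and S: "\<And>i w. i < N \<Longrightarrow> w \<in> S \<Longrightarrow> s i w \<in> S"
    and s_inv: "\<And>i w. i < N \<Longrightarrow> w \<in> S \<Longrightarrow> s i (s i w) = w"
    and s_comm: "\<And>i j w. Suc i < j \<Longrightarrow> j < N \<Longrightarrow> w \<in> S \<Longrightarrow> s i (s j w) = s j (s i w)"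
    and s_braid: "\<And>i w. Suc i < N \<Longrightarrow> w \<in> S \<Longrightarrow>
      s i (s (Suc i) (s i w)) = s (Suc i) (s i (s (Suc i) w))"
    and f_inv: "\<And>i w. i < N \<Longrightarrow> w \<in> S \<Longrightarrow> f i w + f i (s i w) = 0"
    and f_comm: "\<And>i j w. Suc i < j \<Longrightarrow> j < N \<Longrightarrow> w \<in> S \<Longrightarrow>
      f i w + f j (s i w) = f j w + f i (s j w)"
    and f_braid: "\<And>i w. Suc i < N \<Longrightarrow> w \<in> S \<Longrightarrow>
      f i w + f (Suc i) (s i w) + f i (s (Suc i) (s i w)) =
      f (Suc i) w + f i (s (Suc i) w) + f (Suc i) (s i (s (Suc i) w))"
    and P0: "P F_init"
    and P_step: "\<And>i F. i < N \<Longrightarrow> P F \<Longrightarrow> P (\<lambda>w. f i w + F (s i w))"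
    and P_avg: "\<And>k E. (\<And>i. i \<le> k \<Longrightarrow> P (E i)) \<Longrightarrow>
      P (\<lambda>w. sc (inverse (of_nat (Suc k))) (\<Sum>i\<le>k. E i w))"
  shows "\<exists>F. P F \<and> (\<forall>i<N. \<forall>w\<in>S. F w - F (s i w) = f i w)"
proof -
  interpret vector_space sc by fact
  \<comment> \<open>Stage \<open>m\<close> solves the equations of the transpositions below
    \<open>m\<close>, which generate a copy of \<open>S_{m+1}\<close>.\<close>
  have "\<exists>F. P F \<and> (\<forall>i<m. \<forall>w\<in>S. F w - F (s i w) = f i w)" if "m \<le> N" for m
    using that
  proof (induction m)
    case 0
    then show ?case using P0 by blast
  next
    case (Suc m)
    then obtain F where F: "P F" "\<And>i w. i < m \<Longrightarrow> w \<in> S \<Longrightarrow> F w - F (s i w) = f i w"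
      by auto
    have m: "m < N" using Suc.prems by simp
    \<comment> \<open>\<open>E j\<close> is \<open>F\<close> carried along the word
      \<open>s m \<circ> ... \<circ> s (m - j + 1)\<close>. For \<open>j \<le> m + 1\<close> these
      words represent the m + 2 cosets of \<open>S_{m+1}\<close> in \<open>S_{m+2}\<close>.\<close>
    define E where "E = rec_nat F (\<lambda>j E w. f (m - j) w + E (s (m - j) w))"
    have E0: "E 0 = F" and ES: "E (Suc j) w = f (m - j) w + E j (s (m - j) w)" for j w
      by (simp_all add: E_def)
    have PE: "P (E j)" for j
    proof (induction j)
      case 0
      then show ?case using F by (simp add: E0)
    next
      case (Suc j)
      have "P (\<lambda>w. f (m - j) w + E j (s (m - j) w))"
        using m by (intro P_step Suc) simp
      moreover have "E (Suc j) = (\<lambda>w. f (m - j) w + E j (s (m - j) w))" by (simp add: ES fun_eq_iff)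
      ultimately show ?case by simp
    qed
    \<comment> \<open>\<open>s i\<close> exchanges the cosets \<open>m - i\<close> and
      \<open>m - i + 1\<close> and fixes the others; on a fixed coset the equation holds even before
      averaging.\<close>
    have main: "E j w - E j (s i w) = f i w"
      if "j \<le> Suc m" "i \<le> m" "i + j \<noteq> m" "i + j \<noteq> Suc m" "w \<in> S" for i j w
      using that
    proof (induction j arbitrary: i w rule: less_induct)
      case (less j)
      show ?case
      proof (cases j)
        case 0
        then show ?thesis using less.prems F(2) by (simp add: E0)
      next
        case (Suc j')
        define k where "k = m - j'"
        have k: "k < N" "k + j' = m" using less.prems Suc m by (auto simp: k_def)
        have i: "i < N" using less.prems m by simp
        have Ej: "E j w' = f k w' + E j' (s k w')" for w' by (simp add: Suc ES k_def)
        have ik: "i \<noteq> k" "Suc i \<noteq> k" using less.prems Suc k by auto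
        show ?thesis
        proof (cases "i = Suc k")
          \<comment> \<open>Two letters of the word are unfolded. By the braid relation
            \<open>s (k + 1)\<close> passes through \<open>s (k + 1) \<circ> s k\<close> and comes
            out as \<open>s k\<close>, for which \<open>E l\<close> satisfies the equation by
            induction.\<close>
          case True
          then have j': "j' > 0" using k less.prems by (cases j') auto
          then obtain l where l: "j' = Suc l" by (cases j') auto
          have kl: "m - l = Suc k" using k l by simp
          have Ej': "E j' w' = f (Suc k) w' + E l (s (Suc k) w')" for w' by (simp add: l ES kl)
          have N: "Suc k < N" using True i by simp
          have "E l (s (Suc k) (s k w)) - E l (s k (s (Suc k) (s k w))) = f k (s (Suc k) (s k w))"
            using less.prems k l N by (intro less.IH) (auto simp: Suc intro!: S)
          then have "E j w - E j (s i w) = f k w + f (Suc k) (s k w) + f k (s (Suc k) (s k w))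
              - (f k (s (Suc k) w) + f (Suc k) (s k (s (Suc k) w)))"
            using s_braid [OF N less.prems(5)] by (simp add: True Ej Ej' algebra_simps)
          then show ?thesis
            unfolding f_braid [OF N less.prems(5)] by (simp add: True add.assoc)
        next
          case False
          have c: "s k (s i w) = s i (s k w)" "f k w + f i (s k w) = f i w + f k (s i w)"
            using s_comm [of i k w] s_comm [of k i w] f_comm [of i k w] f_comm [of k i w]
              k i ik False less.prems(5) by (auto simp: not_less_eq_eq linorder_neq_iff)
          have "E j' (s k w) - E j' (s i (s k w)) = f i (s k w)"
            using less.prems k i ik False by (intro less.IH) (auto simp: Suc intro!: S)
          then have "E j w - E j (s i w) = f k w - f k (s i w) + f i (s k w)"
            by (simp add: Ej c(1) algebra_simps)
          then show ?thesis using c(2) by (simp add: algebra_simps)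
        qed
      qed
    qed
    define F' where "F' = (\<lambda>w. sc (inverse (of_nat (Suc (Suc m)))) (\<Sum>j\<le>Suc m. E j w))"
    have "P F'" unfolding F'_def by (rule P_avg) (rule PE)
    moreover have "F' w - F' (s i w) = f i w" if i: "i < Suc m" and w: "w \<in> S" for i w
    proof -
      \<comment> \<open>The two exchanged cosets: their defects need not equal \<open>f i w\<close>
        singly but add up to twice \<open>f i w\<close>, so the m + 2 defects together still give m
        + 2 times \<open>f i w\<close>.\<close>
      define j where "j = m - i"
      have j: "i + j = m" "j \<le> m" using i by (auto simp: j_def)
      have mj: "m - j = i" using j by simp
      have iN: "i < N" using i m by simp
      define d where "d = (\<lambda>l. E l w - E l (s i w))"
      have "d l = f i w" if "l \<in> {..Suc m} - {j, Suc j}" for l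
        unfolding d_def using that j i w by (intro main) auto
      moreover have "d j + d (Suc j) = f i w + f i w"
        using f_inv [OF iN w] s_inv [OF iN w] by (simp add: d_def ES mj algebra_simps add_eq_0_iff2)
      moreover have "(\<Sum>l\<le>Suc m. d l) = (\<Sum>l\<in>{..Suc m} - {j, Suc j}. d l) + (d j + d (Suc j))"
        using j by (subst sum.subset_diff [of "{j, Suc j}"]) auto
      moreover have "card ({..Suc m} - {j, Suc j}) = m"
        using j by (subst card_Diff_subset) auto
      ultimately have "(\<Sum>l\<le>Suc m. d l) = sc (of_nat m) (f i w) + (f i w + f i w)"
        by (simp add: sum_constant_scale)
      also have "\<dots> = sc (of_nat (Suc (Suc m))) (f i w)"
        using scale_left_distrib [of 1 1 "f i w"] by (simp add: scale_left_distrib)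
      finally have "(\<Sum>l\<le>Suc m. d l) = sc (of_nat (Suc (Suc m))) (f i w)" .
      moreover have "F' w - F' (s i w) = sc (inverse (of_nat (Suc (Suc m)))) (\<Sum>l\<le>Suc m. d l)"
        unfolding F'_def d_def by (simp only: sum_subtractf scale_right_diff_distrib)
      moreover have nz: "of_nat (Suc (Suc m)) \<noteq> (0::complex)"
        by (simp only: of_nat_eq_0_iff)
      ultimately show ?thesis by (simp only: scale_scale left_inverse [OF nz] scale_one)
    qed
    ultimately show ?case by blast
  qed
  then show ?thesis by blast
qed


section \<open>Algebras spanned by generators and their quotients\<close>

text \<open>Common frame for T(V) and T(V) # G. As addition and zero of the record are those of the
  type, the sums, spans and linear maps of the type apply, and closure only has to be checked on the
  generators \<open>M\<close>.\<close>

locale spanned_algebra = vector_space sc + ring R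
  for sc :: "complex \<Rightarrow> 'a::ab_group_add \<Rightarrow> 'a" and R :: "(complex, 'a) module" (structure) +
  fixes M :: "'a set"
  assumes carrier_span: "carrier R = span M"
    and add_R [simp]: "x \<oplus> y = x + y"
    and zero_R [simp]: "\<zero> = 0"
    and smult_R [simp]: "c \<odot> x = sc c x"
    and mult_scale_left: "x \<in> carrier R \<Longrightarrow> y \<in> carrier R \<Longrightarrow> sc c x \<otimes> y = sc c (x \<otimes> y)"
    and mult_scale_right: "x \<in> carrier R \<Longrightarrow> y \<in> carrier R \<Longrightarrow> x \<otimes> sc c y = sc c (x \<otimes> y)"
begin

lemma generator_closed: "m \<in> M \<Longrightarrow> m \<in> carrier R"
  by (simp add: carrier_span span_base)

lemma carrier_subspace: "subspace (carrier R)"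
  by (simp add: carrier_span)

lemma a_inv_eq: "x \<in> carrier R \<Longrightarrow> \<ominus> x = - x"
  by (rule minus_equality) (use carrier_subspace subspace_neg in auto)

lemma minus_eq: "x \<in> carrier R \<Longrightarrow> y \<in> carrier R \<Longrightarrow> x \<ominus> y = x - y"
  by (simp add: a_minus_def a_inv_eq)

text \<open>A ring ideal absorbs scalars because \<open>c x = (c 1) x\<close>.\<close>

lemma ideal_scale:
  assumes "ideal I R" "x \<in> I"
  shows "sc c x \<in> I"
proof -
  interpret I: ideal I R by fact
  have x: "x \<in> carrier R" using assms I.a_subset by auto
  have "sc c \<one> \<otimes> x \<in> I"
    using assms carrier_subspace by (intro I.I_l_closed) (auto intro: subspace_scale)
  then show ?thesis using x by (simp add: mult_scale_left)
qed

lemma ideal_subspace: "ideal I R \<Longrightarrow> subspace I"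
  using ideal_scale additive_subgroup.zero_closed [OF ideal.axioms(1)]
    additive_subgroup.a_closed [OF ideal.axioms(1)]
  by (fastforce intro!: subspaceI)

lemma span_mult_closed:
  assumes E: "E \<subseteq> carrier R" and x: "x \<in> span E" and y: "y \<in> carrier R"
    and left: "\<And>m e. m \<in> M \<Longrightarrow> e \<in> E \<Longrightarrow> m \<otimes> e \<in> span E"
    and right: "\<And>m e. m \<in> M \<Longrightarrow> e \<in> E \<Longrightarrow> e \<otimes> m \<in> span E"
  shows "y \<otimes> x \<in> span E" "x \<otimes> y \<in> span E"
proof -
  have sE: "span E \<subseteq> carrier R"
    by (rule span_minimal) (use E carrier_subspace in auto)
  have l0: "a \<otimes> 0 = 0" "0 \<otimes> a = 0" if "a \<in> carrier R" for a
    using l_null [OF that] r_null [OF that] by simp_all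
  have l1: "a \<otimes> (sc c b + z) = sc c (a \<otimes> b) + a \<otimes> z"
    "(sc c b + z) \<otimes> a = sc c (b \<otimes> a) + z \<otimes> a"
    if "a \<in> carrier R" "b \<in> carrier R" "z \<in> carrier R" for a b c z
    using that l_distr [of "sc c b" z a] r_distr [of "sc c b" z a]
      subspace_scale [OF carrier_subspace that(2)]
    by (simp_all add: mult_scale_left mult_scale_right)
  have sum: "sc c b + z \<in> carrier R" if "b \<in> carrier R" "z \<in> carrier R" for b c z
    using that carrier_subspace subspace_add subspace_scale by blast
  have 1: "x \<in> carrier R \<and> m \<otimes> x \<in> span E \<and> x \<otimes> m \<in> span E" if "m \<in> M" for m
    using x
  proof (induction rule: span_induct_alt)
    case base
    then show ?case using l0 [OF generator_closed [OF that]] subspace_0 [OF carrier_subspace]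
      by (simp add: span_zero)
  next
    case (step c e z)
    have e: "e \<in> carrier R" using E step by blast
    show ?case
      using step left [OF that] right [OF that] sum [OF e] l1 [OF generator_closed [OF that] e]
      by (auto intro!: span_add span_scale)
  qed
  have xR: "x \<in> carrier R" using x sE by auto
  have "y \<in> span M" using y carrier_span by simp
  then have "y \<in> carrier R \<and> y \<otimes> x \<in> span E \<and> x \<otimes> y \<in> span E"
  proof (induction rule: span_induct_alt)
    case base
    then show ?case using l0 [OF xR] subspace_0 [OF carrier_subspace] by (simp add: span_zero)
  next
    case (step c e z)
    show ?case
      using step 1 sum [of e z] l1 [OF xR, of e z] generator_closed [of e]
      by (auto intro!: span_add span_scale)
  qed
  then show "y \<otimes> x \<in> span E" "x \<otimes> y \<in> span E" by auto
qed

text \<open>\<open>Idl\<close> is an intersection of ideals and gives no normal form for its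
  elements. A span that is stable under multiplication by the generators is itself an ideal, which
  bounds \<open>Idl\<close> from above by explicit elements.\<close>

lemma genideal_subset_span:
  assumes E: "E \<subseteq> carrier R" and Y: "Y \<subseteq> span E"
    and left: "\<And>m e. m \<in> M \<Longrightarrow> e \<in> E \<Longrightarrow> m \<otimes> e \<in> span E"
    and right: "\<And>m e. m \<in> M \<Longrightarrow> e \<in> E \<Longrightarrow> e \<otimes> m \<in> span E"
  shows "Idl Y \<subseteq> span E"
proof (rule genideal_minimal)
  have sE: "span E \<subseteq> carrier R"
    by (rule span_minimal) (use E carrier_subspace in auto)
  show "ideal (span E) R"
  proof (rule idealI)
    show "subgroup (span E) (add_monoid R)"
    proof (rule add.subgroupI)
      fix a assume "a \<in> span E"
      then show "\<ominus> a \<in> span E" using sE by (metis a_inv_eq span_neg subsetD)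
    next
      show "span E \<noteq> {}" using span_zero [of E] by blast
    qed (use sE in \<open>auto intro: span_add\<close>)
  next
    fix a x assume "a \<in> span E" "x \<in> carrier R"
    then show "x \<otimes> a \<in> span E" "a \<otimes> x \<in> span E"
      using span_mult_closed [OF E _ _ left right] by simp_all
  qed (rule ring_axioms)
qed fact

lemma coset_eq: "I +> x = (\<lambda>i. i + x) ` I"
  by (auto simp: a_r_coset_def')

lemma coset_eq_iff:
  assumes "subspace I"
  shows "I +> x = I +> y \<longleftrightarrow> x - y \<in> I"
proof
  assume "I +> x = I +> y"
  then have "0 + x \<in> (\<lambda>i. i + y) ` I" using subspace_0 [OF assms] unfolding coset_eq by blast
  then show "x - y \<in> I" by auto
next
  assume xy: "x - y \<in> I"
  show "I +> x = I +> y"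
    unfolding coset_eq
  proof (intro equalityI subsetI)
    fix z assume "z \<in> (\<lambda>i. i + x) ` I"
    then obtain i where i: "i \<in> I" "z = i + x" by auto
    then show "z \<in> (\<lambda>i. i + y) ` I"
      using subspace_add [OF assms i(1) xy] by (intro image_eqI [of _ _ "i + (x - y)"]) auto
  next
    fix z assume "z \<in> (\<lambda>i. i + y) ` I"
    then obtain i where i: "i \<in> I" "z = i + y" by auto
    then show "z \<in> (\<lambda>i. i + x) ` I"
      using subspace_diff [OF assms i(1) xy] by (intro image_eqI [of _ _ "i - (x - y)"]) auto
  qed
qed

lemma quotient_carrier: "carrier (quotient_algebra R I) = (\<lambda>x. I +> x) ` carrier R"
  by (auto simp: quotient_algebra_def ring.defs module.defs FactRing_def A_RCOSETS_def')

lemma quotient_zero: "\<zero>\<^bsub>quotient_algebra R I\<^esub> = I"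
  by (simp add: quotient_algebra_def ring.defs module.defs FactRing_def)

lemma quotient_zero_coset: "subspace I \<Longrightarrow> I +> x = I \<longleftrightarrow> x \<in> I"
  using coset_eq_iff [of I x 0] by (simp add: coset_eq)

lemma quotient_add:
  assumes "subspace I"
  shows "(I +> x) \<oplus>\<^bsub>quotient_algebra R I\<^esub> (I +> y) = I +> (x + y)"
proof -
  have "(I +> x) <+>\<^bsub>R\<^esub> (I +> y) = I +> (x + y)"
  proof (intro equalityI subsetI)
    fix z assume "z \<in> (I +> x) <+>\<^bsub>R\<^esub> (I +> y)"
    then obtain i j where "i \<in> I" "j \<in> I" "z = (i + x) + (j + y)"
      by (auto simp: set_add_def' coset_eq)
    then show "z \<in> I +> (x + y)"
      using subspace_add [OF assms, of i j]
      by (auto simp: coset_eq algebra_simps intro!: image_eqI [of _ _ "i + j"])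
  next
    fix z assume "z \<in> I +> (x + y)"
    then obtain i where "i \<in> I" "z = (i + x) + (0 + y)" by (auto simp: coset_eq algebra_simps)
    then show "z \<in> (I +> x) <+>\<^bsub>R\<^esub> (I +> y)"
      using subspace_0 [OF assms] unfolding set_add_def' coset_eq add_R by blast
  qed
  then show ?thesis
    by (simp add: quotient_algebra_def ring.defs module.defs FactRing_def)
qed

lemma quotient_smult:
  assumes "subspace I"
  shows "c \<odot>\<^bsub>quotient_algebra R I\<^esub> (I +> x) = I +> sc c x"
proof -
  \<comment> \<open>The scalar multiplication of \<open>quotient_algebra\<close> is a union over all
    representatives; each of them contributes the same coset.\<close>
  have "I +> sc c (i + x) = I +> sc c x" if "i \<in> I" for i
    using that assms by (simp add: coset_eq_iff scale_right_distrib subspace_scale)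
  then have "(\<Union>z\<in>I +> x. I +> sc c z) = I +> sc c x"
    using subspace_0 [OF assms] by (auto simp: coset_eq)
  then show ?thesis
    by (simp add: quotient_algebra_def ring.defs module.defs FactRing_def)
qed

end


section \<open>Tensors and multilinear maps\<close>

definition skew_scale :: "complex \<Rightarrow> ('g \<Rightarrow> 'v tensor) \<Rightarrow> 'g \<Rightarrow> 'v tensor" where
  "skew_scale c r = (\<lambda>g. fun_scale c (r g))"

text \<open>The element \<open>t \<otimes> g\<close> of the skew group algebra.\<close>

definition skew_single :: "'g \<Rightarrow> 'a::zero \<Rightarrow> 'g \<Rightarrow> 'a" where
  "skew_single g t = (\<lambda>k. if k = g then t else 0)"

interpretation sk: vector_space skew_scale
  by unfold_locales
    (auto simp: skew_scale_def fun_eq_iff fs.scale_right_distrib fs.scale_left_distrib plus_fun_apply)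

text \<open>Nothing is demanded of lists of other lengths, so that one map on all lists can be
  multilinear in every degree separately.\<close>

definition multilinear_on ::
  "(complex \<Rightarrow> 'v::ab_group_add \<Rightarrow> 'v) \<Rightarrow> (complex \<Rightarrow> 'x::ab_group_add \<Rightarrow> 'x) \<Rightarrow> nat \<Rightarrow> ('v list \<Rightarrow> 'x) \<Rightarrow> bool" where
  "multilinear_on scale sx n F \<longleftrightarrow>
     (\<forall>w p x y c. length w = n \<longrightarrow> p < n \<longrightarrow>
        F (w[p := x + y]) = F (w[p := x]) + F (w[p := y]) \<and>
        F (w[p := scale c x]) = sx c (F (w[p := x])))"

lemma complex_mult_vector_space: "vector_space ((*) :: complex \<Rightarrow> _)"
  by unfold_locales (auto simp: algebra_simps)

lemma multilinear_onD:
  assumes "multilinear_on scale sx n F" "length w = n" "p < n"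
  shows "F (w[p := x + y]) = F (w[p := x]) + F (w[p := y])"
    "F (w[p := scale c x]) = sx c (F (w[p := x]))"
  using assms by (auto simp: multilinear_on_def)

lemma multilinear_on_append:
  assumes "multilinear_on scale sx n F" "Suc (length v + length w) = n"
  shows "F (v @ (x + y) # w) = F (v @ x # w) + F (v @ y # w)"
    "F (v @ scale c x # w) = sx c (F (v @ x # w))"
  using multilinear_onD [OF assms(1), of "v @ x # w" "length v"] assms(2) by simp_all

lemma skew_single_simps:
  "skew_single g (s + t) = skew_single g s + skew_single g t"
  "skew_single g (s - t) = skew_single g s - (skew_single g t :: _ \<Rightarrow> _ :: ab_group_add)"
  "skew_single g (fun_scale c u) = skew_scale c (skew_single g u)"
  "skew_single g 0 = 0"
  by (auto simp: skew_single_def skew_scale_def fun_eq_iff fun_scale_def plus_fun_apply zero_fun_apply)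

lemma skew_single_apply: "skew_single g t k = (if k = g then t else 0)"
  by (simp add: skew_single_def)

lemma sum_fun_apply: "(\<Sum>i\<in>A. f i) x = (\<Sum>i\<in>A. f i x)"
  by (induction A rule: infinite_finite_induct) (auto simp: plus_fun_apply zero_fun_apply)

section \<open>The skew group algebra T(V) # G in terms of pure tensors\<close>

locale group_rep = group G + V: finite_dimensional_vector_space scale B
  for G :: "('g, 'm) monoid_scheme" (structure)
    and scale :: "complex \<Rightarrow> 'v::ab_group_add \<Rightarrow> 'v" and B :: "'v set" +
  fixes \<rho> :: "'g \<Rightarrow> 'v \<Rightarrow> 'v"
  assumes finite_G: "finite (carrier G)" and rep: "linear_rep G scale \<rho>"
begin

abbreviation P :: "'v list \<Rightarrow> 'v tensor" where "P \<equiv> pure_tensor scale"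
abbreviation T :: "(complex, 'v tensor) module" where "T \<equiv> tensor_algebra scale"
abbreviation H :: "(complex, 'g \<Rightarrow> 'v tensor) module" where "H \<equiv> tensor_skew G scale \<rho>"
abbreviation multilin :: "(complex \<Rightarrow> 'x::ab_group_add \<Rightarrow> 'x) \<Rightarrow> nat \<Rightarrow> ('v list \<Rightarrow> 'x) \<Rightarrow> bool" where
  "multilin \<equiv> multilinear_on scale"

lemma rho_linear: "g \<in> carrier G \<Longrightarrow> Vector_Spaces.linear scale scale (\<rho> g)"
  using rep by (simp add: linear_rep_def)

lemma rho_add: "g \<in> carrier G \<Longrightarrow> \<rho> g (x + y) = \<rho> g x + \<rho> g y"
  using rho_linear [of g] by (simp add: Vector_Spaces.linear_iff)

lemma rho_scale: "g \<in> carrier G \<Longrightarrow> \<rho> g (scale c x) = scale c (\<rho> g x)"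
  using rho_linear [of g] by (simp add: Vector_Spaces.linear_iff)

lemma rho_one [simp]: "\<rho> \<one> = id"
  using rep by (simp add: linear_rep_def)

lemma rho_mult: "g \<in> carrier G \<Longrightarrow> h \<in> carrier G \<Longrightarrow> \<rho> (g \<otimes> h) = \<rho> g \<circ> \<rho> h"
  using rep by (simp add: linear_rep_def)

lemma rho_inv: "g \<in> carrier G \<Longrightarrow> \<rho> g (\<rho> (inv g) v) = v" "g \<in> carrier G \<Longrightarrow> \<rho> (inv g) (\<rho> g v) = v"
  using rho_mult [of g "inv g"] rho_mult [of "inv g" g] by (simp_all add: fun_eq_iff)

sublocale T: spanned_algebra fun_scale T "range P"
proof -
  interpret ring T by (rule tensor_algebra_ring)
  show "spanned_algebra fun_scale T (range P)"
    by unfold_locales (auto simp: tmul_linear)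
qed

lemmas [simp del] = tensor_algebra_simps(1)

lemma H_carrier: "r \<in> carrier H \<longleftrightarrow> (\<forall>g\<in>carrier G. r g \<in> carrier T) \<and> (\<forall>g. g \<notin> carrier G \<longrightarrow> r g = 0)"
  by (simp add: tensor_skew_def skew_group_algebra_def)

lemma P_in_T [simp]: "P w \<in> carrier T"
  by (simp add: T.generator_closed)

lemma T_subspace: "fs.subspace (carrier T)"
  by (rule T.carrier_subspace)

lemma H_carrier_single [simp]: "g \<in> carrier G \<Longrightarrow> t \<in> carrier T \<Longrightarrow> skew_single g t \<in> carrier H"
  using fs.subspace_0 [OF T_subspace] by (auto simp: H_carrier skew_single_apply)

lemma H_eq_sum_single:
  assumes "r \<in> carrier H"
  shows "r = (\<Sum>g\<in>carrier G. skew_single g (r g))"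
proof
  fix k
  show "r k = (\<Sum>g\<in>carrier G. skew_single g (r g)) k"
    using assms finite_G by (auto simp: sum_fun_apply skew_single_apply H_carrier)
qed

lemma H_carrier_span:
  "carrier H = sk.span {skew_single g (P w) |g w. g \<in> carrier G}" (is "_ = sk.span ?M")
proof
  show "sk.span ?M \<subseteq> carrier H"
  proof (rule sk.span_minimal)
    show "sk.subspace (carrier H)"
      using T_subspace
      by (auto simp: sk.subspace_def H_carrier fs.subspace_def skew_scale_def plus_fun_apply zero_fun_apply)
  qed auto
  have "skew_single g t \<in> sk.span ?M" if "g \<in> carrier G" "t \<in> carrier T" for g t
  proof -
    have "t \<in> fs.span (range P)" using that by (simp add: T.carrier_span)
    then show ?thesis
    proof (induction rule: fs.span_induct_alt)
      case base
      then show ?case by (simp add: skew_single_simps sk.span_zero)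
    next
      case (step c x y)
      then show ?case using that
        by (auto simp: skew_single_simps intro!: sk.span_add sk.span_scale intro: sk.span_base)
    qed
  qed
  then have "r \<in> sk.span ?M" if "r \<in> carrier H" for r
    using that by (subst H_eq_sum_single [OF that]) (auto simp: H_carrier intro!: sk.span_sum)
  then show "carrier H \<subseteq> sk.span ?M" by blast
qed

lemma H_ring: "ring H"
  by (rule tensor_skew_ring) (use finite_G rep group_axioms in auto)

lemma H_ops: "\<zero>\<^bsub>H\<^esub> = 0" "x \<oplus>\<^bsub>H\<^esub> y = x + y" "c \<odot>\<^bsub>H\<^esub> x = skew_scale c x"
  "\<one>\<^bsub>H\<^esub> = skew_single \<one> (P [])"
  by (auto simp: tensor_skew_def skew_group_algebra_def fun_eq_iff plus_fun_apply zero_fun_apply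
      skew_scale_def skew_single_def)

lemmas H_mult = tensor_skew_mult [OF group_axioms finite_G rep]

sublocale H: spanned_algebra skew_scale H "{skew_single g (P w) |g w. g \<in> carrier G}"
proof -
  interpret ring H by (rule H_ring)
  have sc: "skew_scale c x \<in> carrier H" if "x \<in> carrier H" for c x
    using that by (simp add: H_carrier_span sk.span_scale)
  have "skew_scale c x \<otimes>\<^bsub>H\<^esub> y = skew_scale c (x \<otimes>\<^bsub>H\<^esub> y)"
    "x \<otimes>\<^bsub>H\<^esub> skew_scale c y = skew_scale c (x \<otimes>\<^bsub>H\<^esub> y)"
    if "x \<in> carrier H" "y \<in> carrier H" for x y c
    unfolding H_mult [OF that] H_mult [OF sc [OF that(1)] that(2)] H_mult [OF that(1) sc [OF that(2)]]
    by (rule ext; simp add: skew_scale_def tmul_linear tensor_act_linear fs.scale_sum_right)+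
  then show "spanned_algebra skew_scale H {skew_single g (P w) |g w. g \<in> carrier G}"
    by unfold_locales (auto simp: H_ops H_carrier_span)
qed

lemma single_mult:
  assumes "g \<in> carrier G" "h \<in> carrier G" "s \<in> carrier T" "t \<in> carrier T"
  shows "skew_single g s \<otimes>\<^bsub>H\<^esub> skew_single h t = skew_single (g \<otimes> h) (tmul s (tensor_act \<rho> g t))"
proof
  fix k
  have *: "inv g \<otimes> k = h \<longleftrightarrow> k = g \<otimes> h" if "k \<in> carrier G"
    using assms that by (metis inv_solve_left)
  have "(\<Sum>l\<in>carrier G. tmul (skew_single g s l) (tensor_act \<rho> l (skew_single h t (inv l \<otimes> k)))) =
     (\<Sum>l\<in>carrier G. if l = g then tmul s (tensor_act \<rho> g (skew_single h t (inv g \<otimes> k))) else 0)"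
    by (intro sum.cong) (auto simp: skew_single_apply tmul_linear)
  also have "\<dots> = tmul s (tensor_act \<rho> g (skew_single h t (inv g \<otimes> k)))"
    using finite_G assms by simp
  finally show "(skew_single g s \<otimes>\<^bsub>H\<^esub> skew_single h t) k = skew_single (g \<otimes> h) (tmul s (tensor_act \<rho> g t)) k"
    using assms *
    by (auto simp: H_mult skew_single_apply tmul_linear tensor_act_linear)
qed

lemma tmul_P: "tmul (P v) (P w) = P (v @ w)"
  using pure_tensor_append [of scale v w] by simp

lemma single_mult_P:
  assumes "g \<in> carrier G" "h \<in> carrier G"
  shows "skew_single g (P v) \<otimes>\<^bsub>H\<^esub> skew_single h (P w) = skew_single (g \<otimes> h) (P (v @ map (\<rho> g) w))"
  using assms by (simp add: single_mult tensor_act_pure_tensor [OF group_axioms rep] tmul_P)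

section \<open>Independence of basis words and the universal property of T(V)\<close>

lemma P_update:
  assumes "p < length w"
  shows "P (w[p := x]) \<phi>s = (if set \<phi>s \<subseteq> dual_space scale \<and> length \<phi>s = length w
    then (\<phi>s ! p) x * (\<Prod>i\<in>{..<length w} - {p}. (\<phi>s ! i) (w ! i)) else 0)"
  using assms
  by (auto simp: pure_tensor_def prod.remove [of "{..<length w}" p] intro!: prod.cong)

lemma multilin_P: "multilin fun_scale n P"
proof -
  have *: "(\<phi>s ! p) (x + y) = (\<phi>s ! p) x + (\<phi>s ! p) y \<and> (\<phi>s ! p) (scale c x) = c * (\<phi>s ! p) x"
    if "set \<phi>s \<subseteq> dual_space scale" "p < length \<phi>s" for \<phi>s p x y c
  proof -
    have "\<phi>s ! p \<in> dual_space scale" using that nth_mem by blast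
    then show ?thesis by (simp add: dual_space_def Vector_Spaces.linear_iff)
  qed
  show ?thesis
    unfolding multilinear_on_def
    by (auto simp: fun_eq_iff P_update fun_scale_def plus_fun_apply * distrib_right)
qed

definition coord :: "'v \<Rightarrow> 'v \<Rightarrow> complex" where
  "coord b v = V.representation B v b"

lemma coord_dual: "coord b \<in> dual_space scale"
  unfolding dual_space_def coord_def
  by (auto simp: Vector_Spaces.linear_iff V.representation_add V.representation_scale V.independent_Basis V.span_Basis
      V.vector_space_axioms complex_mult_vector_space)

lemma P_coord:
  assumes "set w \<subseteq> B" "set w' \<subseteq> B"
  shows "P w (map coord w') = (if w = w' then 1 else 0)"
proof (cases "length w = length w'")
  case True
  have "P w (map coord w') = (\<Prod>i<length w. coord (w' ! i) (w ! i))"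
    using True coord_dual by (auto simp: pure_tensor_def)
  also have "\<dots> = (\<Prod>i<length w. if w ! i = w' ! i then 1 else 0)"
    using assms by (intro prod.cong)
      (auto simp: coord_def V.representation_basis V.independent_Basis subset_iff)
  also have "\<dots> = (if w = w' then 1 else 0)"
    using True by (auto simp: list_eq_iff_nth_eq)
  finally show ?thesis .
qed (auto simp: pure_tensor_def)

text \<open>The words \<open>map coord w\<close> in the dual basis are dual to the
  \<open>P w\<close>, so evaluating a linear relation at one of them reads off a single
  coefficient.\<close>

lemma P_words_independent: "fs.independent (P ` {w. set w \<subseteq> B})"
proof
  assume "fs.dependent (P ` {w. set w \<subseteq> B})"
  then obtain t u v where t: "finite t" "t \<subseteq> P ` {w. set w \<subseteq> B}" "(\<Sum>v\<in>t. fun_scale (u v) v) = 0"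
    "v \<in> t" "u v \<noteq> 0"
    by (auto simp: fs.dependent_explicit)
  then obtain w where w: "v = P w" "set w \<subseteq> B" by auto
  have "0 = (\<Sum>v\<in>t. fun_scale (u v) v) (map coord w)" by (simp add: t(3) zero_fun_apply)
  also have "\<dots> = (\<Sum>x\<in>t. if x = v then u v else 0)"
    unfolding sum_fun_apply
  proof (rule sum.cong)
    fix x assume "x \<in> t"
    then obtain w' where w': "x = P w'" "set w' \<subseteq> B" using t by auto
    have "x (map coord w) = (if w' = w then 1 else 0)" using w w' by (simp add: P_coord)
    moreover have "v (map coord w) = 1" using w by (simp add: P_coord)
    ultimately show "fun_scale (u x) x (map coord w) = (if x = v then u v else 0)"
      using w(1) w'(1) by (cases "w' = w") (simp_all add: fun_scale_def, force)
  qed simp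
  also have "\<dots> = u v" using t(1,4) by simp
  finally show False using t(5) by simp
qed

text \<open>The universal property of T(V), which the realisation of tensors as functions does not
  give for free. \<open>L\<close> is prescribed on the independent words in \<open>B\<close> and
  then shown to agree with \<open>F\<close> on all words.\<close>

lemma multilinear_extension:
  fixes F :: "'v list \<Rightarrow> 'x::ab_group_add"
  assumes sx: "vector_space sx" and F: "\<And>n. multilin sx n F"
  obtains L where "Vector_Spaces.linear fun_scale sx L" "\<And>w. L (P w) = F w"
proof -
  interpret X: vector_space sx by fact
  note pair = vector_space_pair.intro [OF fs.vector_space_axioms sx]
  have inj: "inj_on P {w. set w \<subseteq> B}"
  proof (rule inj_onI)
    fix w w' assume w: "w \<in> {w. set w \<subseteq> B}" "w' \<in> {w. set w \<subseteq> B}" and eq: "P w = P w'"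
    have "P w (map coord w) = 1" "P w' (map coord w) = (if w' = w then 1 else 0)"
      using w by (simp_all add: P_coord)
    then show "w = w'" unfolding eq by (metis zero_neq_one)
  qed
  obtain L where L: "Vector_Spaces.linear fun_scale sx L"
    "\<And>x. x \<in> P ` {w. set w \<subseteq> B} \<Longrightarrow> L x = F (inv_into {w. set w \<subseteq> B} P x)"
    using vector_space_pair.linear_independent_extend [OF pair P_words_independent,
        of "\<lambda>x. F (inv_into {w. set w \<subseteq> B} P x)"] by blast
  have LB: "L (P w) = F w" if "set w \<subseteq> B" for w
    using that L(2) inj by simp
  have Ladd: "L (x + y) = L x + L y" and Lsc: "L (fun_scale c x) = sx c (L x)" for x y c
    using L(1) by (auto simp: Vector_Spaces.linear_iff)
  \<comment> \<open>The requirement of being basis vectors is lifted one entry at a time: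
    \<open>v\<close> is arbitrary, \<open>w\<close> is still a word in \<open>B\<close>, and the
    last entry of \<open>v\<close> is expanded in \<open>B\<close>.\<close>
  have "L (P (v @ w)) = F (v @ w)" if "set w \<subseteq> B" for v w
    using that
  proof (induction v arbitrary: w rule: rev_induct)
    case Nil
    then show ?case using LB by simp
  next
    case (snoc a v)
    let ?n = "Suc (length v + length w)"
    note FL = multilinear_on_append [OF F [of ?n] refl] multilinear_on_append [OF multilin_P [of ?n] refl]
    have "a \<in> V.span B" using V.span_Basis by simp
    then have "L (P (v @ a # w)) = F (v @ a # w)"
    proof (induction rule: V.span_induct_alt)
      case base
      have "P (v @ 0 # w) = 0" using FL(4) [of 0 0] by simp
      moreover have "F (v @ 0 # w) = 0" using FL(2) [of 0 0] by simp
      ultimately show ?case using Lsc [of 0 0] by simp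
    next
      case (step c x y)
      have "L (P (v @ x # w)) = F (v @ x # w)" using snoc.IH [of "x # w"] step snoc.prems by simp
      then show ?case using step by (simp add: FL Ladd Lsc)
    qed
    then show ?case by simp
  qed
  from this [of "[]"] have "L (P w) = F w" for w by simp
  with L(1) show ?thesis by (rule that)
qed

end


section \<open>Adjacent transpositions and contraction with a skew form\<close>

definition swap_adjacent :: "nat \<Rightarrow> 'a list \<Rightarrow> 'a list" where
  "swap_adjacent i w = w[i := w ! Suc i, Suc i := w ! i]"

lemma length_swap_adjacent [simp]: "length (swap_adjacent i w) = length w"
  by (simp add: swap_adjacent_def)

lemma swap_adjacent_append:
  "length A = i \<Longrightarrow> swap_adjacent i (A @ a # b # D) = A @ b # a # D"
  by (simp add: swap_adjacent_def nth_append list_update_append)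

lemma split_at_adjacent:
  assumes "Suc i < length w"
  obtains A a b D where "w = A @ a # b # D" "length A = i"
proof (rule that)
  show "w = take i w @ w ! i # w ! Suc i # drop (Suc (Suc i)) w"
    using assms by (metis Cons_nth_drop_Suc Suc_lessD id_take_nth_drop)
qed (use assms in simp)

lemma swap_adjacent_update:
  assumes "Suc i < length w" "p < length w"
  shows "swap_adjacent i (w[p := x]) =
    (swap_adjacent i w)[(if p = i then Suc i else if p = Suc i then i else p) := x]"
  using assms by (auto simp: swap_adjacent_def list_eq_iff_nth_eq nth_list_update)

lemma swap_adjacent_inverse: "Suc i < length w \<Longrightarrow> swap_adjacent i (swap_adjacent i w) = w"
  by (auto simp: swap_adjacent_def list_eq_iff_nth_eq nth_list_update)

lemma swap_adjacent_commute:
  "Suc i < j \<Longrightarrow> Suc j < length w \<Longrightarrow>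
    swap_adjacent i (swap_adjacent j w) = swap_adjacent j (swap_adjacent i w)"
  by (auto simp: swap_adjacent_def list_eq_iff_nth_eq nth_list_update)

lemma swap_adjacent_braid:
  "Suc (Suc i) < length w \<Longrightarrow>
    swap_adjacent i (swap_adjacent (Suc i) (swap_adjacent i w)) =
    swap_adjacent (Suc i) (swap_adjacent i (swap_adjacent (Suc i) w))"
  by (auto simp: swap_adjacent_def list_eq_iff_nth_eq nth_list_update)

lemma multilinear_on_add:
  assumes "vector_space sx" "multilinear_on scale sx n F" "multilinear_on scale sx n F'"
  shows "multilinear_on scale sx n (\<lambda>w. F w + F' w)"
proof -
  interpret vector_space sx by fact
  show ?thesis using assms(2,3)
    by (auto simp: multilinear_on_def scale_right_distrib)
qed

lemma multilinear_on_scale: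
  assumes "vector_space sx" "multilinear_on scale sx n F"
  shows "multilinear_on scale sx n (\<lambda>w. sx c (F w))"
proof -
  interpret vector_space sx by fact
  show ?thesis using assms(2)
    by (auto simp: multilinear_on_def scale_right_distrib mult.commute)
qed

lemma multilinear_on_sum:
  assumes "vector_space sx" "\<And>i. i \<in> I \<Longrightarrow> multilinear_on scale sx n (F i)"
  shows "multilinear_on scale sx n (\<lambda>w. \<Sum>i\<in>I. F i w)"
proof -
  interpret vector_space sx by fact
  show ?thesis
    using assms(2)
  proof (induction I rule: infinite_finite_induct)
    case (insert i I)
    then show ?case using multilinear_on_add [OF assms(1), of scale n "F i" "\<lambda>w. \<Sum>i\<in>I. F i w"]
      by simp
  qed (simp_all add: multilinear_on_def)
qed

lemma multilinear_on_swap: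
  assumes "multilinear_on scale sx n F" "Suc i < n"
  shows "multilinear_on scale sx n (\<lambda>w. F (swap_adjacent i w))"
  unfolding multilinear_on_def
proof (intro allI impI)
  fix w :: "'a list" and p x y c assume w: "length w = n" "p < n"
  have "(if p = i then Suc i else if p = Suc i then i else p) < n" using w assms(2) by simp
  then show "F (swap_adjacent i (w[p := x + y])) =
      F (swap_adjacent i (w[p := x])) + F (swap_adjacent i (w[p := y])) \<and>
    F (swap_adjacent i (w[p := scale c x])) = sx c (F (swap_adjacent i (w[p := x])))"
    using w assms(2) multilinear_onD [OF assms(1), of "swap_adjacent i w"]
    by (simp only: swap_adjacent_update length_swap_adjacent)
qed

section \<open>The symmetric ideal and congruence of leading terms\<close>

context group_rep
begin

abbreviation J :: "'v tensor set" where "J \<equiv> symmetric_ideal scale"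

definition commutator_in :: "'v list \<Rightarrow> 'v \<Rightarrow> 'v \<Rightarrow> 'v list \<Rightarrow> 'v tensor" where
  "commutator_in A v w D = P (A @ v # w # D) - P (A @ w # v # D)"

lemma tensor_commutator_eq: "tensor_commutator scale v w = commutator_in [] v w []"
  by (simp add: tensor_commutator_def commutator_in_def T.minus_eq)

lemma commutator_in_T [simp]: "commutator_in A v w D \<in> carrier T"
  unfolding commutator_in_def by (intro fs.subspace_diff [OF T_subspace]) simp_all

lemma tmul_diff: "tmul a (b - c) = tmul a b - tmul a c" "tmul (a - b) c = tmul a c - tmul b c"
  using tmul_linear(2) [of a "b - c" c] tmul_linear(1) [of "a - b" b c] by simp_all

lemma tmul_commutator:
  "tmul (P C) (commutator_in A v w D) = commutator_in (C @ A) v w D"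
  "tmul (commutator_in A v w D) (P C) = commutator_in A v w (D @ C)"
  by (simp_all add: commutator_in_def tmul_diff tmul_P)

lemma J_ideal: "ideal J T"
  unfolding symmetric_ideal_def
  by (rule T.genideal_ideal) (auto simp: tensor_commutator_eq)

lemma J_subspace: "fs.subspace J"
  by (rule T.ideal_subspace [OF J_ideal])

lemma J_eq_span: "J = fs.span {commutator_in A v w D |A v w D. True}" (is "_ = fs.span ?E")
proof
  define E where "E = ?E"
  have span: "commutator_in A v w D \<in> fs.span E" for A v w D
    unfolding E_def by (rule fs.span_base) blast
  have E: "\<exists>A v w D. e = commutator_in A v w D" if "e \<in> E" for e
    using that by (auto simp: E_def)
  have "J \<subseteq> fs.span E"
    unfolding symmetric_ideal_def
    by (rule T.genideal_subset_span) (use E in \<open>fastforce simp: tensor_commutator_eq tmul_commutator span\<close>)+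
  then show "J \<subseteq> fs.span ?E" by (simp add: E_def)
  have "commutator_in A v w D \<in> J" for A v w D
  proof -
    have "commutator_in [] v w [] \<in> J"
      unfolding symmetric_ideal_def
      by (rule subsetD [OF T.genideal_self]) (auto simp: tensor_commutator_eq)
    then have "tmul (P A) (tmul (commutator_in [] v w []) (P D)) \<in> J"
      using ideal.I_l_closed [OF J_ideal] ideal.I_r_closed [OF J_ideal]
      by (metis P_in_T tensor_algebra_simps(2))
    then show ?thesis by (simp add: tmul_commutator)
  qed
  then show "fs.span ?E \<subseteq> J"
    by (intro fs.span_minimal J_subspace) auto
qed

lemma commutator_in_J: "commutator_in A v w D \<in> J"
  unfolding J_eq_span by (rule fs.span_base) blast

lemma swap_mod_J: "Suc i < length w \<Longrightarrow> P (swap_adjacent i w) - P w \<in> J"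
  by (rule split_at_adjacent, assumption)
    (simp add: swap_adjacent_append, simp flip: commutator_in_def add: commutator_in_J)

text \<open>Congruence modulo \<open>lower n\<close> means equality in S(V) up to terms of degree
  below \<open>n\<close>. The symmetric ideal is included in all degrees, so \<open>lower 0\<close>
  is that ideal.\<close>

definition lower :: "nat \<Rightarrow> 'v tensor set" where
  "lower n = fs.span (J \<union> {P w |w. length w < n})"

lemma lower_subspace: "fs.subspace (lower n)"
  by (simp add: lower_def)

lemma J_lower: "J \<subseteq> lower n"
  unfolding lower_def using fs.span_superset by blast

lemma P_lower: "length w < n \<Longrightarrow> P w \<in> lower n"
  unfolding lower_def by (rule fs.span_base) blast

lemma lower_mono: "m \<le> n \<Longrightarrow> lower m \<subseteq> lower n"
  unfolding lower_def by (rule fs.span_mono) auto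

definition skew_lower :: "nat \<Rightarrow> ('g \<Rightarrow> 'v tensor) set" where
  "skew_lower n = {r. \<forall>g. r g \<in> lower n}"

lemma skew_lower_subspace: "sk.subspace (skew_lower n)"
  using lower_subspace [of n]
  by (auto simp: sk.subspace_def fs.subspace_def skew_lower_def skew_scale_def plus_fun_apply zero_fun_apply)

lemma skew_lower_mono: "m \<le> n \<Longrightarrow> skew_lower m \<subseteq> skew_lower n"
  using lower_mono [of m n] by (auto simp: skew_lower_def)

lemma single_skew_lower: "t \<in> lower n \<Longrightarrow> skew_single g t \<in> skew_lower n"
  using fs.subspace_0 [OF lower_subspace] by (auto simp: skew_lower_def skew_single_apply)

end

section \<open>Skew forms and their contraction with words\<close>

locale hecke_form = group_rep G scale B \<rho>
  for G :: "('g, 'm) monoid_scheme" (structure)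
    and scale :: "complex \<Rightarrow> 'v::ab_group_add \<Rightarrow> 'v" and B \<rho> +
  fixes \<kappa> :: "'v \<Rightarrow> 'v \<Rightarrow> 'g \<Rightarrow> complex"
  assumes kappa: "bilinear_skew G scale \<kappa>"
begin

lemma kappa_outside: "g \<notin> carrier G \<Longrightarrow> \<kappa> v w g = 0"
  using kappa unfolding bilinear_skew_def group_algebra_carrier_def by blast

lemma kappa_linear:
  "\<kappa> (x + y) w g = \<kappa> x w g + \<kappa> y w g" "\<kappa> v (x + y) g = \<kappa> v x g + \<kappa> v y g"
  "\<kappa> (scale c x) w g = c * \<kappa> x w g" "\<kappa> v (scale c x) g = c * \<kappa> v x g"
proof -
  have "Vector_Spaces.linear scale fun_scale (\<lambda>v. \<kappa> v w)" for w
    using kappa unfolding bilinear_skew_def by blast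
  then show "\<kappa> (x + y) w g = \<kappa> x w g + \<kappa> y w g" "\<kappa> (scale c x) w g = c * \<kappa> x w g"
    by (simp_all add: Vector_Spaces.linear_iff fun_scale_def plus_fun_apply)
  have "Vector_Spaces.linear scale fun_scale (\<lambda>w. \<kappa> v w)" for v
    using kappa unfolding bilinear_skew_def by blast
  then show "\<kappa> v (x + y) g = \<kappa> v x g + \<kappa> v y g" "\<kappa> v (scale c x) g = c * \<kappa> v x g"
    by (simp_all add: Vector_Spaces.linear_iff fun_scale_def plus_fun_apply)
qed

lemma kappa_skew: "\<kappa> v w g = - \<kappa> w v g"
proof -
  have "\<kappa> v w = - \<kappa> w v" using kappa unfolding bilinear_skew_def by blast
  then show ?thesis by (simp add: fun_Compl_def)
qed

text \<open>\<open>\<Phi> w g\<close> stands for the value of a linear map at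
  \<open>P w \<otimes> g\<close>. The contraction is its value after the neighbours at
  \<open>i\<close> and \<open>i + 1\<close> are replaced by the group algebra element \<kappa> of
  the pair, with each h moved to the right by \<open>h d = (\<rho> h d) h\<close> until it meets
  \<open>g\<close>.\<close>

definition kappa_contract ::
  "('v list \<Rightarrow> 'g \<Rightarrow> 'g \<Rightarrow> 'v tensor) \<Rightarrow> nat \<Rightarrow> 'v list \<Rightarrow> 'g \<Rightarrow> 'g \<Rightarrow> 'v tensor" where
  "kappa_contract \<Phi> i w g = (\<Sum>h\<in>carrier G. skew_scale (\<kappa> (w ! i) (w ! Suc i) h)
     (\<Phi> (take i w @ map (\<rho> h) (drop (Suc (Suc i)) w)) (h \<otimes> g)))"

lemma kappa_contract_append:
  assumes "length A = i"
  shows "kappa_contract \<Phi> i (A @ a # b # D) g =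
    (\<Sum>h\<in>carrier G. skew_scale (\<kappa> a b h) (\<Phi> (A @ map (\<rho> h) D) (h \<otimes> g)))"
  using assms by (simp add: kappa_contract_def nth_append)

lemma multilin_kappa_contract:
  assumes \<Phi>: "\<And>g. g \<in> carrier G \<Longrightarrow> multilin skew_scale m (\<lambda>w. \<Phi> w g)" and g: "g \<in> carrier G"
    and i: "i \<le> m"
  shows "multilin skew_scale (Suc (Suc m)) (\<lambda>w. kappa_contract \<Phi> i w g)"
  unfolding kappa_contract_def
proof (rule multilinear_on_sum [OF sk.vector_space_axioms])
  fix h assume h: "h \<in> carrier G"
  then have hg: "h \<otimes> g \<in> carrier G" using g by simp
  show "multilin skew_scale (Suc (Suc m)) (\<lambda>w. skew_scale (\<kappa> (w ! i) (w ! Suc i) h)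
     (\<Phi> (take i w @ map (\<rho> h) (drop (Suc (Suc i)) w)) (h \<otimes> g)))"
    unfolding multilinear_on_def
  proof (intro allI impI)
    fix w :: "'v list" and p x y c
    assume w: "length w = Suc (Suc m)" and p: "p < Suc (Suc m)"
    define U where "U z = take i (w[p := z]) @ map (\<rho> h) (drop (Suc (Suc i)) (w[p := z]))" for z
    define \<alpha> where "\<alpha> z = \<kappa> (w[p := z] ! i) (w[p := z] ! Suc i) h" for z
    let ?u = "take i w @ map (\<rho> h) (drop (Suc (Suc i)) w)"
    have len: "length ?u = m" using w i by simp
    \<comment> \<open>The varied entry enters either the coefficient \<alpha> or the shortened word
      \<open>U\<close>, never both, so each summand is linear in it.\<close>
    have "(\<alpha> (x + y) = \<alpha> x + \<alpha> y \<and> \<alpha> (scale c x) = c * \<alpha> x \<and> (\<forall>z. U z = ?u)) \<or>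
      ((\<forall>z. \<alpha> z = \<kappa> (w ! i) (w ! Suc i) h) \<and>
        \<Phi> (U (x + y)) (h \<otimes> g) = \<Phi> (U x) (h \<otimes> g) + \<Phi> (U y) (h \<otimes> g) \<and>
        \<Phi> (U (scale c x)) (h \<otimes> g) = skew_scale c (\<Phi> (U x) (h \<otimes> g)))"
    proof -
      consider "p < i" | "p = i" | "p = Suc i" | "p > Suc i" by linarith
      then show ?thesis
      proof cases
        case 1
        then have "U z = ?u[p := z]" for z
          using w p i by (simp add: U_def take_update_swap list_update_append)
        moreover have "\<alpha> z = \<kappa> (w ! i) (w ! Suc i) h" for z using 1 by (simp add: \<alpha>_def)
        ultimately show ?thesis using multilinear_onD [OF \<Phi> [OF hg] len, of p] 1 i by simp
      next
        case 2
        then show ?thesis using w i by (simp add: U_def \<alpha>_def kappa_linear)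
      next
        case 3
        then show ?thesis using w i by (simp add: U_def \<alpha>_def kappa_linear)
      next
        case 4
        \<comment> \<open>Beyond the contracted pair, entry \<open>p\<close> moves to place
          \<open>p - 2\<close> and is hit by the linear map \<open>\<rho> h\<close>.\<close>
        then have "\<not> p - 2 < i" "p - 2 - i = p - Suc (Suc i)" by simp_all
        with 4 have "U z = ?u[p - 2 := \<rho> h z]" for z
          using w p i by (simp add: U_def drop_update_swap map_update list_update_append)
        moreover have "\<alpha> z = \<kappa> (w ! i) (w ! Suc i) h" for z using 4 by (simp add: \<alpha>_def)
        moreover have "p - 2 < m" using 4 p by simp
        ultimately show ?thesis using multilinear_onD [OF \<Phi> [OF hg] len, of "p - 2"]
          by (simp add: rho_add [OF h] rho_scale [OF h])
      qed
    qed
    then have "skew_scale (\<alpha> (x + y)) (\<Phi> (U (x + y)) (h \<otimes> g)) =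
        skew_scale (\<alpha> x) (\<Phi> (U x) (h \<otimes> g)) + skew_scale (\<alpha> y) (\<Phi> (U y) (h \<otimes> g)) \<and>
      skew_scale (\<alpha> (scale c x)) (\<Phi> (U (scale c x)) (h \<otimes> g)) =
        skew_scale c (skew_scale (\<alpha> x) (\<Phi> (U x) (h \<otimes> g)))"
      by (auto simp: sk.scale_left_distrib sk.scale_right_distrib mult.commute)
    then show "skew_scale (\<kappa> (w[p := x + y] ! i) (w[p := x + y] ! Suc i) h)
         (\<Phi> (take i (w[p := x + y]) @ map (\<rho> h) (drop (Suc (Suc i)) (w[p := x + y]))) (h \<otimes> g)) =
        skew_scale (\<kappa> (w[p := x] ! i) (w[p := x] ! Suc i) h)
         (\<Phi> (take i (w[p := x]) @ map (\<rho> h) (drop (Suc (Suc i)) (w[p := x]))) (h \<otimes> g)) +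
        skew_scale (\<kappa> (w[p := y] ! i) (w[p := y] ! Suc i) h)
         (\<Phi> (take i (w[p := y]) @ map (\<rho> h) (drop (Suc (Suc i)) (w[p := y]))) (h \<otimes> g)) \<and>
        skew_scale (\<kappa> (w[p := scale c x] ! i) (w[p := scale c x] ! Suc i) h)
         (\<Phi> (take i (w[p := scale c x]) @ map (\<rho> h) (drop (Suc (Suc i)) (w[p := scale c x])))
           (h \<otimes> g)) =
        skew_scale c (skew_scale (\<kappa> (w[p := x] ! i) (w[p := x] ! Suc i) h)
         (\<Phi> (take i (w[p := x]) @ map (\<rho> h) (drop (Suc (Suc i)) (w[p := x]))) (h \<otimes> g)))"
      unfolding U_def \<alpha>_def .
  qed
qed

end


section \<open>Straightening maps\<close>

locale hecke_pbw_form = hecke_form G scale B \<rho> \<kappa>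
  for G :: "('g, 'm) monoid_scheme" (structure)
    and scale :: "complex \<Rightarrow> 'v::ab_group_add \<Rightarrow> 'v" and B \<rho> \<kappa> +
  assumes invariant: "\<And>g h v w. g \<in> carrier G \<Longrightarrow> h \<in> carrier G \<Longrightarrow>
      \<kappa> (\<rho> h v) (\<rho> h w) (h \<otimes> g \<otimes> inv h) = \<kappa> v w g"
    and jacobi: "\<And>g u v w. g \<in> carrier G \<Longrightarrow>
      scale (\<kappa> u v g) (\<rho> g w - w) + scale (\<kappa> v w g) (\<rho> g u - u) +
      scale (\<kappa> w u g) (\<rho> g v - v) = 0"
begin

text \<open>The last clause says that the linear map given by \<open>\<Phi>\<close> kills the
  defining relations in degree \<open>n\<close>. Its right side evaluates \<open>\<Phi>\<close> on
  words of length \<open>n - 2\<close>, which makes the construction a recursion on degree.\<close>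

definition straightening_at :: "('v list \<Rightarrow> 'g \<Rightarrow> 'g \<Rightarrow> 'v tensor) \<Rightarrow> nat \<Rightarrow> bool" where
  "straightening_at \<Phi> n \<longleftrightarrow>
     (\<forall>g\<in>carrier G. multilin skew_scale n (\<lambda>w. \<Phi> w g)) \<and>
     (\<forall>w. \<forall>g\<in>carrier G. length w = n \<longrightarrow> \<Phi> w g - skew_single g (P w) \<in> skew_lower n) \<and>
     (\<forall>w i. \<forall>g\<in>carrier G. length w = n \<longrightarrow> Suc i < n \<longrightarrow>
        \<Phi> w g - \<Phi> (swap_adjacent i w) g = kappa_contract \<Phi> i w g)"

text \<open>Agreement is required for lengths up to \<open>n\<close> and not only at
  \<open>n\<close>, because the contraction looks at shorter words.\<close>

lemma straightening_at_cong:
  assumes "\<And>w. length w \<le> n \<Longrightarrow> \<Phi> w = \<Phi>' w" "straightening_at \<Phi> n"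
  shows "straightening_at \<Phi>' n"
proof -
  have eq: "\<Phi>' w = \<Phi> w" if "length w = n" for w using assms(1) [of w] that by simp
  have "kappa_contract \<Phi>' i w g = kappa_contract \<Phi> i w g" if "length w = n" "Suc i < n" for i w g
  proof -
    have "\<Phi> (take i w @ map (\<rho> h) (drop (Suc (Suc i)) w)) = \<Phi>' (take i w @ map (\<rho> h) (drop (Suc (Suc i)) w))" for h
      using that by (intro assms(1)) simp
    then show ?thesis by (simp add: kappa_contract_def)
  qed
  then show ?thesis
    using assms(2) by (simp add: straightening_at_def multilinear_on_def eq)
qed

lemma kappa_contract_lower:
  assumes \<Phi>: "straightening_at \<Phi> m" and g: "g \<in> carrier G" and i: "i \<le> m"
    and w: "length w = Suc (Suc m)"
  shows "kappa_contract \<Phi> i w g \<in> skew_lower (Suc (Suc m))"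
  unfolding kappa_contract_def
proof (intro sk.subspace_sum [OF skew_lower_subspace] sk.subspace_scale [OF skew_lower_subspace])
  fix h assume h: "h \<in> carrier G"
  let ?u = "take i w @ map (\<rho> h) (drop (Suc (Suc i)) w)"
  have len: "length ?u = m" using w i by simp
  then have "\<Phi> ?u (h \<otimes> g) - skew_single (h \<otimes> g) (P ?u) \<in> skew_lower m"
    using \<Phi> g h unfolding straightening_at_def by blast
  then have "\<Phi> ?u (h \<otimes> g) - skew_single (h \<otimes> g) (P ?u) \<in> skew_lower (Suc (Suc m))"
    using skew_lower_mono [of m "Suc (Suc m)"] by auto
  moreover have "skew_single (h \<otimes> g) (P ?u) \<in> skew_lower (Suc (Suc m))"
    by (rule single_skew_lower, rule P_lower) (use len in simp)
  ultimately show "\<Phi> ?u (h \<otimes> g) \<in> skew_lower (Suc (Suc m))"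
    using sk.subspace_add [OF skew_lower_subspace] by fastforce
qed

lemma straightening_rel:
  assumes "straightening_at \<Phi> m" "g \<in> carrier G" "Suc (Suc (length A + length D)) = m"
  shows "\<Phi> (A @ a # b # D) g - \<Phi> (A @ b # a # D) g =
    (\<Sum>h\<in>carrier G. skew_scale (\<kappa> a b h) (\<Phi> (A @ map (\<rho> h) D) (h \<otimes> g)))"
proof -
  have "length (A @ a # b # D) = m" "Suc (length A) < m" using assms(3) by simp_all
  then have "\<Phi> (A @ a # b # D) g - \<Phi> (swap_adjacent (length A) (A @ a # b # D)) g =
      kappa_contract \<Phi> (length A) (A @ a # b # D) g"
    using assms(1,2) unfolding straightening_at_def by blast
  then show ?thesis by (simp add: swap_adjacent_append kappa_contract_append)
qed

lemma contract_inverse: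
  assumes "Suc i < length w"
  shows "kappa_contract \<Phi> i w g + kappa_contract \<Phi> i (swap_adjacent i w) g = 0"
proof -
  obtain A a b D where w: "w = A @ a # b # D" "length A = i"
    using split_at_adjacent [OF assms] .
  have "skew_scale (\<kappa> b a h) x = - skew_scale (\<kappa> a b h) x" for h and x :: "'g \<Rightarrow> 'v tensor"
    by (subst kappa_skew) (rule sk.scale_minus_left)
  then show ?thesis
    using w by (simp add: swap_adjacent_append kappa_contract_append sum_negf)
qed

text \<open>Exchanging c and d after contracting (a, b), and exchanging a and b after contracting
  (c, d), lead to the same double sum over h and k with coefficients
  \<open>\<kappa> a b h * \<kappa> c d k\<close>. In the first order the relation in degree
  \<open>m\<close> produces \<kappa> at the translated pair (hc, hd), which invariance brings back
  to (c, d).\<close>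

lemma contract_commute:
  assumes \<Phi>: "straightening_at \<Phi> m" and g: "g \<in> carrier G" and w: "length w = Suc (Suc m)"
    and ij: "Suc i < j" "Suc j < length w"
  shows "kappa_contract \<Phi> i w g + kappa_contract \<Phi> j (swap_adjacent i w) g =
    kappa_contract \<Phi> j w g + kappa_contract \<Phi> i (swap_adjacent j w) g"
proof -
  have "Suc i < length w" using ij by simp
  then obtain A a b E where w1: "w = A @ a # b # E" "length A = i" by (rule split_at_adjacent)
  have "Suc (j - Suc (Suc i)) < length E" using ij w1 by simp
  then obtain C c d D where E: "E = C @ c # d # D" "length C = j - Suc (Suc i)"
    by (rule split_at_adjacent)
  have j: "length (A @ a # b # C) = j" "length (A @ b # a # C) = j" using w1 E ij by simp_all
  have w2: "w = (A @ a # b # C) @ c # d # D" using w1 E by simp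
  have m: "Suc (Suc (length A + length C + length D)) = m" using w w1 E by simp
  let ?H = "\<lambda>h. map (\<rho> h)"
  have sj: "swap_adjacent j w = A @ a # b # C @ d # c # D"
    using swap_adjacent_append [OF j(1), of c d D] w2 by simp
  have si: "swap_adjacent i w = (A @ b # a # C) @ c # d # D"
    using swap_adjacent_append [OF w1(2), of a b E] w1(1) E by simp
  have "kappa_contract \<Phi> i w g - kappa_contract \<Phi> i (swap_adjacent j w) g =
    (\<Sum>h\<in>carrier G. skew_scale (\<kappa> a b h)
      (\<Phi> ((A @ ?H h C) @ \<rho> h c # \<rho> h d # ?H h D) (h \<otimes> g) -
       \<Phi> ((A @ ?H h C) @ \<rho> h d # \<rho> h c # ?H h D) (h \<otimes> g)))"
    unfolding sj unfolding w1 E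
    by (simp add: kappa_contract_append w1(2) sum_subtractf sk.scale_right_diff_distrib)
  also have "\<dots> = (\<Sum>h\<in>carrier G. \<Sum>k\<in>carrier G. skew_scale (\<kappa> a b h * \<kappa> c d k)
      (\<Phi> (A @ ?H h C @ ?H h (?H k D)) (h \<otimes> (k \<otimes> g))))"
  proof (rule sum.cong [OF refl])
    fix h assume h: "h \<in> carrier G"
    have "\<Phi> ((A @ ?H h C) @ \<rho> h c # \<rho> h d # ?H h D) (h \<otimes> g) -
       \<Phi> ((A @ ?H h C) @ \<rho> h d # \<rho> h c # ?H h D) (h \<otimes> g) =
       (\<Sum>k\<in>carrier G. skew_scale (\<kappa> (\<rho> h c) (\<rho> h d) k)
          (\<Phi> ((A @ ?H h C) @ ?H k (?H h D)) (k \<otimes> (h \<otimes> g))))"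
      by (rule straightening_rel [OF \<Phi>]) (use g h m in simp_all)
    also have "\<dots> = (\<Sum>k\<in>carrier G. skew_scale (\<kappa> c d k)
          (\<Phi> (A @ ?H h C @ ?H h (?H k D)) (h \<otimes> (k \<otimes> g))))"
    \<comment> \<open>Conjugation by h: the coefficient at k of the translated pair is that of (c,
      d) at \<open>inv h \<otimes> k \<otimes> h\<close>, and the product of h with this element is
      \<open>k \<otimes> h\<close>.\<close>
    proof (rule sum.reindex_bij_witness [of _ "\<lambda>k. h \<otimes> k \<otimes> inv h" "\<lambda>k. inv h \<otimes> k \<otimes> h"])
      fix k assume k: "k \<in> carrier G"
      show "inv h \<otimes> (h \<otimes> k \<otimes> inv h) \<otimes> h = k"
        using h k by (simp add: m_assoc) (simp flip: m_assoc)
      show kk: "h \<otimes> (inv h \<otimes> k \<otimes> h) \<otimes> inv h = k"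
        using h k by (simp add: m_assoc) (simp flip: m_assoc)
      have hk: "h \<otimes> (inv h \<otimes> k \<otimes> h) = k \<otimes> h"
        using h k by (simp flip: m_assoc)
      have "\<kappa> c d (inv h \<otimes> k \<otimes> h) = \<kappa> (\<rho> h c) (\<rho> h d) k"
        using invariant [of "inv h \<otimes> k \<otimes> h" h c d] h k kk by simp
      moreover have "?H h (?H (inv h \<otimes> k \<otimes> h) D) = ?H k (?H h D)"
        using rho_mult [of h "inv h \<otimes> k \<otimes> h"] rho_mult [of k h] h k hk by simp
      moreover have "h \<otimes> (inv h \<otimes> k \<otimes> h \<otimes> g) = k \<otimes> (h \<otimes> g)"
        using hk h k g by (metis inv_closed m_assoc m_closed)
      ultimately show "skew_scale (\<kappa> c d (inv h \<otimes> k \<otimes> h))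
          (\<Phi> (A @ ?H h C @ ?H h (?H (inv h \<otimes> k \<otimes> h) D)) (h \<otimes> (inv h \<otimes> k \<otimes> h \<otimes> g))) =
        skew_scale (\<kappa> (\<rho> h c) (\<rho> h d) k) (\<Phi> ((A @ ?H h C) @ ?H k (?H h D)) (k \<otimes> (h \<otimes> g)))"
        by (simp only: append_assoc)
    qed (use h in simp_all)
    finally show "skew_scale (\<kappa> a b h) (\<Phi> ((A @ ?H h C) @ \<rho> h c # \<rho> h d # ?H h D) (h \<otimes> g) -
       \<Phi> ((A @ ?H h C) @ \<rho> h d # \<rho> h c # ?H h D) (h \<otimes> g)) =
      (\<Sum>k\<in>carrier G. skew_scale (\<kappa> a b h * \<kappa> c d k)
        (\<Phi> (A @ ?H h C @ ?H h (?H k D)) (h \<otimes> (k \<otimes> g))))"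
      by (simp add: sk.scale_sum_right)
  qed
  also have "\<dots> = (\<Sum>k\<in>carrier G. \<Sum>h\<in>carrier G. skew_scale (\<kappa> a b h * \<kappa> c d k)
      (\<Phi> (A @ ?H h C @ ?H h (?H k D)) (h \<otimes> (k \<otimes> g))))"
    by (rule sum.swap)
  also have "\<dots> = (\<Sum>k\<in>carrier G. skew_scale (\<kappa> c d k)
      (\<Phi> (A @ a # b # C @ ?H k D) (k \<otimes> g) - \<Phi> (A @ b # a # C @ ?H k D) (k \<otimes> g)))"
  proof (rule sum.cong [OF refl])
    fix k assume k: "k \<in> carrier G"
    have "\<Phi> (A @ a # b # C @ ?H k D) (k \<otimes> g) - \<Phi> (A @ b # a # C @ ?H k D) (k \<otimes> g) =
      (\<Sum>h\<in>carrier G. skew_scale (\<kappa> a b h) (\<Phi> (A @ ?H h (C @ ?H k D)) (h \<otimes> (k \<otimes> g))))"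
      by (rule straightening_rel [OF \<Phi>]) (use g k m in simp_all)
    then show "(\<Sum>h\<in>carrier G. skew_scale (\<kappa> a b h * \<kappa> c d k)
      (\<Phi> (A @ ?H h C @ ?H h (?H k D)) (h \<otimes> (k \<otimes> g)))) = skew_scale (\<kappa> c d k)
      (\<Phi> (A @ a # b # C @ ?H k D) (k \<otimes> g) - \<Phi> (A @ b # a # C @ ?H k D) (k \<otimes> g))"
      by (simp add: sk.scale_sum_right mult.commute del: map_map)
  qed
  also have "\<dots> = kappa_contract \<Phi> j w g - kappa_contract \<Phi> j (swap_adjacent i w) g"
    unfolding si unfolding w2 kappa_contract_append [OF j(1)] kappa_contract_append [OF j(2)]
    by (simp add: sum_subtractf sk.scale_right_diff_distrib)
  finally show ?thesis by (simp add: algebra_simps)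
qed

text \<open>Each of the six terms contracts two of the letters a, b, c and keeps the third, moved by
  h if it stood to the right of the pair and unchanged if it stood to the left. Collected at one h,
  they are the linear map \<open>R h\<close> applied to the left side of the Jacobi
  condition.\<close>

lemma contract_braid:
  assumes \<Phi>: "straightening_at \<Phi> m" and g: "g \<in> carrier G" and w: "length w = Suc (Suc m)"
    and i: "Suc (Suc i) < length w"
  shows "kappa_contract \<Phi> i w g + kappa_contract \<Phi> (Suc i) (swap_adjacent i w) g +
      kappa_contract \<Phi> i (swap_adjacent (Suc i) (swap_adjacent i w)) g =
    kappa_contract \<Phi> (Suc i) w g + kappa_contract \<Phi> i (swap_adjacent (Suc i) w) g +
      kappa_contract \<Phi> (Suc i) (swap_adjacent i (swap_adjacent (Suc i) w)) g"
proof -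
  have "Suc i < length w" using i by simp
  then obtain A a b E where w1: "w = A @ a # b # E" "length A = i" by (rule split_at_adjacent)
  then obtain c D where E: "E = c # D" using i by (cases E) auto
  have m: "Suc (length A + length (map (\<rho> h) D)) = m" for h using w w1 E by simp
  define R where "R h x = \<Phi> (A @ x # map (\<rho> h) D) (h \<otimes> g)" for h x
  have R: "R h (x + y) = R h x + R h y" "R h (scale c x) = skew_scale c (R h x)"
    if "h \<in> carrier G" for h x y c
  proof -
    have "multilin skew_scale m (\<lambda>w. \<Phi> w (h \<otimes> g))"
      using \<Phi> that g unfolding straightening_at_def by blast
    from multilinear_on_append [OF this m]
    show "R h (x + y) = R h x + R h y" "R h (scale c x) = skew_scale c (R h x)"
      unfolding R_def by blast+
  qed
  have R0: "R h 0 = 0" if "h \<in> carrier G" for h using R(2) [OF that, of 0 0] by simp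
  have Rd: "R h (x - y) = R h x - R h y" if "h \<in> carrier G" for h x y
    using R(1) [OF that, of "x - y" y] by simp
  have SA: "length (A @ [x]) = Suc i" for x using w1 by simp
  have k1: "kappa_contract \<Phi> i (A @ x # y # z # D) g =
      (\<Sum>h\<in>carrier G. skew_scale (\<kappa> x y h) (R h (\<rho> h z)))" for x y z
    using w1(2) by (simp add: kappa_contract_append R_def)
  have k2: "kappa_contract \<Phi> (Suc i) (A @ x # y # z # D) g =
      (\<Sum>h\<in>carrier G. skew_scale (\<kappa> y z h) (R h x))" for x y z
    using kappa_contract_append [OF SA, of \<Phi> x y z D g] by (simp add: R_def)
  have s1: "swap_adjacent i (A @ x # y # z # D) = A @ y # x # z # D" for x y z
    using w1(2) by (simp add: swap_adjacent_append)
  have s2: "swap_adjacent (Suc i) (A @ x # y # z # D) = A @ x # z # y # D" for x y z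
    using swap_adjacent_append [OF SA, of x y z D] by simp
  have ww: "w = A @ a # b # c # D" using w1 E by simp
  have "(\<Sum>h\<in>carrier G. (skew_scale (\<kappa> a b h) (R h (\<rho> h c)) + skew_scale (\<kappa> a c h) (R h b) +
        skew_scale (\<kappa> b c h) (R h (\<rho> h a))) -
      (skew_scale (\<kappa> b c h) (R h a) + skew_scale (\<kappa> a c h) (R h (\<rho> h b)) +
        skew_scale (\<kappa> a b h) (R h c))) = 0"
  proof (rule sum.neutral, rule ballI)
    fix h assume h: "h \<in> carrier G"
    have ac: "\<kappa> a c h = - \<kappa> c a h" by (rule kappa_skew)
    have "0 = R h (scale (\<kappa> a b h) (\<rho> h c - c) + scale (\<kappa> b c h) (\<rho> h a - a) +
        scale (\<kappa> c a h) (\<rho> h b - b))"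
      using jacobi [OF h] R0 [OF h] by simp
    also have "\<dots> = skew_scale (\<kappa> a b h) (R h (\<rho> h c) - R h c) +
        skew_scale (\<kappa> b c h) (R h (\<rho> h a) - R h a) + skew_scale (\<kappa> c a h) (R h (\<rho> h b) - R h b)"
      by (simp only: R [OF h] Rd [OF h])
    finally show "(skew_scale (\<kappa> a b h) (R h (\<rho> h c)) + skew_scale (\<kappa> a c h) (R h b) +
        skew_scale (\<kappa> b c h) (R h (\<rho> h a))) -
      (skew_scale (\<kappa> b c h) (R h a) + skew_scale (\<kappa> a c h) (R h (\<rho> h b)) +
        skew_scale (\<kappa> a b h) (R h c)) = 0"
      unfolding ac by (simp add: sk.scale_right_diff_distrib sk.scale_minus_left algebra_simps)
  qed
  then show ?thesis
    unfolding ww s1 s2 k1 k2 by (simp add: sum_subtractf sum.distrib)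
qed

text \<open>The cocycle lemma is applied to pairs \<open>(w, g)\<close> in which only
  \<open>w\<close> is permuted. The tautological map \<open>skew_single g (P w)\<close> is the
  initial potential: it has the right leading term but satisfies no relation yet.\<close>

lemma straightening_step:
  assumes \<Phi>: "straightening_at \<Phi> m"
  shows "\<exists>F. straightening_at (\<lambda>w g. if length w = Suc (Suc m) then F (w, g) else \<Phi> w g) (Suc (Suc m))"
proof -
  let ?n = "Suc (Suc m)"
  let ?S = "{w. length w = ?n} \<times> carrier G"
  let ?s = "\<lambda>i (w, g). (swap_adjacent i w, g)"
  let ?f = "\<lambda>i (w, g). kappa_contract \<Phi> i w g"
  let ?Q = "\<lambda>F. (\<forall>g\<in>carrier G. multilin skew_scale ?n (\<lambda>w. F (w, g))) \<and>
    (\<forall>w. \<forall>g\<in>carrier G. length w = ?n \<longrightarrow> F (w, g) - skew_single g (P w) \<in> skew_lower ?n)"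
  note [simp] = swap_adjacent_inverse
  have multi: "multilin skew_scale m (\<lambda>w. \<Phi> w g)" if "g \<in> carrier G" for g
    using \<Phi> that unfolding straightening_at_def by blast
  have "\<exists>F. ?Q F \<and> (\<forall>i<Suc m. \<forall>x\<in>?S. F x - F (?s i x) = ?f i x)"
  proof (rule braid_cocycle_potential [OF sk.vector_space_axioms, where P = ?Q and F_init = "\<lambda>(w, g). skew_single g (P w)"])
    show "?Q (\<lambda>(w, g). skew_single g (P w))"
      using multilin_P [of ?n] sk.subspace_0 [OF skew_lower_subspace]
      by (auto simp: multilinear_on_def skew_single_simps)
  next
    fix i F assume i: "i < Suc m" and F: "?Q F"
    show "?Q (\<lambda>x. ?f i x + F (?s i x))"
    proof (intro conjI ballI allI impI)
      fix g assume g: "g \<in> carrier G"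
      have "multilin skew_scale ?n (\<lambda>w. kappa_contract \<Phi> i w g + F (swap_adjacent i w, g))"
      proof (rule multilinear_on_add [OF sk.vector_space_axioms])
        show "multilin skew_scale ?n (\<lambda>w. kappa_contract \<Phi> i w g)"
          by (rule multilin_kappa_contract) (use multi g i in auto)
        show "multilin skew_scale ?n (\<lambda>w. F (swap_adjacent i w, g))"
          by (rule multilinear_on_swap [where F = "\<lambda>w. F (w, g)"]) (use F g i in auto)
      qed
      then show "multilin skew_scale ?n (\<lambda>w. ?f i (w, g) + F (?s i (w, g)))" by simp
      fix w :: "'v list" assume w: "length w = ?n"
      have "F (swap_adjacent i w, g) - skew_single g (P (swap_adjacent i w)) \<in> skew_lower ?n"
        using F g w by simp
      moreover have "kappa_contract \<Phi> i w g \<in> skew_lower ?n"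
        by (rule kappa_contract_lower [OF \<Phi> g]) (use w i in simp_all)
      \<comment> \<open>Exchanging neighbours changes a pure tensor by a symmetric relation, so the
        prescribed leading term survives the step.\<close>
      moreover have "skew_single g (P (swap_adjacent i w) - P w) \<in> skew_lower ?n"
        using swap_mod_J [of i w] J_lower w i by (intro single_skew_lower) auto
      ultimately have "kappa_contract \<Phi> i w g + (F (swap_adjacent i w, g) - skew_single g (P (swap_adjacent i w)))
          + skew_single g (P (swap_adjacent i w) - P w) \<in> skew_lower ?n"
        by (intro sk.subspace_add [OF skew_lower_subspace])
      then show "?f i (w, g) + F (?s i (w, g)) - skew_single g (P w) \<in> skew_lower ?n"
        by (simp add: skew_single_simps add_diff_eq)
    qed
  next
    fix k and E :: "nat \<Rightarrow> 'v list \<times> 'g \<Rightarrow> 'g \<Rightarrow> 'v tensor"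
    assume E: "\<And>i. i \<le> k \<Longrightarrow> ?Q (E i)"
    let ?c = "inverse (of_nat (Suc k)) :: complex"
    show "?Q (\<lambda>x. skew_scale ?c (\<Sum>i\<le>k. E i x))"
    proof (intro conjI ballI allI impI)
      fix g assume g: "g \<in> carrier G"
      show "multilin skew_scale ?n (\<lambda>w. skew_scale ?c (\<Sum>i\<le>k. E i (w, g)))"
        by (intro multilinear_on_scale multilinear_on_sum sk.vector_space_axioms) (use E g in auto)
      fix w :: "'v list" assume w: "length w = ?n"
      have nz: "of_nat (Suc k) \<noteq> (0::complex)" by (simp only: of_nat_eq_0_iff)
      have "skew_single g (P w) = skew_scale ?c (\<Sum>i\<le>k. skew_single g (P w))"
        unfolding sk.sum_constant_scale by (simp only: card_atMost sk.scale_scale left_inverse [OF nz] sk.scale_one)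
      then have "skew_scale ?c (\<Sum>i\<le>k. E i (w, g)) - skew_single g (P w) =
          skew_scale ?c (\<Sum>i\<le>k. E i (w, g) - skew_single g (P w))"
        by (simp only: sum_subtractf sk.scale_right_diff_distrib)
      also have "\<dots> \<in> skew_lower ?n"
        by (intro sk.subspace_scale sk.subspace_sum skew_lower_subspace) (use E g w in auto)
      finally show "skew_scale ?c (\<Sum>i\<le>k. E i (w, g)) - skew_single g (P w) \<in> skew_lower ?n" .
    qed
  next
    fix i j and x :: "'v list \<times> 'g" assume ij: "Suc i < j" "j < Suc m" and x: "x \<in> ?S"
    obtain w g where x': "x = (w, g)" "length w = ?n" "g \<in> carrier G" using x by auto
    show "?s i (?s j x) = ?s j (?s i x)" using ij x' swap_adjacent_commute [of i j w] by simp
    show "?f i x + ?f j (?s i x) = ?f j x + ?f i (?s j x)"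
      using ij x' contract_commute [OF \<Phi> x'(3,2)] by simp
  next
    fix i and x :: "'v list \<times> 'g" assume i: "Suc i < Suc m" and x: "x \<in> ?S"
    obtain w g where x': "x = (w, g)" "length w = ?n" "g \<in> carrier G" using x by auto
    show "?s i (?s (Suc i) (?s i x)) = ?s (Suc i) (?s i (?s (Suc i) x))"
      using i x' swap_adjacent_braid [of i w] by simp
    show "?f i x + ?f (Suc i) (?s i x) + ?f i (?s (Suc i) (?s i x)) =
      ?f (Suc i) x + ?f i (?s (Suc i) x) + ?f (Suc i) (?s i (?s (Suc i) x))"
      using i x' contract_braid [OF \<Phi> x'(3,2)] by simp
  next
    fix i and x :: "'v list \<times> 'g" assume i: "i < Suc m" and x: "x \<in> ?S"
    obtain w g where x': "x = (w, g)" "length w = ?n" "g \<in> carrier G" using x by auto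
    show "?f i x + ?f i (?s i x) = 0" using contract_inverse [of i w] x' i by simp
  qed auto
  then obtain F where F: "?Q F" "\<And>i x. i < Suc m \<Longrightarrow> x \<in> ?S \<Longrightarrow> F x - F (?s i x) = ?f i x" by blast
  let ?F = "\<lambda>w g. if length w = ?n then F (w, g) else \<Phi> w g"
  \<comment> \<open>Contractions in degree \<open>m + 2\<close> see words of length \<open>m\<close>
    only, where the new map is still \<open>\<Phi>\<close>.\<close>
  have c: "kappa_contract ?F i w g = kappa_contract \<Phi> i w g" if "Suc i < ?n" "length w = ?n" for i w g
    using that by (simp add: kappa_contract_def)
  have "straightening_at ?F ?n"
    using F(1) F(2) [of _ "(_, _)"] by (auto simp: straightening_at_def c multilinear_on_def)
  then show ?thesis by blast
qed

text \<open>Extensions to the next degree exist but are not unique, so a chain of maps is chosen in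
  which each agrees with its predecessor on the words already settled. The diagonal of the chain
  works in all degrees.\<close>

lemma straightening_exists:
  obtains \<Phi> where "\<And>n. straightening_at \<Phi> n"
proof -
  have step: "\<exists>\<Psi>. (\<forall>m<Suc n. straightening_at \<Psi> m) \<and> (\<forall>w. length w < n \<longrightarrow> \<Psi> w = \<Phi> w)"
    if \<Phi>: "\<forall>m<n. straightening_at \<Phi> m" for n and \<Phi> :: "'v list \<Rightarrow> 'g \<Rightarrow> 'g \<Rightarrow> 'v tensor"
  proof -
    obtain F where F: "straightening_at (\<lambda>w g. if length w = n then F (w, g) else \<Phi> w g) n"
    proof (cases "\<exists>m. n = Suc (Suc m)")
      case True
      then obtain m where m: "n = Suc (Suc m)" by blast
      show ?thesis using straightening_step [of \<Phi> m] \<Phi> that m by auto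
    next
      \<comment> \<open>In degrees 0 and 1 there is no adjacent pair, and the tautological map
        qualifies.\<close>
      case False
      then have n: "\<not> Suc i < n" for i using False by (auto simp: less_iff_Suc_add)
      show ?thesis
      proof (rule that [of "\<lambda>(w, g). skew_single g (P w)"])
        show "straightening_at (\<lambda>w g. if length w = n then (case (w, g) of (w, g) \<Rightarrow> skew_single g (P w)) else \<Phi> w g) n"
          using multilin_P [of n] sk.subspace_0 [OF skew_lower_subspace] n
          by (auto simp: straightening_at_def multilinear_on_def skew_single_simps)
      qed
    qed
    let ?\<Psi> = "\<lambda>w g. if length w = n then F (w, g) else \<Phi> w g"
    have "straightening_at ?\<Psi> m" if "m < Suc n" for m
    proof (cases "m = n")
      case False
      then have "straightening_at \<Phi> m" using \<Phi> that by simp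
      then show ?thesis by (rule straightening_at_cong [rotated]) (use False that in auto)
    qed (use F in simp)
    then show ?thesis by (intro exI [of _ ?\<Psi>]) auto
  qed
  have "\<exists>f. \<forall>n. (\<forall>m<n. straightening_at (f n) m) \<and> (\<forall>w. length w < n \<longrightarrow> f (Suc n) w = f n w)"
    by (rule dependent_nat_choice [of "\<lambda>n \<Phi>. \<forall>m<n. straightening_at \<Phi> m"
          "\<lambda>n \<Phi> \<Psi>. \<forall>w. length w < n \<longrightarrow> \<Psi> w = \<Phi> w"]) (use step in auto)
  then obtain f where f: "\<And>n m. m < n \<Longrightarrow> straightening_at (f n) m"
    "\<And>n w. length w < n \<Longrightarrow> f (Suc n) w = f n w" by blast
  have stable: "f (n + k) w = f n w" if "length w < n" for n k w
    using that by (induction k) (simp_all add: f(2))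
  show ?thesis
  proof (rule that)
    fix n
    have "straightening_at (f (Suc n)) n" using f(1) by simp
    then show "straightening_at (\<lambda>w. f (Suc (length w)) w) n"
    proof (rule straightening_at_cong [rotated])
      fix w :: "'v list" assume "length w \<le> n"
      then show "f (Suc n) w = f (Suc (length w)) w"
        using stable [of w "Suc (length w)" "n - length w"] by simp
    qed
  qed
qed

end


section \<open>The ideal of relations\<close>

context spanned_algebra
begin

lemma mult_diff_right: "x \<in> carrier R \<Longrightarrow> y \<in> carrier R \<Longrightarrow> z \<in> carrier R \<Longrightarrow> x \<otimes> (y - z) = x \<otimes> y - x \<otimes> z"
  using r_distr [of "y - z" z x] subspace_diff [OF carrier_subspace, of y z] by simp

lemma mult_diff_left: "x \<in> carrier R \<Longrightarrow> y \<in> carrier R \<Longrightarrow> z \<in> carrier R \<Longrightarrow> (y - z) \<otimes> x = y \<otimes> x - z \<otimes> x"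
  using l_distr [of "y - z" z x] subspace_diff [OF carrier_subspace, of y z] by simp

lemma mult_sum:
  assumes x: "x \<in> carrier R" and f: "\<And>i. i \<in> A \<Longrightarrow> f i \<in> carrier R"
  shows "x \<otimes> (\<Sum>i\<in>A. f i) = (\<Sum>i\<in>A. x \<otimes> f i)" "(\<Sum>i\<in>A. f i) \<otimes> x = (\<Sum>i\<in>A. f i \<otimes> x)"
proof -
  have "x \<otimes> (\<Sum>i\<in>A. f i) = (\<Sum>i\<in>A. x \<otimes> f i) \<and> (\<Sum>i\<in>A. f i) \<otimes> x = (\<Sum>i\<in>A. f i \<otimes> x)"
    using f
  proof (induction A rule: infinite_finite_induct)
    case (insert i A)
    have "(\<Sum>i\<in>A. f i) \<in> carrier R"
      using insert.prems by (intro subspace_sum [OF carrier_subspace]) auto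
    then show ?case
      using insert x r_distr [of "f i" "\<Sum>i\<in>A. f i" x] l_distr [of "f i" "\<Sum>i\<in>A. f i" x] by simp
  qed (use l_null [OF x] r_null [OF x] in auto)
  then show "x \<otimes> (\<Sum>i\<in>A. f i) = (\<Sum>i\<in>A. x \<otimes> f i)" "(\<Sum>i\<in>A. f i) \<otimes> x = (\<Sum>i\<in>A. f i \<otimes> x)"
    by auto
qed

lemma mult_scaled_sum:
  assumes x: "x \<in> carrier R" and f: "\<And>i. i \<in> A \<Longrightarrow> f i \<in> carrier R"
  shows "x \<otimes> (\<Sum>i\<in>A. sc (c i) (f i)) = (\<Sum>i\<in>A. sc (c i) (x \<otimes> f i))"
    "(\<Sum>i\<in>A. sc (c i) (f i)) \<otimes> x = (\<Sum>i\<in>A. sc (c i) (f i \<otimes> x))"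
proof -
  have "sc (c i) (f i) \<in> carrier R" if "i \<in> A" for i
    using f that subspace_scale [OF carrier_subspace] by blast
  then show "x \<otimes> (\<Sum>i\<in>A. sc (c i) (f i)) = (\<Sum>i\<in>A. sc (c i) (x \<otimes> f i))"
    "(\<Sum>i\<in>A. sc (c i) (f i)) \<otimes> x = (\<Sum>i\<in>A. sc (c i) (f i \<otimes> x))"
    by (simp_all add: mult_sum x f mult_scale_left mult_scale_right)
qed

end

context group_rep
begin

lemma act_commutator:
  "g \<in> carrier G \<Longrightarrow> tensor_act \<rho> g (commutator_in A v w D) =
     commutator_in (map (\<rho> g) A) (\<rho> g v) (\<rho> g w) (map (\<rho> g) D)"
  using tensor_act_linear(1) [of \<rho> g "commutator_in A v w D" "P (A @ w # v # D)"]
  by (simp add: commutator_in_def tensor_act_pure_tensor [OF group_axioms rep])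

lemma alg_embed_eq: "alg_embed G T t = skew_single \<one> t"
  by (simp add: alg_embed_def skew_single_def fun_eq_iff)

end

section \<open>Explicit elements of the ideal of T(V) # G\<close>

context hecke_form
begin

abbreviation I :: "('g \<Rightarrow> 'v tensor) set" where "I \<equiv> hecke_ideal G scale \<rho> \<kappa>"

text \<open>The product of \<open>A\<close>, the relation for (v, w), \<open>D\<close> and
  \<open>g\<close>, with the group elements of \<kappa> already moved to the right past
  \<open>D\<close>.\<close>

definition hecke_rel :: "'v list \<Rightarrow> 'v \<Rightarrow> 'v \<Rightarrow> 'v list \<Rightarrow> 'g \<Rightarrow> 'g \<Rightarrow> 'v tensor" where
  "hecke_rel A v w D g = skew_single g (commutator_in A v w D) -
     (\<Sum>h\<in>carrier G. skew_scale (\<kappa> v w h) (skew_single (h \<otimes> g) (P (A @ map (\<rho> h) D))))"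

lemma H_diff: "x \<in> carrier H \<Longrightarrow> y \<in> carrier H \<Longrightarrow> x - y \<in> carrier H"
  by (rule sk.subspace_diff [OF H.carrier_subspace])

lemma kappa_sum_closed:
  assumes "\<And>h. h \<in> carrier G \<Longrightarrow> f h \<in> carrier H"
  shows "(\<Sum>h\<in>carrier G. skew_scale (\<kappa> v w h) (f h)) \<in> carrier H"
  using assms by (intro sk.subspace_sum sk.subspace_scale H.carrier_subspace)

lemma hecke_rel_closed: "g \<in> carrier G \<Longrightarrow> hecke_rel A v w D g \<in> carrier H"
  unfolding hecke_rel_def by (intro H_diff kappa_sum_closed) simp_all

lemma group_algebra_embed_kappa:
  "group_algebra_embed T (\<kappa> v w) = (\<Sum>h\<in>carrier G. skew_scale (\<kappa> v w h) (skew_single h (P [])))"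
proof
  fix k
  have "(\<Sum>h\<in>carrier G. skew_scale (\<kappa> v w h) (skew_single h (P []))) k =
      (\<Sum>h\<in>carrier G. if h = k then fun_scale (\<kappa> v w k) (P []) else 0)"
    by (auto simp: sum_fun_apply skew_scale_def skew_single_apply intro!: sum.cong)
  then show "group_algebra_embed T (\<kappa> v w) k =
      (\<Sum>h\<in>carrier G. skew_scale (\<kappa> v w h) (skew_single h (P []))) k"
    using finite_G kappa_outside [of k v w] by (simp add: group_algebra_embed_def)
qed

lemma hecke_generator:
  "alg_embed G T (tensor_commutator scale v w) \<ominus>\<^bsub>H\<^esub> group_algebra_embed T (\<kappa> v w) =
    hecke_rel [] v w [] \<one>"
  by (subst H.minus_eq)
    (auto simp: alg_embed_eq tensor_commutator_eq group_algebra_embed_kappa hecke_rel_def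
      intro!: kappa_sum_closed)

lemma I_eq: "I = Idl\<^bsub>H\<^esub> {hecke_rel [] v w [] \<one> |v w. True}"
  by (simp add: hecke_ideal_def hecke_generator)

lemma I_ideal: "ideal I H"
  unfolding I_eq by (rule H.genideal_ideal) (auto simp: hecke_rel_closed)

lemma I_subspace: "sk.subspace I"
  by (rule H.ideal_subspace [OF I_ideal])

lemma I_carrier: "I \<subseteq> carrier H"
  using additive_subgroup.a_subset [OF ideal.axioms(1) [OF I_ideal]] .

lemma hecke_rel_right:
  assumes g: "g \<in> carrier G" and k: "k \<in> carrier G"
  shows "hecke_rel A v w D g \<otimes>\<^bsub>H\<^esub> skew_single k (P C) = hecke_rel A v w (D @ map (\<rho> g) C) (g \<otimes> k)"
proof -
  have "(\<Sum>h\<in>carrier G. skew_scale (\<kappa> v w h) (skew_single (h \<otimes> g) (P (A @ map (\<rho> h) D)) \<otimes>\<^bsub>H\<^esub> skew_single k (P C))) =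
    (\<Sum>h\<in>carrier G. skew_scale (\<kappa> v w h)
       (skew_single (h \<otimes> (g \<otimes> k)) (P (A @ map (\<rho> h) (D @ map (\<rho> g) C)))))"
    by (rule sum.cong) (use g k in \<open>simp_all add: single_mult_P rho_mult m_assoc\<close>)
  then show ?thesis
    unfolding hecke_rel_def using g k
    by (subst H.mult_diff_left; simp add: kappa_sum_closed H.mult_scaled_sum single_mult
        act_commutator tmul_commutator tensor_act_pure_tensor [OF group_axioms rep])
qed

text \<open>The right side is deliberately not of the form \<open>hecke_rel\<close>: its
  coefficients are still those of (v, w) and not of the translated pair. The discrepancy is exactly
  the failure of invariance and is used as such in \<open>pbw_invariant\<close>.\<close>

lemma hecke_rel_left:
  assumes g: "g \<in> carrier G" and k: "k \<in> carrier G"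
  shows "skew_single k (P C) \<otimes>\<^bsub>H\<^esub> hecke_rel A v w D g =
    skew_single (k \<otimes> g) (commutator_in (C @ map (\<rho> k) A) (\<rho> k v) (\<rho> k w) (map (\<rho> k) D)) -
    (\<Sum>h\<in>carrier G. skew_scale (\<kappa> v w h)
       (skew_single (k \<otimes> (h \<otimes> g)) (P (C @ map (\<rho> k) (A @ map (\<rho> h) D)))))"
  unfolding hecke_rel_def using g k
  by (subst H.mult_diff_right; simp add: kappa_sum_closed H.mult_scaled_sum single_mult_P)
    (simp add: single_mult act_commutator tmul_commutator)

lemma hecke_rel_left_one:
  "g \<in> carrier G \<Longrightarrow> skew_single \<one> (P C) \<otimes>\<^bsub>H\<^esub> hecke_rel A v w D g = hecke_rel (C @ A) v w D g"
  by (simp add: hecke_rel_left) (simp add: hecke_rel_def)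

lemma hecke_rel_in_I:
  assumes "g \<in> carrier G"
  shows "hecke_rel A v w D g \<in> I"
proof -
  have "hecke_rel [] v w [] \<one> \<in> I"
    unfolding I_eq by (rule subsetD [OF H.genideal_self]) (auto simp: hecke_rel_closed)
  then have "skew_single \<one> (P A) \<otimes>\<^bsub>H\<^esub> (hecke_rel [] v w [] \<one> \<otimes>\<^bsub>H\<^esub> skew_single g (P D)) \<in> I"
    using assms by (intro ideal.I_l_closed [OF I_ideal] ideal.I_r_closed [OF I_ideal]) simp_all
  then show ?thesis using assms by (simp add: hecke_rel_right hecke_rel_left_one)
qed

end

context hecke_pbw_form
begin

text \<open>Substituting \<open>k \<otimes> h \<otimes> inv k\<close> for h turns the coefficients
  of (v, w) into those of the translated pair, by invariance.\<close>

lemma hecke_rel_left_closed: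
  assumes g: "g \<in> carrier G" and k: "k \<in> carrier G"
  shows "skew_single k (P C) \<otimes>\<^bsub>H\<^esub> hecke_rel A v w D g =
    hecke_rel (C @ map (\<rho> k) A) (\<rho> k v) (\<rho> k w) (map (\<rho> k) D) (k \<otimes> g)"
proof -
  have "(\<Sum>h\<in>carrier G. skew_scale (\<kappa> v w h)
       (skew_single (k \<otimes> (h \<otimes> g)) (P (C @ map (\<rho> k) (A @ map (\<rho> h) D))))) =
    (\<Sum>h\<in>carrier G. skew_scale (\<kappa> (\<rho> k v) (\<rho> k w) h)
       (skew_single (h \<otimes> (k \<otimes> g)) (P ((C @ map (\<rho> k) A) @ map (\<rho> h) (map (\<rho> k) D)))))"
  proof (rule sum.reindex_bij_witness [of _ "\<lambda>h. inv k \<otimes> h \<otimes> k" "\<lambda>h. k \<otimes> h \<otimes> inv k"])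
    fix h assume h: "h \<in> carrier G"
    show "inv k \<otimes> (k \<otimes> h \<otimes> inv k) \<otimes> k = h" "k \<otimes> (inv k \<otimes> h \<otimes> k) \<otimes> inv k = h"
      using h k by (simp_all add: m_assoc) (simp_all flip: m_assoc)
    have "k \<otimes> h \<otimes> inv k \<otimes> k = k \<otimes> h" using h k by (simp add: m_assoc)
    then have "map (\<rho> (k \<otimes> h \<otimes> inv k)) (map (\<rho> k) D) = map (\<rho> k) (map (\<rho> h) D)"
      using rho_mult [of "k \<otimes> h \<otimes> inv k" k] rho_mult [of k h] h k by simp
    moreover have "k \<otimes> h \<otimes> inv k \<otimes> (k \<otimes> g) = k \<otimes> (h \<otimes> g)"
      using h k g \<open>k \<otimes> h \<otimes> inv k \<otimes> k = k \<otimes> h\<close> by (metis inv_closed m_assoc m_closed)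
    moreover have "\<kappa> (\<rho> k v) (\<rho> k w) (k \<otimes> h \<otimes> inv k) = \<kappa> v w h"
      using invariant [OF h k] .
    ultimately show "skew_scale (\<kappa> (\<rho> k v) (\<rho> k w) (k \<otimes> h \<otimes> inv k))
       (skew_single (k \<otimes> h \<otimes> inv k \<otimes> (k \<otimes> g))
         (P ((C @ map (\<rho> k) A) @ map (\<rho> (k \<otimes> h \<otimes> inv k)) (map (\<rho> k) D)))) =
      skew_scale (\<kappa> v w h) (skew_single (k \<otimes> (h \<otimes> g)) (P (C @ map (\<rho> k) (A @ map (\<rho> h) D))))"
      by (simp only: append_assoc map_append)
  qed (use k in simp_all)
  then show ?thesis
    unfolding hecke_rel_left [OF g k] unfolding hecke_rel_def by simp
qed

lemma I_subset_span: "I \<subseteq> sk.span {hecke_rel A v w D g |A v w D g. g \<in> carrier G}"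
proof -
  define E where "E = {hecke_rel A v w D g |A v w D g. g \<in> carrier G}"
  have E: "hecke_rel A v w D g \<in> sk.span E" if "g \<in> carrier G" for A v w D g
    unfolding E_def by (rule sk.span_base) (use that in blast)
  have EE: "\<exists>A v w D g. e = hecke_rel A v w D g \<and> g \<in> carrier G" if "e \<in> E" for e
    using that by (auto simp: E_def)
  have "I \<subseteq> sk.span E"
    unfolding I_eq
  proof (rule H.genideal_subset_span)
    show "E \<subseteq> carrier H" using EE hecke_rel_closed by blast
    show "{hecke_rel [] v w [] \<one> |v w. True} \<subseteq> sk.span E" using E by auto
  next
    fix m e assume "m \<in> {skew_single g (P w) |g w. g \<in> carrier G}" "e \<in> E"
    then obtain k C A v w D g where *: "m = skew_single k (P C)" "k \<in> carrier G"
      "e = hecke_rel A v w D g" "g \<in> carrier G"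
      using EE by blast
    show "m \<otimes>\<^bsub>H\<^esub> e \<in> sk.span E" "e \<otimes>\<^bsub>H\<^esub> m \<in> sk.span E"
      unfolding * using *(2,4) by (simp_all add: hecke_rel_left_closed hecke_rel_right E)
  qed
  then show ?thesis by (simp add: E_def)
qed

text \<open>\<open>\<Theta>\<close> is the linear map on T(V) # G induced by a straightening map. It
  kills every \<open>hecke_rel\<close> and hence \<open>r\<close>, but moves an element of degree at
  most \<open>n\<close> only by an element of \<open>skew_lower n\<close>. Thus \<open>r\<close> is
  congruent to \<open>\<Theta> r = 0\<close>.\<close>

lemma I_leading_term:
  assumes r: "r \<in> I" and deg: "\<And>g. r g \<in> tensors_up_to scale n"
  shows "r g \<in> lower n"
proof -
  obtain \<Phi> where \<Phi>: "\<And>n. straightening_at \<Phi> n" using straightening_exists by blast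
  have "\<exists>L. Vector_Spaces.linear fun_scale skew_scale L \<and> (\<forall>w. L (P w) = \<Phi> w g)" if "g \<in> carrier G" for g
  proof -
    have "multilin skew_scale n (\<lambda>w. \<Phi> w g)" for n
      using \<Phi> [of n] that unfolding straightening_at_def by blast
    then show ?thesis using multilinear_extension [OF sk.vector_space_axioms] by metis
  qed
  then obtain L where L: "\<And>g. g \<in> carrier G \<Longrightarrow> Vector_Spaces.linear fun_scale skew_scale (L g)"
    "\<And>g w. g \<in> carrier G \<Longrightarrow> L g (P w) = \<Phi> w g"
    by metis
  have Ladd: "L g (s + t) = L g s + L g t" and Lsc: "L g (fun_scale c t) = skew_scale c (L g t)"
    if "g \<in> carrier G" for g s t c
    using L(1) [OF that] by (simp_all add: Vector_Spaces.linear_iff)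
  have L0: "L g 0 = 0" if "g \<in> carrier G" for g using Lsc [OF that, of 0 0] by simp
  have Ldiff: "L g (s - t) = L g s - L g t" if "g \<in> carrier G" for g s t
    using Ladd [OF that, of "s - t" t] by simp
  define \<Theta> where "\<Theta> r = (\<Sum>g\<in>carrier G. L g (r g))" for r
  have \<Theta>_add: "\<Theta> (s + t) = \<Theta> s + \<Theta> t" for s t
    by (simp add: \<Theta>_def plus_fun_apply Ladd sum.distrib)
  have \<Theta>_scale: "\<Theta> (skew_scale c t) = skew_scale c (\<Theta> t)" for c t
    by (simp add: \<Theta>_def skew_scale_def [of c t] Lsc sk.scale_sum_right)
  have \<Theta>_0: "\<Theta> 0 = 0" using \<Theta>_scale [of 0 0] by simp
  have \<Theta>_diff: "\<Theta> (s - t) = \<Theta> s - \<Theta> t" for s t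
    using \<Theta>_add [of "s - t" t] by simp
  have \<Theta>_sum: "\<Theta> (\<Sum>i\<in>A. f i) = (\<Sum>i\<in>A. \<Theta> (f i))" for A :: "'g set" and f
    by (induction A rule: infinite_finite_induct) (simp_all add: \<Theta>_0 \<Theta>_add)
  have \<Theta>_single: "\<Theta> (skew_single g t) = L g t" if "g \<in> carrier G" for g t
  proof -
    have "\<Theta> (skew_single g t) = (\<Sum>h\<in>carrier G. if h = g then L g t else 0)"
      unfolding \<Theta>_def by (rule sum.cong) (auto simp: skew_single_apply L0)
    then show ?thesis using finite_G that by simp
  qed
  have \<Theta>_rel: "\<Theta> (hecke_rel A v w D g) = 0" if g: "g \<in> carrier G" for A v w D g
    using straightening_rel [OF \<Phi> g refl, where A = A and D = D and a = v and b = w] g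
    by (simp add: hecke_rel_def \<Theta>_diff \<Theta>_sum \<Theta>_scale \<Theta>_single commutator_in_def L Ldiff)
  have "r \<in> sk.span {hecke_rel A v w D g |A v w D g. g \<in> carrier G}" using r I_subset_span by blast
  then have \<Theta>_r: "\<Theta> r = 0"
  proof (induction rule: sk.span_induct_alt)
    case (step c x y)
    then show ?case using \<Theta>_rel by (auto simp: \<Theta>_add \<Theta>_scale)
  qed (simp add: \<Theta>_0)
  have lead: "L g t - skew_single g t \<in> skew_lower n" if "g \<in> carrier G" "t \<in> tensors_up_to scale n" for g t
  proof -
    have "t \<in> fs.span {P w |w. length w \<le> n}" using that by (simp add: tensors_up_to_def)
    then show ?thesis
    proof (induction rule: fs.span_induct_alt)
      case base
      then show ?case using that sk.subspace_0 [OF skew_lower_subspace] by (simp add: L0 skew_single_simps)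
    next
      case (step c x y)
      then obtain w where w: "x = P w" "length w \<le> n" by auto
      have "L g x - skew_single g x \<in> skew_lower (length w)"
        using \<Phi> [of "length w"] that w L(2) unfolding straightening_at_def by simp
      then have x: "L g x - skew_single g x \<in> skew_lower n" using skew_lower_mono [OF w(2)] by blast
      have "L g (fun_scale c x + y) - skew_single g (fun_scale c x + y) =
          skew_scale c (L g x - skew_single g x) + (L g y - skew_single g y)"
        using that by (simp add: Ladd Lsc skew_single_simps sk.scale_right_diff_distrib)
      also have "\<dots> \<in> skew_lower n"
        using x step by (intro sk.subspace_add sk.subspace_scale skew_lower_subspace)
      finally show ?case .
    qed
  qed
  have rH: "r \<in> carrier H" using r I_carrier by blast
  have "\<Theta> r - r = (\<Sum>g\<in>carrier G. L g (r g)) - (\<Sum>g\<in>carrier G. skew_single g (r g))"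
    using H_eq_sum_single [OF rH] by (simp add: \<Theta>_def)
  also have "\<dots> = (\<Sum>g\<in>carrier G. L g (r g) - skew_single g (r g))" by (simp add: sum_subtractf)
  also have "\<dots> \<in> skew_lower n"
    by (intro sk.subspace_sum skew_lower_subspace lead deg)
  finally have "- r \<in> skew_lower n" by (simp add: \<Theta>_r)
  then have "r \<in> skew_lower n" using sk.subspace_neg [OF skew_lower_subspace, of "- r" n] by simp
  then show ?thesis by (simp add: skew_lower_def)
qed

end


section \<open>Filtered splittings\<close>

context group_rep
begin

lemma tensors_up_to_mono: "m \<le> n \<Longrightarrow> tensors_up_to scale m \<subseteq> tensors_up_to scale n"
  unfolding tensors_up_to_def by (rule fs.span_mono) auto

lemma tensors_up_to_subspace: "fs.subspace (tensors_up_to scale n)"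
  by (simp add: tensors_up_to_def)

lemma P_up_to: "length w \<le> n \<Longrightarrow> P w \<in> tensors_up_to scale n"
  unfolding tensors_up_to_def by (rule fs.span_base) blast

lemma tensors_up_to_T: "tensors_up_to scale n \<subseteq> carrier T"
  unfolding tensors_up_to_def T.carrier_span by (rule fs.span_mono) auto

lemma tensor_bounded_degree:
  assumes "t \<in> carrier T"
  obtains n where "t \<in> tensors_up_to scale n"
proof -
  have "t \<in> fs.span (range P)" using assms by (simp add: T.carrier_span)
  then have "\<exists>n. t \<in> tensors_up_to scale n"
  proof (induction rule: fs.span_induct_alt)
    case base
    show ?case using fs.subspace_0 [OF tensors_up_to_subspace] by blast
  next
    case (step c x y)
    then obtain w n where *: "x = P w" "y \<in> tensors_up_to scale n" by auto
    have "x \<in> tensors_up_to scale (max n (length w))" "y \<in> tensors_up_to scale (max n (length w))"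
      using * P_up_to [of w] tensors_up_to_mono [of n "max n (length w)"] by auto
    then show ?case
      using fs.subspace_add [OF tensors_up_to_subspace] fs.subspace_scale [OF tensors_up_to_subspace] by blast
  qed
  then show ?thesis using that by blast
qed

lemma tensors_bounded_degree:
  assumes "\<And>g. g \<in> carrier G \<Longrightarrow> r g \<in> carrier T"
  obtains n where "\<And>g. g \<in> carrier G \<Longrightarrow> r g \<in> tensors_up_to scale n"
proof -
  have "\<forall>g\<in>carrier G. \<exists>n. r g \<in> tensors_up_to scale n"
    using assms tensor_bounded_degree by metis
  then obtain d where d: "\<And>g. g \<in> carrier G \<Longrightarrow> r g \<in> tensors_up_to scale (d g)" by metis
  show ?thesis
  proof (rule that)
    fix g assume g: "g \<in> carrier G"
    have "d g \<le> Max (d ` carrier G)" using finite_G g by simp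
    then show "r g \<in> tensors_up_to scale (Max (d ` carrier G))"
      using d [OF g] tensors_up_to_mono by blast
  qed
qed

text \<open>The degree of a tensor is the length of its arguments, so ignoring long arguments is the
  projection onto degrees at most \<open>n\<close>.\<close>

definition truncate :: "nat \<Rightarrow> 'v tensor \<Rightarrow> 'v tensor" where
  "truncate n t = (\<lambda>\<phi>s. if length \<phi>s \<le> n then t \<phi>s else 0)"

lemma truncate_linear:
  "truncate n (s + t) = truncate n s + truncate n t"
  "truncate n (s - t) = truncate n s - truncate n t"
  "truncate n (fun_scale c t) = fun_scale c (truncate n t)"
  "truncate n 0 = 0"
  by (auto simp: truncate_def fun_eq_iff fun_scale_def plus_fun_apply zero_fun_apply)

lemma truncate_P: "truncate n (P w) = (if length w \<le> n then P w else 0)"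
  by (auto simp: truncate_def pure_tensor_def fun_eq_iff zero_fun_apply)

lemma truncate_commutator:
  "truncate n (commutator_in A v w D) =
    (if length A + length D + 2 \<le> n then commutator_in A v w D else 0)"
  by (auto simp: commutator_in_def truncate_linear truncate_P)

lemma truncate_up_to: "t \<in> tensors_up_to scale n \<Longrightarrow> truncate n t = t"
  unfolding tensors_up_to_def
  by (induction rule: fs.span_induct_alt) (auto simp: truncate_linear truncate_P)

text \<open>A combination of commutators may have small degree because its large terms cancel. As
  each commutator is homogeneous, truncation discards these terms and keeps the others
  intact.\<close>

lemma J_up_to:
  assumes "t \<in> J" "t \<in> tensors_up_to scale n"
  shows "t \<in> fs.span {commutator_in A v w D |A v w D. length A + length D + 2 \<le> n}"
proof -
  define E where "E = {commutator_in A v w D |A v w D. length A + length D + 2 \<le> n}"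
  have "truncate n t \<in> fs.span E"
    using assms(1) unfolding J_eq_span
  proof (induction rule: fs.span_induct_alt)
    case base
    show ?case by (simp add: truncate_linear fs.span_zero)
  next
    case (step c x y)
    then obtain A v w D where x: "x = commutator_in A v w D" by blast
    have "truncate n x \<in> fs.span E"
    proof (cases "length A + length D + 2 \<le> n")
      case True
      then show ?thesis unfolding E_def x truncate_commutator if_P [OF True] by (intro fs.span_base) blast
    next
      case False
      then show ?thesis by (simp add: x truncate_commutator fs.span_zero)
    qed
    then show ?case using step by (simp add: truncate_linear fs.span_add fs.span_scale)
  qed
  then show ?thesis by (simp add: truncate_up_to [OF assms(2)] E_def)
qed

text \<open>The relations of S(V) begin in degree 2.\<close>

lemma J_up_to_1: "t \<in> J \<Longrightarrow> t \<in> tensors_up_to scale 1 \<Longrightarrow> t = 0"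
  using J_up_to [of t 1] by simp

text \<open>The cocycle lemma for the zero cocycle: a potential is then a map invariant under all
  adjacent transpositions, and starting from \<open>P\<close> the averages stay congruent to
  \<open>P\<close> modulo symmetric relations. This is symmetrization without a sum over all
  permutations.\<close>

lemma symmetrizer_degree:
  "\<exists>F. multilin fun_scale n F \<and>
    (\<forall>w. length w = n \<longrightarrow> F w - P w \<in> J \<and> F w \<in> tensors_up_to scale n) \<and>
    (\<forall>w i. length w = n \<longrightarrow> Suc i < n \<longrightarrow> F w = F (swap_adjacent i w))"
proof -
  let ?Q = "\<lambda>F. multilin fun_scale n F \<and>
    (\<forall>w. length w = n \<longrightarrow> F w - P w \<in> J \<and> F w \<in> tensors_up_to scale n)"
  have "\<exists>F. ?Q F \<and> (\<forall>i<n - 1. \<forall>w\<in>{w. length w = n}. F w - F (swap_adjacent i w) = 0)"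
  proof (rule braid_cocycle_potential [OF fs.vector_space_axioms, where P = ?Q and F_init = P])
    show "?Q P" using multilin_P P_up_to fs.subspace_0 [OF J_subspace] by auto
  next
    fix i and F :: "'v list \<Rightarrow> 'v tensor"
    assume i: "i < n - 1" and F: "?Q F"
    have "F (swap_adjacent i w) - P w \<in> J" if w: "length w = n" for w
    proof -
      have "F (swap_adjacent i w) - P (swap_adjacent i w) \<in> J" using F w by simp
      moreover have "P (swap_adjacent i w) - P w \<in> J" using w i by (intro swap_mod_J) simp
      ultimately show ?thesis using fs.subspace_add [OF J_subspace] by fastforce
    qed
    then show "?Q (\<lambda>w. 0 + F (swap_adjacent i w))"
      using multilinear_on_swap [of scale fun_scale n F i] F i by auto
  next
    fix k and E :: "nat \<Rightarrow> 'v list \<Rightarrow> 'v tensor"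
    assume E: "\<And>i. i \<le> k \<Longrightarrow> ?Q (E i)"
    let ?c = "inverse (of_nat (Suc k)) :: complex"
    have nz: "of_nat (Suc k) \<noteq> (0::complex)" by (simp only: of_nat_eq_0_iff)
    have P: "P w = fun_scale ?c (\<Sum>i\<le>k. P w)" for w
      unfolding fs.sum_constant_scale by (simp only: card_atMost fs.scale_scale left_inverse [OF nz] fs.scale_one)
    show "?Q (\<lambda>w. fun_scale ?c (\<Sum>i\<le>k. E i w))"
    proof (intro conjI allI impI)
      show "multilin fun_scale n (\<lambda>w. fun_scale ?c (\<Sum>i\<le>k. E i w))"
        by (intro multilinear_on_scale multilinear_on_sum fs.vector_space_axioms) (use E in auto)
      fix w :: "'v list" assume w: "length w = n"
      have "fun_scale ?c (\<Sum>i\<le>k. E i w) - P w = fun_scale ?c (\<Sum>i\<le>k. E i w - P w)"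
        by (subst P) (simp only: sum_subtractf fs.scale_right_diff_distrib)
      also have "\<dots> \<in> J"
        by (intro fs.subspace_scale fs.subspace_sum J_subspace) (use E w in auto)
      finally show "fun_scale ?c (\<Sum>i\<le>k. E i w) - P w \<in> J" .
      show "fun_scale ?c (\<Sum>i\<le>k. E i w) \<in> tensors_up_to scale n"
        by (intro fs.subspace_scale fs.subspace_sum tensors_up_to_subspace) (use E w in auto)
    qed
  next
    fix i and w :: "'v list" assume "i < n - 1" "w \<in> {w. length w = n}"
    then show "swap_adjacent i (swap_adjacent i w) = w" by (intro swap_adjacent_inverse) auto
  next
    fix i j and w :: "'v list" assume "Suc i < j" "j < n - 1" "w \<in> {w. length w = n}"
    then show "swap_adjacent i (swap_adjacent j w) = swap_adjacent j (swap_adjacent i w)"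
      by (intro swap_adjacent_commute) auto
  next
    fix i and w :: "'v list" assume "Suc i < n - 1" "w \<in> {w. length w = n}"
    then show "swap_adjacent i (swap_adjacent (Suc i) (swap_adjacent i w)) =
      swap_adjacent (Suc i) (swap_adjacent i (swap_adjacent (Suc i) w))"
      by (intro swap_adjacent_braid) auto
  qed auto
  then show ?thesis by auto
qed

lemma symmetrizer_exists:
  obtains S where "Vector_Spaces.linear fun_scale fun_scale S" "\<And>t. t \<in> J \<Longrightarrow> S t = 0"
    "\<And>t. t \<in> carrier T \<Longrightarrow> S t - t \<in> J"
    "\<And>n t. t \<in> tensors_up_to scale n \<Longrightarrow> S t \<in> tensors_up_to scale n"
proof -
  obtain F where F: "\<And>n. multilin fun_scale n (F n)"
    "\<And>n w. length w = n \<Longrightarrow> F n w - P w \<in> J \<and> F n w \<in> tensors_up_to scale n"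
    "\<And>n w i. length w = n \<Longrightarrow> Suc i < n \<Longrightarrow> F n w = F n (swap_adjacent i w)"
    using symmetrizer_degree by metis
  have "multilin fun_scale n (\<lambda>w. F (length w) w)" for n
    using F(1) [of n] by (simp add: multilinear_on_def)
  then obtain S where S: "Vector_Spaces.linear fun_scale fun_scale S" "\<And>w. S (P w) = F (length w) w"
    using multilinear_extension [OF fs.vector_space_axioms, of "\<lambda>w. F (length w) w"] by blast
  have Sadd: "S (s + t) = S s + S t" and Ssc: "S (fun_scale c t) = fun_scale c (S t)" for s t c
    using S(1) by (simp_all add: Vector_Spaces.linear_iff)
  have S0: "S 0 = 0" using Ssc [of 0 0] by simp
  have Sdiff: "S (s - t) = S s - S t" for s t using Sadd [of "s - t" t] by simp
  show ?thesis
  proof (rule that [OF S(1)])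
    fix t assume "t \<in> J"
    then show "S t = 0"
      unfolding J_eq_span
    proof (induction rule: fs.span_induct_alt)
      case (step c x y)
      then obtain A v w D where x: "x = commutator_in A v w D" by blast
      have "S x = 0"
        using F(3) [OF refl, of "length A" "A @ v # w # D"]
        by (simp add: x commutator_in_def Sdiff S swap_adjacent_append)
      then show ?case using step by (simp add: Sadd Ssc)
    qed (simp add: S0)
  next
    fix t assume "t \<in> carrier T"
    then show "S t - t \<in> J"
      unfolding T.carrier_span
    proof (induction rule: fs.span_induct_alt)
      case base
      then show ?case using fs.subspace_0 [OF J_subspace] by (simp add: S0)
    next
      case (step c x y)
      then have x: "S x - x \<in> J" using F(2) S(2) by auto
      have "S (fun_scale c x + y) - (fun_scale c x + y) = fun_scale c (S x - x) + (S y - y)"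
        by (simp add: Sadd Ssc fs.scale_right_diff_distrib)
      also have "\<dots> \<in> J" using x step by (intro fs.subspace_add fs.subspace_scale J_subspace)
      finally show ?case .
    qed
  next
    fix n t assume "t \<in> tensors_up_to scale n"
    then show "S t \<in> tensors_up_to scale n"
      unfolding tensors_up_to_def [of scale n]
    proof (induction rule: fs.span_induct_alt)
      case base
      then show ?case by (simp add: S0 fs.span_zero)
    next
      case (step c x y)
      then obtain w where w: "x = P w" "length w \<le> n" by auto
      then have "S x \<in> tensors_up_to scale n"
        using F(2) [OF refl, of w] S(2) tensors_up_to_mono [OF w(2)] by auto
      then show ?case using step unfolding tensors_up_to_def
        by (simp add: Sadd Ssc fs.span_add fs.span_scale)
    qed
  qed
qed

section \<open>S(V) as a quotient and the existence of a splitting\<close>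

abbreviation Sym :: "(complex, 'v tensor set) module" where "Sym \<equiv> symmetric_algebra scale"

lemma Sym_carrier: "carrier Sym = symmetric_proj scale ` carrier T"
  unfolding symmetric_algebra_def T.quotient_carrier symmetric_proj_def ..

lemma symmetric_proj_closed [simp]: "t \<in> carrier T \<Longrightarrow> symmetric_proj scale t \<in> carrier Sym"
  by (simp add: Sym_carrier)

lemma symmetric_proj_add:
  "symmetric_proj scale s \<oplus>\<^bsub>Sym\<^esub> symmetric_proj scale t = symmetric_proj scale (s + t)"
  by (simp add: symmetric_algebra_def symmetric_proj_def T.quotient_add [OF J_subspace])

lemma symmetric_proj_smult:
  "c \<odot>\<^bsub>Sym\<^esub> symmetric_proj scale t = symmetric_proj scale (fun_scale c t)"
  by (simp add: symmetric_algebra_def symmetric_proj_def T.quotient_smult [OF J_subspace])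

lemma symmetric_proj_eq_iff: "symmetric_proj scale s = symmetric_proj scale t \<longleftrightarrow> s - t \<in> J"
  by (simp add: symmetric_proj_def T.coset_eq_iff [OF J_subspace])

lemma Sym_zero: "\<zero>\<^bsub>Sym\<^esub> = symmetric_proj scale 0"
  using T.quotient_zero_coset [OF J_subspace, of 0] fs.subspace_0 [OF J_subspace]
  by (simp add: symmetric_algebra_def symmetric_proj_def T.quotient_zero)

text \<open>\<open>pbw_property\<close> quantifies over all filtered splittings, so invariance and
  the Jacobi condition can be extracted from it only once a splitting is at hand.\<close>

lemma filtered_splitting_exists: "\<exists>\<sigma>. filtered_splitting scale \<sigma>"
proof -
  obtain S where S: "Vector_Spaces.linear fun_scale fun_scale S" "\<And>t. t \<in> J \<Longrightarrow> S t = 0"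
    "\<And>t. t \<in> carrier T \<Longrightarrow> S t - t \<in> J"
    "\<And>n t. t \<in> tensors_up_to scale n \<Longrightarrow> S t \<in> tensors_up_to scale n"
    using symmetrizer_exists by metis
  have Sadd: "S (s + t) = S s + S t" and Ssc: "S (fun_scale c t) = fun_scale c (S t)" for s t c
    using S(1) by (simp_all add: Vector_Spaces.linear_iff)
  \<comment> \<open>The choice of the representative is immaterial, since \<open>S\<close> vanishes
    on the symmetric ideal.\<close>
  define \<sigma> where "\<sigma> X = S (SOME t. t \<in> X)" for X
  have \<sigma>: "\<sigma> (symmetric_proj scale t) = S t" for t
  proof -
    have "t \<in> symmetric_proj scale t"
      using fs.subspace_0 [OF J_subspace] by (force simp: symmetric_proj_def T.coset_eq)
    then have "(SOME u. u \<in> symmetric_proj scale t) \<in> symmetric_proj scale t" 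
      by (rule someI [where P = "\<lambda>u. u \<in> symmetric_proj scale t"])
    then obtain j where "j \<in> J" "(SOME u. u \<in> symmetric_proj scale t) = j + t"
      by (auto simp: symmetric_proj_def T.coset_eq)
    then show ?thesis by (simp add: \<sigma>_def Sadd S(2))
  qed
  have ST: "S t \<in> carrier T" if t: "t \<in> carrier T" for t
  proof -
    obtain n where "t \<in> tensors_up_to scale n" using tensor_bounded_degree [OF t] by blast
    then show ?thesis by (rule subsetD [OF tensors_up_to_T S(4)])
  qed
  have "filtered_splitting scale \<sigma>"
    unfolding filtered_splitting_def linear_map_def Sym_carrier
  proof (intro conjI ballI allI impI funcsetI)
    fix n t assume "t \<in> tensors_up_to scale n"
    then show "\<sigma> (symmetric_proj scale t) \<in> tensors_up_to scale n" unfolding \<sigma> by (rule S(4))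
  next
    fix X assume "X \<in> symmetric_proj scale ` carrier T"
    then obtain t where t: "X = symmetric_proj scale t" "t \<in> carrier T" by blast
    show "\<sigma> X \<in> carrier T" unfolding t \<sigma> by (rule ST) fact
    show "symmetric_proj scale (\<sigma> X) = X" unfolding t \<sigma> symmetric_proj_eq_iff by (rule S(3)) fact
    show "\<sigma> (c \<odot>\<^bsub>Sym\<^esub> X) = c \<odot>\<^bsub>T\<^esub> \<sigma> X" for c
      unfolding t symmetric_proj_smult \<sigma> by (simp add: Ssc)
    fix Y assume "Y \<in> symmetric_proj scale ` carrier T"
    then obtain u where u: "Y = symmetric_proj scale u" by blast
    show "\<sigma> (X \<oplus>\<^bsub>Sym\<^esub> Y) = \<sigma> X \<oplus>\<^bsub>T\<^esub> \<sigma> Y"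
      unfolding t u symmetric_proj_add \<sigma> by (simp add: Sadd)
  qed
  then show ?thesis by blast
qed

end


section \<open>The PBW property\<close>

context group_rep
begin

lemma lower_0: "lower 0 = J"
  using fs.span_eq_iff [of J] J_subspace by (simp add: lower_def)

text \<open>Used for the descent in \<open>pbw\<close>: modulo symmetric relations, membership in
  \<open>lower\<close> is a bound on the degree of some representative.\<close>

lemma lower_Suc:
  assumes "s \<in> lower (Suc n)"
  obtains t where "t \<in> tensors_up_to scale n" "s - t \<in> J"
proof -
  have "\<exists>t\<in>tensors_up_to scale n. s - t \<in> J"
    using assms unfolding lower_def
  proof (induction rule: fs.span_induct_alt)
    case base
    show ?case
      using fs.subspace_0 [OF tensors_up_to_subspace] fs.subspace_0 [OF J_subspace]
      by (intro bexI [of _ 0]) simp_all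
  next
    case (step c x y)
    then obtain t where t: "t \<in> tensors_up_to scale n" "y - t \<in> J" by blast
    have "\<exists>u\<in>tensors_up_to scale n. x - u \<in> J"
    proof (cases "x \<in> J")
      case True
      then show ?thesis
        using fs.subspace_0 [OF tensors_up_to_subspace] by (intro bexI [of _ 0]) simp_all
    next
      case False
      then obtain w where "x = P w" "length w \<le> n" using step by auto
      then show ?thesis
        using P_up_to fs.subspace_0 [OF J_subspace] by (intro bexI [of _ x]) simp_all
    qed
    then obtain u where u: "u \<in> tensors_up_to scale n" "x - u \<in> J" by blast
    have "fun_scale c x + y - (fun_scale c u + t) = fun_scale c (x - u) + (y - t)"
      by (simp add: fs.scale_right_diff_distrib)
    also have "\<dots> \<in> J" using t u by (intro fs.subspace_add fs.subspace_scale J_subspace)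
    finally show ?case
      using t u by (intro bexI [of _ "fun_scale c u + t"] fs.subspace_add fs.subspace_scale
          tensors_up_to_subspace)
  qed
  then show ?thesis using that by blast
qed

abbreviation SkewSym :: "(complex, 'g \<Rightarrow> 'v tensor set) module" where
  "SkewSym \<equiv> symmetric_skew G scale \<rho>"

lemma SkewSym_carrier:
  "f \<in> carrier SkewSym \<longleftrightarrow>
    (\<forall>g\<in>carrier G. f g \<in> carrier Sym) \<and> (\<forall>g. g \<notin> carrier G \<longrightarrow> f g = symmetric_proj scale 0)"
  by (simp add: symmetric_skew_def skew_group_algebra_def Sym_zero)

lemma proj_0_closed [simp]: "symmetric_proj scale 0 \<in> carrier Sym"
  using fs.subspace_0 [OF T_subspace] by simp

lemma SkewSym_apply: "f \<in> carrier SkewSym \<Longrightarrow> f g \<in> carrier Sym"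
  by (cases "g \<in> carrier G") (simp_all add: SkewSym_carrier)

lemma SkewSym_ops: "f \<oplus>\<^bsub>SkewSym\<^esub> f' = (\<lambda>g. f g \<oplus>\<^bsub>Sym\<^esub> f' g)" "c \<odot>\<^bsub>SkewSym\<^esub> f = (\<lambda>g. c \<odot>\<^bsub>Sym\<^esub> f g)"
  by (simp_all add: symmetric_skew_def skew_group_algebra_def)

lemma SkewSym_closed:
  assumes "f \<in> carrier SkewSym"
  shows "f' \<in> carrier SkewSym \<Longrightarrow> f \<oplus>\<^bsub>SkewSym\<^esub> f' \<in> carrier SkewSym" "c \<odot>\<^bsub>SkewSym\<^esub> f \<in> carrier SkewSym"
proof -
  have "X \<oplus>\<^bsub>Sym\<^esub> Y \<in> carrier Sym" "c \<odot>\<^bsub>Sym\<^esub> X \<in> carrier Sym"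
    if "X \<in> carrier Sym" "Y \<in> carrier Sym" for X Y
    using that fs.subspace_add [OF T_subspace] fs.subspace_scale [OF T_subspace]
    by (auto simp: Sym_carrier symmetric_proj_add symmetric_proj_smult)
  then show "f' \<in> carrier SkewSym \<Longrightarrow> f \<oplus>\<^bsub>SkewSym\<^esub> f' \<in> carrier SkewSym" "c \<odot>\<^bsub>SkewSym\<^esub> f \<in> carrier SkewSym"
    using assms by (auto simp: SkewSym_carrier SkewSym_ops symmetric_proj_add symmetric_proj_smult)
qed

end

section \<open>The map from S(V) # G to the quotient for one splitting\<close>

locale filtered_section = hecke_form G scale B \<rho> \<kappa>
  for G :: "('g, 'm) monoid_scheme" (structure)
    and scale :: "complex \<Rightarrow> 'v::ab_group_add \<Rightarrow> 'v" and B \<rho> \<kappa> +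
  fixes \<sigma> :: "'v tensor set \<Rightarrow> 'v tensor"
  assumes splitting: "filtered_splitting scale \<sigma>"
begin

lemma sigma_closed: "X \<in> carrier Sym \<Longrightarrow> \<sigma> X \<in> carrier T"
  and sigma_add: "X \<in> carrier Sym \<Longrightarrow> Y \<in> carrier Sym \<Longrightarrow> \<sigma> (X \<oplus>\<^bsub>Sym\<^esub> Y) = \<sigma> X + \<sigma> Y"
  and sigma_smult: "X \<in> carrier Sym \<Longrightarrow> \<sigma> (c \<odot>\<^bsub>Sym\<^esub> X) = fun_scale c (\<sigma> X)"
  and proj_sigma: "X \<in> carrier Sym \<Longrightarrow> symmetric_proj scale (\<sigma> X) = X"
  and sigma_up_to: "t \<in> tensors_up_to scale n \<Longrightarrow> \<sigma> (symmetric_proj scale t) \<in> tensors_up_to scale n"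
  using splitting unfolding filtered_splitting_def linear_map_def by auto

lemma sigma_0: "\<sigma> (symmetric_proj scale 0) = 0"
  using sigma_smult [OF proj_0_closed, of 0] symmetric_proj_smult [of 0 0] by simp

definition lift :: "('g \<Rightarrow> 'v tensor set) \<Rightarrow> 'g \<Rightarrow> 'v tensor" where
  "lift f = (\<lambda>g. \<sigma> (f g))"

lemma lift_closed: "f \<in> carrier SkewSym \<Longrightarrow> lift f \<in> carrier H"
  by (auto simp: lift_def H_carrier SkewSym_carrier sigma_closed sigma_0)

lemma lift_add:
  "f \<in> carrier SkewSym \<Longrightarrow> f' \<in> carrier SkewSym \<Longrightarrow> lift (f \<oplus>\<^bsub>SkewSym\<^esub> f') = lift f + lift f'"
  by (simp add: lift_def SkewSym_ops fun_eq_iff sigma_add SkewSym_apply plus_fun_apply)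

lemma lift_smult: "f \<in> carrier SkewSym \<Longrightarrow> lift (c \<odot>\<^bsub>SkewSym\<^esub> f) = skew_scale c (lift f)"
  by (simp add: lift_def SkewSym_ops fun_eq_iff sigma_smult SkewSym_apply skew_scale_def)

lemma lift_inject:
  assumes "f \<in> carrier SkewSym" "f' \<in> carrier SkewSym" "lift f = lift f'"
  shows "f = f'"
proof
  fix g
  have "symmetric_proj scale (\<sigma> (f g)) = symmetric_proj scale (\<sigma> (f' g))"
    using fun_cong [OF assms(3), of g] by (simp add: lift_def)
  then show "f g = f' g" using assms(1,2) by (simp add: proj_sigma SkewSym_apply)
qed

lemma quotient_carrier:
  "carrier (hecke_quotient G scale \<rho> \<kappa>) = (\<lambda>x. I +>\<^bsub>H\<^esub> x) ` carrier H"
  by (simp add: hecke_quotient_def H.quotient_carrier)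

lemma linear_map_lift:
  "linear_map SkewSym (hecke_quotient G scale \<rho> \<kappa>) (\<lambda>f. I +>\<^bsub>H\<^esub> lift f)"
  unfolding linear_map_def quotient_carrier
proof (intro conjI ballI allI funcsetI)
  fix f assume f: "f \<in> carrier SkewSym"
  show "I +>\<^bsub>H\<^esub> lift f \<in> (\<lambda>x. I +>\<^bsub>H\<^esub> x) ` carrier H" using lift_closed [OF f] by blast
  show "I +>\<^bsub>H\<^esub> lift (c \<odot>\<^bsub>SkewSym\<^esub> f) = c \<odot>\<^bsub>hecke_quotient G scale \<rho> \<kappa>\<^esub> (I +>\<^bsub>H\<^esub> lift f)" for c
    unfolding lift_smult [OF f] hecke_quotient_def H.quotient_smult [OF I_subspace] ..
  fix f' assume f': "f' \<in> carrier SkewSym"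
  show "I +>\<^bsub>H\<^esub> lift (f \<oplus>\<^bsub>SkewSym\<^esub> f') =
      (I +>\<^bsub>H\<^esub> lift f) \<oplus>\<^bsub>hecke_quotient G scale \<rho> \<kappa>\<^esub> (I +>\<^bsub>H\<^esub> lift f')"
    unfolding lift_add [OF f f'] hecke_quotient_def H.quotient_add [OF I_subspace] ..
qed

text \<open>The elements whose class is attained by a lift; that these are all of T(V) # G is the
  surjectivity half of the PBW property.\<close>

definition reducible :: "('g \<Rightarrow> 'v tensor) set" where
  "reducible = {r. \<exists>f\<in>carrier SkewSym. r - lift f \<in> I}"

lemma reducible_add:
  assumes "r \<in> reducible" "s \<in> reducible"
  shows "r + s \<in> reducible"
proof -
  obtain f f' where f: "f \<in> carrier SkewSym" "r - lift f \<in> I"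
    and f': "f' \<in> carrier SkewSym" "s - lift f' \<in> I" using assms by (auto simp: reducible_def)
  have "r + s - lift (f \<oplus>\<^bsub>SkewSym\<^esub> f') = (r - lift f) + (s - lift f')"
    by (simp add: lift_add f(1) f'(1))
  also have "\<dots> \<in> I" using f f' by (intro sk.subspace_add [OF I_subspace])
  finally show ?thesis unfolding reducible_def using SkewSym_closed(1) [OF f(1) f'(1)] by blast
qed

lemma reducible_scale:
  assumes "r \<in> reducible"
  shows "skew_scale c r \<in> reducible"
proof -
  obtain f where f: "f \<in> carrier SkewSym" "r - lift f \<in> I"
    using assms by (auto simp: reducible_def)
  have "skew_scale c r - lift (c \<odot>\<^bsub>SkewSym\<^esub> f) = skew_scale c (r - lift f)"
    by (simp add: lift_smult f(1) sk.scale_right_diff_distrib)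
  also have "\<dots> \<in> I" using f by (intro sk.subspace_scale [OF I_subspace])
  finally show ?thesis unfolding reducible_def using SkewSym_closed(2) [OF f(1)] by blast
qed

lemma reducible_I: "r \<in> I \<Longrightarrow> r \<in> reducible"
  unfolding reducible_def
  by (intro CollectI bexI [of _ "\<lambda>_. symmetric_proj scale 0"])
    (simp_all add: SkewSym_carrier lift_def sigma_0 flip: zero_fun_def)

lemma reducible_subspace: "sk.subspace reducible"
  using reducible_add reducible_scale reducible_I sk.subspace_0 [OF I_subspace]
  by (auto simp: sk.subspace_def)

text \<open>A tensor and the lift of its class in S(V) differ by a sum of commutators of degree at
  most \<open>n\<close>, by \<open>J_up_to\<close>. Modulo the ideal, each commutator equals its
  contraction, whose degree is smaller by 2.\<close>

lemma reducible_single: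
  "g \<in> carrier G \<Longrightarrow> t \<in> tensors_up_to scale n \<Longrightarrow> skew_single g t \<in> reducible"
proof (induction n arbitrary: g t rule: less_induct)
  case (less n)
  let ?X = "symmetric_proj scale t"
  have tT: "t \<in> carrier T" using less.prems tensors_up_to_T by blast
  have sX: "\<sigma> ?X \<in> tensors_up_to scale n" by (rule sigma_up_to) fact
  have "symmetric_proj scale (\<sigma> ?X) = ?X" using tT by (simp add: proj_sigma)
  then have "\<sigma> ?X - t \<in> J" by (simp only: symmetric_proj_eq_iff)
  then have "t - \<sigma> ?X \<in> J" using fs.subspace_neg [OF J_subspace, of "\<sigma> ?X - t"] by simp
  moreover have "t - \<sigma> ?X \<in> tensors_up_to scale n"
    using less.prems sX by (intro fs.subspace_diff tensors_up_to_subspace)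
  ultimately have "t - \<sigma> ?X \<in> fs.span {commutator_in A v w D |A v w D. length A + length D + 2 \<le> n}"
    by (rule J_up_to)
  then have "skew_single g (t - \<sigma> ?X) \<in> reducible"
  proof (induction rule: fs.span_induct_alt)
    case base
    show ?case using sk.subspace_0 [OF reducible_subspace] by (simp add: skew_single_simps)
  next
    case (step c x y)
    then obtain A v w D where x: "x = commutator_in A v w D" "length A + length D + 2 \<le> n" by auto
    have "skew_single (h \<otimes> g) (P (A @ map (\<rho> h) D)) \<in> reducible" if "h \<in> carrier G" for h
      using that less.prems x(2) by (intro less.IH [of "n - 2"] P_up_to) simp_all
    then have "(\<Sum>h\<in>carrier G. skew_scale (\<kappa> v w h) (skew_single (h \<otimes> g) (P (A @ map (\<rho> h) D)))) \<in> reducible"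
      by (intro sk.subspace_sum sk.subspace_scale reducible_subspace)
    moreover have "hecke_rel A v w D g \<in> reducible"
      by (intro reducible_I hecke_rel_in_I less.prems)
    ultimately have "hecke_rel A v w D g + (\<Sum>h\<in>carrier G. skew_scale (\<kappa> v w h)
        (skew_single (h \<otimes> g) (P (A @ map (\<rho> h) D)))) \<in> reducible"
      by (intro reducible_add)
    then have "skew_single g x \<in> reducible" by (simp add: hecke_rel_def x)
    then show ?case using step by (simp add: skew_single_simps reducible_add reducible_scale)
  qed
  moreover have "skew_single g (\<sigma> ?X) \<in> reducible"
  proof -
    let ?f = "\<lambda>k. if k = g then ?X else symmetric_proj scale 0"
    have "?f \<in> carrier SkewSym" using less.prems tT by (auto simp: SkewSym_carrier)
    moreover have "lift ?f = skew_single g (\<sigma> ?X)"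
      by (auto simp: lift_def skew_single_def fun_eq_iff sigma_0)
    ultimately show ?thesis
      using sk.subspace_0 [OF I_subspace] unfolding reducible_def by (intro CollectI bexI [of _ ?f]) simp_all
  qed
  ultimately have "skew_single g (t - \<sigma> ?X) + skew_single g (\<sigma> ?X) \<in> reducible"
    by (rule reducible_add)
  then show ?case by (simp add: skew_single_simps)
qed

lemma all_reducible:
  assumes "r \<in> carrier H"
  shows "r \<in> reducible"
proof -
  have "skew_single g (r g) \<in> reducible" if g: "g \<in> carrier G" for g
  proof -
    have "r g \<in> carrier T" using assms g by (simp add: H_carrier)
    then obtain n where "r g \<in> tensors_up_to scale n" using tensor_bounded_degree by blast
    then show ?thesis by (rule reducible_single [OF g])
  qed
  then have "(\<Sum>g\<in>carrier G. skew_single g (r g)) \<in> reducible"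
    by (intro sk.subspace_sum reducible_subspace)
  then show ?thesis using H_eq_sum_single [OF assms] by simp
qed

lemma bij_lift:
  assumes inj: "\<And>f. f \<in> carrier SkewSym \<Longrightarrow> lift f \<in> I \<Longrightarrow> lift f = 0"
  shows "vector_space_iso SkewSym (hecke_quotient G scale \<rho> \<kappa>) (\<lambda>f. I +>\<^bsub>H\<^esub> lift f)"
  unfolding vector_space_iso_def bij_betw_def
proof (intro conjI linear_map_lift)
  show "inj_on (\<lambda>f. I +>\<^bsub>H\<^esub> lift f) (carrier SkewSym)"
  proof (rule inj_onI)
    fix f f' assume f: "f \<in> carrier SkewSym" and f': "f' \<in> carrier SkewSym"
      and eq: "I +>\<^bsub>H\<^esub> lift f = I +>\<^bsub>H\<^esub> lift f'"
    let ?d = "f \<oplus>\<^bsub>SkewSym\<^esub> ((-1) \<odot>\<^bsub>SkewSym\<^esub> f')"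
    have d: "?d \<in> carrier SkewSym" by (intro SkewSym_closed f f')
    have ld: "lift ?d = lift f - lift f'"
      by (simp add: lift_add lift_smult f f' SkewSym_closed sk.scale_minus_left)
    have "lift f - lift f' \<in> I" using eq by (simp add: H.coset_eq_iff [OF I_subspace])
    then have "lift f - lift f' = 0" using inj [OF d] ld by simp
    then show "f = f'" by (intro lift_inject f f') simp
  qed
  show "(\<lambda>f. I +>\<^bsub>H\<^esub> lift f) ` carrier SkewSym = carrier (hecke_quotient G scale \<rho> \<kappa>)"
  proof
    show "(\<lambda>f. I +>\<^bsub>H\<^esub> lift f) ` carrier SkewSym \<subseteq> carrier (hecke_quotient G scale \<rho> \<kappa>)"
      unfolding quotient_carrier using lift_closed by blast
    show "carrier (hecke_quotient G scale \<rho> \<kappa>) \<subseteq> (\<lambda>f. I +>\<^bsub>H\<^esub> lift f) ` carrier SkewSym"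
    proof
      fix X assume "X \<in> carrier (hecke_quotient G scale \<rho> \<kappa>)"
      then obtain r where r: "X = I +>\<^bsub>H\<^esub> r" "r \<in> carrier H" unfolding quotient_carrier by blast
      then obtain f where f: "f \<in> carrier SkewSym" "r - lift f \<in> I"
        using all_reducible [OF r(2)] by (auto simp: reducible_def)
      have "X = I +>\<^bsub>H\<^esub> lift f" unfolding r(1) H.coset_eq_iff [OF I_subspace] by (rule f(2))
      then show "X \<in> (\<lambda>f. I +>\<^bsub>H\<^esub> lift f) ` carrier SkewSym" using f(1) by blast
    qed
  qed
qed

text \<open>In degree at most 1 every filtered splitting is forced: \<open>\<sigma>\<close> returns
  the tensor itself, since there are no symmetric relations there. So \<open>r\<close> is its own
  lift, and injectivity applies.\<close>

lemma I_up_to_1: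
  assumes pbw: "pbw_property G scale \<rho> \<kappa>" and r: "r \<in> I"
    and deg: "\<And>g. g \<in> carrier G \<Longrightarrow> r g \<in> tensors_up_to scale 1"
  shows "r = 0"
proof -
  have iso: "vector_space_iso SkewSym (hecke_quotient G scale \<rho> \<kappa>) (\<lambda>f. I +>\<^bsub>H\<^esub> lift f)"
    using pbw splitting unfolding pbw_property_def lift_def by blast
  have rH: "r \<in> carrier H" using r I_carrier by blast
  let ?f = "\<lambda>g. symmetric_proj scale (r g)"
  let ?z = "\<lambda>g. symmetric_proj scale 0"
  have f: "?f \<in> carrier SkewSym" using rH by (auto simp: SkewSym_carrier H_carrier)
  have z: "?z \<in> carrier SkewSym" by (simp add: SkewSym_carrier)
  have rT: "r g \<in> carrier T" for g
    using rH fs.subspace_0 [OF T_subspace] by (cases "g \<in> carrier G") (simp_all add: H_carrier)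
  have deg': "r g \<in> tensors_up_to scale 1" for g
    using rH deg fs.subspace_0 [OF tensors_up_to_subspace, of 1]
    by (cases "g \<in> carrier G") (simp_all add: H_carrier)
  have "\<sigma> (?f g) = r g" for g
  proof -
    have "\<sigma> (?f g) \<in> tensors_up_to scale 1" by (rule sigma_up_to [OF deg'])
    then have "\<sigma> (?f g) - r g \<in> tensors_up_to scale 1"
      using deg' by (intro fs.subspace_diff tensors_up_to_subspace)
    moreover have "symmetric_proj scale (\<sigma> (?f g)) = ?f g" using rT by (simp add: proj_sigma)
    then have "\<sigma> (?f g) - r g \<in> J" by (simp only: symmetric_proj_eq_iff)
    ultimately show ?thesis using J_up_to_1 by fastforce
  qed
  then have lf: "lift ?f = r" by (simp add: lift_def)
  have lz: "lift ?z = 0" by (simp add: lift_def sigma_0 fun_eq_iff zero_fun_apply)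
  have "I +>\<^bsub>H\<^esub> lift ?f = I +>\<^bsub>H\<^esub> lift ?z"
    unfolding H.coset_eq_iff [OF I_subspace] lf lz using r by simp
  then have "?f = ?z"
    using iso f z unfolding vector_space_iso_def bij_betw_def by (blast dest: inj_onD)
  then show ?thesis using lf lz by simp
qed

end

context hecke_pbw_form
begin

text \<open>Suppose \<open>lift f\<close> lies in the ideal. Its leading term is then a symmetric
  relation, which gives the class \<open>f\<close> a representative of smaller degree, though not
  yet \<open>lift f\<close> itself. As \<open>\<sigma>\<close> respects degrees,
  \<open>lift f\<close> drops along with \<open>f\<close>, and the argument repeats until
  \<open>lower 0\<close> is reached.\<close>

theorem pbw: "pbw_property G scale \<rho> \<kappa>"
  unfolding pbw_property_def
proof (intro allI impI)
  fix \<sigma> assume \<sigma>: "filtered_splitting scale \<sigma>"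
  interpret filtered_section G scale B \<rho> \<kappa> \<sigma> by unfold_locales (rule \<sigma>)
  have "vector_space_iso SkewSym (hecke_quotient G scale \<rho> \<kappa>) (\<lambda>f. I +>\<^bsub>H\<^esub> lift f)"
  proof (rule bij_lift)
    fix f assume f: "f \<in> carrier SkewSym" and fI: "lift f \<in> I"
    have up: "\<exists>t\<in>tensors_up_to scale n. f g = symmetric_proj scale t"
      if "\<And>g. g \<in> carrier G \<Longrightarrow> \<exists>t\<in>tensors_up_to scale n. f g = symmetric_proj scale t" for n g
      using that [of g] f fs.subspace_0 [OF tensors_up_to_subspace, of n]
      by (cases "g \<in> carrier G") (auto simp: SkewSym_carrier)
    have lower: "lift f g \<in> lower n"
      if "\<And>g. g \<in> carrier G \<Longrightarrow> \<exists>t\<in>tensors_up_to scale n. f g = symmetric_proj scale t" for n g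
      using up [OF that] by (intro I_leading_term [OF fI]) (metis lift_def sigma_up_to)
    have proj: "f g = symmetric_proj scale (lift f g)" for g
      using f by (simp add: lift_def proj_sigma SkewSym_apply)
    have zero: "f g = symmetric_proj scale 0"
      if "\<And>g. g \<in> carrier G \<Longrightarrow> \<exists>t\<in>tensors_up_to scale n. f g = symmetric_proj scale t" for n g
      using that
    proof (induction n)
      case 0
      have "lift f g \<in> J" using lower [OF 0, of g] by (simp add: lower_0)
      then show ?case by (subst proj) (simp add: symmetric_proj_eq_iff)
    next
      case (Suc n)
      show ?case
      proof (rule Suc.IH)
        fix h
        obtain t where "t \<in> tensors_up_to scale n" "lift f h - t \<in> J"
          using lower_Suc [OF lower [OF Suc.prems, of h]] by blast
        then show "\<exists>t\<in>tensors_up_to scale n. f h = symmetric_proj scale t"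
          using proj [of h] by (metis symmetric_proj_eq_iff)
      qed
    qed
    obtain n where n: "\<And>g. g \<in> carrier G \<Longrightarrow> lift f g \<in> tensors_up_to scale n"
      using tensors_bounded_degree [of "lift f"] lift_closed [OF f] by (auto simp: H_carrier)
    have "f g = symmetric_proj scale 0" for g
      by (rule zero [of n]) (use n proj in blast)
    then show "lift f = 0" by (simp add: lift_def fun_eq_iff sigma_0 zero_fun_apply)
  qed
  then show "vector_space_iso SkewSym (hecke_quotient G scale \<rho> \<kappa>) (\<lambda>f. I +>\<^bsub>H\<^esub> (\<lambda>g. \<sigma> (f g)))"
    by (simp add: lift_def)
qed

end


section \<open>Necessity of invariance and the Jacobi condition\<close>

context group_rep
begin

lemma P_single_eq_0: "P [x] = 0 \<Longrightarrow> x = 0"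
proof -
  assume x: "P [x] = 0"
  have "coord b x = 0" for b
  proof -
    have "P [x] [coord b] = coord b x" using coord_dual [of b] by (simp add: pure_tensor_def)
    then show ?thesis by (simp add: x zero_fun_apply)
  qed
  then have "V.representation B x b = 0" for b by (simp add: coord_def)
  moreover have "(\<Sum>b\<in>B. scale (V.representation B x b) b) = x"
    by (rule V.sum_representation_eq) (simp_all add: V.independent_Basis V.span_Basis V.finite_Basis)
  ultimately show "x = 0" by simp
qed

lemma P_Nil_apply: "P [] [] = 1"
  by (simp add: pure_tensor_def)

lemma P_single_linear:
  "P [x + y] = P [x] + P [y]" "P [x - y] = P [x] - P [y]" "P [scale c x] = fun_scale c (P [x])"
proof -
  show add: "P [x + y] = P [x] + P [y]" for x y
    using multilinear_on_append(1) [OF multilin_P [of 1], of "[]" "[]" x y] by simp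
  show "P [scale c x] = fun_scale c (P [x])"
    using multilinear_on_append(2) [OF multilin_P [of 1], of "[]" "[]" c x] by simp
  show "P [x - y] = P [x] - P [y]" using add [of "x - y" y] by simp
qed

end

context hecke_form
begin

lemma pbw_I_up_to_1:
  assumes "pbw_property G scale \<rho> \<kappa>" "r \<in> I" "\<And>g. g \<in> carrier G \<Longrightarrow> r g \<in> tensors_up_to scale 1"
  shows "r = 0"
proof -
  obtain \<sigma> where "filtered_splitting scale \<sigma>" using filtered_splitting_exists by blast
  then interpret filtered_section G scale B \<rho> \<kappa> \<sigma> by unfold_locales
  show ?thesis by (rule I_up_to_1 [OF assms])
qed

lemma sum_single_apply:
  assumes "g \<in> carrier G"
  shows "(\<Sum>h\<in>carrier G. skew_scale (c h) (skew_single h (f h))) g = fun_scale (c g) (f g)"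
proof -
  have "(\<Sum>h\<in>carrier G. skew_scale (c h) (skew_single h (f h))) g =
      (\<Sum>h\<in>carrier G. if h = g then fun_scale (c g) (f g) else 0)"
    by (auto simp: sum_fun_apply skew_scale_def skew_single_apply intro!: sum.cong)
  then show ?thesis using finite_G assms by simp
qed

text \<open>Conjugating the relation of (v, w) by h and subtracting the relation of (hv, hw) cancels
  the commutators. What remains in the ideal is an element of the group algebra, of degree 0, whose
  coefficients are the defects of invariance.\<close>

lemma pbw_invariant:
  assumes pbw: "pbw_property G scale \<rho> \<kappa>" and g: "g \<in> carrier G" and h: "h \<in> carrier G"
  shows "\<kappa> (\<rho> h v) (\<rho> h w) (h \<otimes> g \<otimes> inv h) = \<kappa> v w g"
proof -
  have sum_eq: "(\<Sum>k\<in>carrier G. skew_scale (\<kappa> v w k) (skew_single (h \<otimes> (k \<otimes> inv h)) (P []))) =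
      (\<Sum>k\<in>carrier G. skew_scale (\<kappa> v w (inv h \<otimes> k \<otimes> h)) (skew_single k (P [])))"
  proof (rule sum.reindex_bij_witness [of _ "\<lambda>k. inv h \<otimes> k \<otimes> h" "\<lambda>k. h \<otimes> (k \<otimes> inv h)"])
    fix k assume k: "k \<in> carrier G"
    show "inv h \<otimes> (h \<otimes> (k \<otimes> inv h)) \<otimes> h = k" "h \<otimes> (inv h \<otimes> k \<otimes> h \<otimes> inv h) = k"
      using h k by (simp_all add: m_assoc) (simp_all flip: m_assoc)
    then show "skew_scale (\<kappa> v w (inv h \<otimes> (h \<otimes> (k \<otimes> inv h)) \<otimes> h)) (skew_single (h \<otimes> (k \<otimes> inv h)) (P [])) =
       skew_scale (\<kappa> v w k) (skew_single (h \<otimes> (k \<otimes> inv h)) (P []))" by simp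
  qed (use h in simp_all)
  define r where "r = (\<Sum>k\<in>carrier G. skew_scale (\<kappa> (\<rho> h v) (\<rho> h w) k - \<kappa> v w (inv h \<otimes> k \<otimes> h))
      (skew_single k (P [])))"
  have "skew_single h (P []) \<otimes>\<^bsub>H\<^esub> hecke_rel [] v w [] (inv h) \<in> I"
    using h by (intro ideal.I_l_closed [OF I_ideal] hecke_rel_in_I) simp_all
  then have "skew_single h (P []) \<otimes>\<^bsub>H\<^esub> hecke_rel [] v w [] (inv h) -
      hecke_rel [] (\<rho> h v) (\<rho> h w) [] \<one> \<in> I"
    by (intro sk.subspace_diff [OF I_subspace] hecke_rel_in_I) simp_all
  moreover have "skew_single h (P []) \<otimes>\<^bsub>H\<^esub> hecke_rel [] v w [] (inv h) -
      hecke_rel [] (\<rho> h v) (\<rho> h w) [] \<one> = r"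
    using h by (simp add: hecke_rel_left) (simp add: hecke_rel_def r_def sum_eq sk.scale_left_diff_distrib sum_subtractf)
  ultimately have "r \<in> I" by simp
  moreover have "r k \<in> tensors_up_to scale 1" if "k \<in> carrier G" for k
    unfolding r_def sum_single_apply [OF that]
    by (intro fs.subspace_scale tensors_up_to_subspace P_up_to) simp
  ultimately have "r = 0" by (rule pbw_I_up_to_1 [OF pbw])
  let ?k = "h \<otimes> g \<otimes> inv h"
  have k: "?k \<in> carrier G" using g h by simp
  have "r ?k [] = \<kappa> (\<rho> h v) (\<rho> h w) ?k - \<kappa> v w (inv h \<otimes> ?k \<otimes> h)"
    unfolding r_def sum_single_apply [OF k] by (simp add: fun_scale_def P_Nil_apply)
  moreover have "inv h \<otimes> ?k \<otimes> h = g" using g h by (simp add: m_assoc) (simp flip: m_assoc)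
  ultimately show ?thesis using \<open>r = 0\<close> by (simp add: zero_fun_apply)
qed

text \<open>The Jacobi identity of the commutators in T(V). The difference of the relations
  multiplied by a on the left and on the right is a double commutator plus the terms with ha - a; in
  the cyclic sum the double commutators vanish, and an element of degree 1 remains.\<close>

lemma pbw_jacobi:
  assumes pbw: "pbw_property G scale \<rho> \<kappa>" and g: "g \<in> carrier G"
  shows "scale (\<kappa> u v g) (\<rho> g w - w) + scale (\<kappa> v w g) (\<rho> g u - u) +
      scale (\<kappa> w u g) (\<rho> g v - v) = 0"
proof -
  define X where "X h = scale (\<kappa> u v h) (\<rho> h w - w) + scale (\<kappa> v w h) (\<rho> h u - u) +
      scale (\<kappa> w u h) (\<rho> h v - v)" for h
  \<comment> \<open>The scalar 1 only brings \<open>r\<close> into the shape of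
    \<open>sum_single_apply\<close>.\<close>
  define r where "r = (\<Sum>h\<in>carrier G. skew_scale 1 (skew_single h (P [X h])))"
  have rel: "hecke_rel [a] b c [] \<one> - hecke_rel [] b c [a] \<one> =
      skew_single \<one> (commutator_in [a] b c [] - commutator_in [] b c [a]) +
      (\<Sum>h\<in>carrier G. skew_single h (P [scale (\<kappa> b c h) (\<rho> h a - a)]))" for a b c
  proof -
    have "hecke_rel [a] b c [] \<one> - hecke_rel [] b c [a] \<one> =
      skew_single \<one> (commutator_in [a] b c [] - commutator_in [] b c [a]) +
      ((\<Sum>h\<in>carrier G. skew_scale (\<kappa> b c h) (skew_single (h \<otimes> \<one>) (P [\<rho> h a]))) -
       (\<Sum>h\<in>carrier G. skew_scale (\<kappa> b c h) (skew_single (h \<otimes> \<one>) (P [a]))))"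
      by (simp add: hecke_rel_def skew_single_simps)
    also have "(\<Sum>h\<in>carrier G. skew_scale (\<kappa> b c h) (skew_single (h \<otimes> \<one>) (P [\<rho> h a]))) -
       (\<Sum>h\<in>carrier G. skew_scale (\<kappa> b c h) (skew_single (h \<otimes> \<one>) (P [a]))) =
       (\<Sum>h\<in>carrier G. skew_single h (P [scale (\<kappa> b c h) (\<rho> h a - a)]))"
      unfolding sum_subtractf [symmetric]
      by (rule sum.cong)
        (simp_all add: P_single_linear skew_single_simps sk.scale_right_diff_distrib)
    finally show ?thesis .
  qed
  have "(hecke_rel [w] u v [] \<one> - hecke_rel [] u v [w] \<one>) + (hecke_rel [u] v w [] \<one> - hecke_rel [] v w [u] \<one>) +
      (hecke_rel [v] w u [] \<one> - hecke_rel [] w u [v] \<one>) \<in> I"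
    by (intro sk.subspace_add [OF I_subspace] sk.subspace_diff [OF I_subspace] hecke_rel_in_I) simp_all
  moreover have "(hecke_rel [w] u v [] \<one> - hecke_rel [] u v [w] \<one>) + (hecke_rel [u] v w [] \<one> - hecke_rel [] v w [u] \<one>) +
      (hecke_rel [v] w u [] \<one> - hecke_rel [] w u [v] \<one>) = r"
  proof -
    have "(commutator_in [w] u v [] - commutator_in [] u v [w]) + (commutator_in [u] v w [] - commutator_in [] v w [u]) +
      (commutator_in [v] w u [] - commutator_in [] w u [v]) = 0"
      by (simp add: commutator_in_def)
    then have "skew_single \<one> (commutator_in [w] u v [] - commutator_in [] u v [w]) +
        skew_single \<one> (commutator_in [u] v w [] - commutator_in [] v w [u]) +
        skew_single \<one> (commutator_in [v] w u [] - commutator_in [] w u [v]) = 0"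
      unfolding skew_single_simps(1) [symmetric] by (simp add: skew_single_simps(4))
    moreover have "r = (\<Sum>h\<in>carrier G. skew_single h (P [scale (\<kappa> u v h) (\<rho> h w - w)])) +
        (\<Sum>h\<in>carrier G. skew_single h (P [scale (\<kappa> v w h) (\<rho> h u - u)])) +
        (\<Sum>h\<in>carrier G. skew_single h (P [scale (\<kappa> w u h) (\<rho> h v - v)]))"
      by (simp only: r_def X_def P_single_linear(1) skew_single_simps(1) sum.distrib sk.scale_one)
    ultimately show ?thesis unfolding rel by (simp add: algebra_simps)
  qed
  ultimately have "r \<in> I" by simp
  moreover have "r k \<in> tensors_up_to scale 1" if "k \<in> carrier G" for k
    unfolding r_def sum_single_apply [OF that]
    by (intro fs.subspace_scale tensors_up_to_subspace P_up_to) simp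
  ultimately have "r = 0" by (rule pbw_I_up_to_1 [OF pbw])
  then have "P [X g] = 0" using sum_single_apply [OF g, of "\<lambda>_. 1" "\<lambda>h. P [X h]"] by (simp add: r_def zero_fun_apply)
  then show ?thesis using P_single_eq_0 by (simp add: X_def)
qed

end


section \<open>The components of the constant cocycles\<close>

lemma permutes_lessThan_2: "{p. p permutes {..<2::nat}} = {id, transpose 0 1}"
proof -
  have "{..<2::nat} = {0, 1}" by auto
  then show ?thesis by (auto simp: permutes_doubleton_iff)
qed

lemma wedge_pair: "wedge [\<phi>, \<psi>] [a, b] = \<phi> a * \<psi> b - \<phi> b * \<psi> a"
proof -
  have 2: "Suc (Suc 0) = 2" by simp
  have "transpose 0 (1::nat) \<noteq> id" by (metis id_apply transpose_apply_first zero_neq_one)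
  moreover have "(\<Prod>i<2. f i) = f 0 * f (1::nat)" for f :: "nat \<Rightarrow> complex"
    by (simp add: numeral_2_eq_2)
  ultimately show ?thesis
    by (simp add: wedge_def 2 permutes_lessThan_2 sign_swap_id)
qed

lemma wedge_length: "length vs \<noteq> length \<phi>s \<Longrightarrow> wedge \<phi>s vs = 0"
  by (simp add: wedge_def)

lemma length_2_list: "length vs = 2 \<Longrightarrow> \<exists>a b. vs = [a, b]"
  by (auto simp: numeral_2_eq_2 length_Suc_conv)

section \<open>The decomposition of V by an invariant inner product\<close>

locale hermitian_rep = group_rep G scale B \<rho>
  for G :: "('g, 'm) monoid_scheme" (structure)
    and scale :: "complex \<Rightarrow> 'v::ab_group_add \<Rightarrow> 'v" and B \<rho> +
  fixes ip :: "'v \<Rightarrow> 'v \<Rightarrow> complex"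
  assumes inner: "invariant_inner_product G scale \<rho> ip"
begin

lemma ip_add: "ip (x + y) w = ip x w + ip y w"
  and ip_scale: "ip (scale c x) w = c * ip x w"
proof -
  have "Vector_Spaces.linear scale (*) (\<lambda>v. ip v w)" using inner unfolding invariant_inner_product_def by blast
  then show "ip (x + y) w = ip x w + ip y w" "ip (scale c x) w = c * ip x w"
    by (simp_all add: Vector_Spaces.linear_iff)
qed

lemma ip_0: "ip 0 w = 0"
  using ip_scale [of 0 0 w] by simp

lemma ip_diff: "ip (x - y) w = ip x w - ip y w"
  using ip_add [of "x - y" y w] by simp

lemma ip_sum: "ip (\<Sum>i\<in>A. f i) w = (\<Sum>i\<in>A. ip (f i) w)"
  by (induction A rule: infinite_finite_induct) (simp_all add: ip_0 ip_add)

lemma ip_self: "ip v v = 0 \<Longrightarrow> v = 0"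
  using inner unfolding invariant_inner_product_def by (metis less_irrefl zero_complex.simps(1))

lemma ip_invariant: "g \<in> carrier G \<Longrightarrow> ip (\<rho> g v) (\<rho> g w) = ip v w"
  using inner unfolding invariant_inner_product_def by blast

abbreviation Fix :: "'g \<Rightarrow> 'v set" where "Fix g \<equiv> fixed_space \<rho> g"
abbreviation Perp :: "'g \<Rightarrow> 'v set" where "Perp g \<equiv> orth_complement ip (Fix g)"

lemma rho_zero: "g \<in> carrier G \<Longrightarrow> \<rho> g 0 = 0"
  using rho_scale [of g 0 0] by simp

lemma rho_sum: "g \<in> carrier G \<Longrightarrow> \<rho> g (\<Sum>i\<in>A. f i) = (\<Sum>i\<in>A. \<rho> g (f i))"
  by (induction A rule: infinite_finite_induct) (simp_all add: rho_zero rho_add)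

lemma Fix_subspace: "g \<in> carrier G \<Longrightarrow> V.subspace (Fix g)"
  by (auto simp: V.subspace_def fixed_space_def rho_zero rho_add rho_scale)

lemma Perp_subspace: "V.subspace (Perp g)"
  by (auto simp: V.subspace_def orth_complement_def ip_0 ip_add ip_scale)

lemma Fix_Perp: "v \<in> Fix g \<Longrightarrow> v \<in> Perp g \<Longrightarrow> v = 0"
  by (rule ip_self) (simp add: orth_complement_def)

text \<open>The orthogonal projection onto \<open>V\<^sup>g\<close> is the average over the powers of \<open>g\<close>.\<close>

lemma Fix_Perp_decomposition:
  assumes g: "g \<in> carrier G"
  shows "\<exists>u\<in>Fix g. v - u \<in> Perp g"
proof -
  let ?n = "order G"
  \<comment> \<open>The average runs over as many powers as G has elements; that number is a
    multiple of the order of g, so applying g permutes the summands cyclically.\<close>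
  define u where "u = scale (1 / of_nat ?n) (\<Sum>k<?n. \<rho> (g [^] k) v)"
  have n: "?n > 0" using finite_G by (simp add: order_gt_0_iff_finite)
  have gk: "g [^] k \<in> carrier G" for k :: nat using g by simp
  have "(\<Sum>k<?n. \<rho> (g [^] Suc k) v) = (\<Sum>k<?n. \<rho> (g [^] k) v)"
    using sum.lessThan_Suc_shift [of "\<lambda>k. \<rho> (g [^] k) v" ?n] pow_order_eq_1 [OF g] by simp
  moreover have "\<rho> g (\<rho> (g [^] k) v) = \<rho> (g [^] Suc k) v" for k :: nat
    using rho_mult [OF g gk] nat_pow_Suc2 [OF g] by simp
  ultimately have "u \<in> Fix g"
    by (simp add: fixed_space_def u_def rho_scale [OF g] rho_sum [OF g])
  moreover have "v - u \<in> Perp g"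
    unfolding orth_complement_def
  proof (intro CollectI ballI)
    fix x assume x: "x \<in> Fix g"
    have "\<rho> (g [^] k) x = x" for k :: nat
    proof (induction k)
      case (Suc k)
      then show ?case using x rho_mult [OF gk g] by (simp add: fixed_space_def)
    qed simp
    then have "ip (\<rho> (g [^] k) v) x = ip v x" for k :: nat
      using ip_invariant [OF gk, of k v x] by simp
    then show "ip (v - u) x = 0"
      using n by (simp add: u_def ip_diff ip_scale ip_sum)
  qed
  ultimately show ?thesis by blast
qed

lemma dual_linear:
  assumes "\<phi> \<in> dual_space scale"
  shows "\<phi> (x + y) = \<phi> x + \<phi> y" "\<phi> (scale c x) = c * \<phi> x" "\<phi> 0 = 0" "\<phi> (x - y) = \<phi> x - \<phi> y"
    "\<phi> (\<Sum>i\<in>A. f i) = (\<Sum>i\<in>A. \<phi> (f i))"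
proof -
  show add: "\<phi> (x + y) = \<phi> x + \<phi> y" and sc: "\<phi> (scale c x) = c * \<phi> x" for x y c
    using assms by (simp_all add: dual_space_def Vector_Spaces.linear_iff)
  show z: "\<phi> 0 = 0" using sc [of 0 0] by simp
  show "\<phi> (x - y) = \<phi> x - \<phi> y" using add [of "x - y" y] by simp
  show "\<phi> (\<Sum>i\<in>A. f i) = (\<Sum>i\<in>A. \<phi> (f i))"
    by (induction A rule: infinite_finite_induct) (simp_all add: z add)
qed

lemma dual_spaceI:
  assumes "\<And>x y. \<phi> (x + y) = \<phi> x + \<phi> y" "\<And>c x. \<phi> (scale c x) = c * \<phi> x"
  shows "\<phi> \<in> dual_space scale"
  using assms by (simp add: dual_space_def Vector_Spaces.linear_iff V.vector_space_axioms complex_mult_vector_space)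

text \<open>A basis \<open>b\<close> of the complement with its coordinates, extended by zero to the
  fixed space. Indexing by numbers below the codimension lets the later proof distinguish cases by
  that number and name the first coordinates.\<close>

lemma Perp_coordinates:
  assumes g: "g \<in> carrier G"
  defines "c \<equiv> codim scale (Fix g)"
  shows "\<exists>(b :: nat \<Rightarrow> 'v) \<chi>. (\<forall>i<c. \<chi> i \<in> dual_vanishing_on scale (Fix g)) \<and>
    (\<forall>i<c. \<forall>j<c. \<chi> i (b j) = (if i = j then 1 else 0)) \<and>
    (\<forall>v. v - (\<Sum>i<c. scale (\<chi> i v) (b i)) \<in> Fix g) \<and>
    (\<forall>v\<in>Perp g. v = (\<Sum>i<c. scale (\<chi> i v) (b i)))"
proof -
    have "{x + y |x y. x \<in> Fix g \<and> y \<in> Perp g} = UNIV"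
  proof -
    have "\<exists>x y. v = x + y \<and> x \<in> Fix g \<and> y \<in> Perp g" for v
      using Fix_Perp_decomposition [OF g, of v] by (metis add_diff_cancel_left' diff_add_cancel add.commute)
    then show ?thesis by blast
  qed
  moreover have "Fix g \<inter> Perp g = {0}"
    using Fix_Perp V.subspace_0 [OF Fix_subspace [OF g]] V.subspace_0 [OF Perp_subspace] by blast
  ultimately have dim: "V.dim (Perp g) = c"
    using V.dim_sums_Int [OF Fix_subspace [OF g] Perp_subspace [of g]] by (simp add: c_def codim_def)
  obtain W where W: "W \<subseteq> Perp g" "V.independent W" "Perp g \<subseteq> V.span W" "card W = V.dim (Perp g)"
    by (rule V.basis_exists)
  have finW: "finite W" using W(2) by (rule V.finiteI_independent)
  then obtain b where b: "bij_betw b {..<c} W"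
    using W(4) dim ex_bij_betw_nat_finite [of W] by (auto simp: atLeast0LessThan)
  have "\<forall>v. \<exists>q. q \<in> Perp g \<and> v - q \<in> Fix g"
  proof
    fix v
    obtain u where u: "u \<in> Fix g" "v - u \<in> Perp g" using Fix_Perp_decomposition [OF g] by blast
    then show "\<exists>q. q \<in> Perp g \<and> v - q \<in> Fix g" by (intro exI [of _ "v - u"]) simp
  qed
  \<comment> \<open>The orthogonal projection onto \<open>Perp g\<close>, chosen pointwise;
    uniqueness of the decomposition makes it linear.\<close>
  then obtain q where q: "\<And>v. q v \<in> Perp g" "\<And>v. v - q v \<in> Fix g" by metis
  have q_unique: "q v = y" if "y \<in> Perp g" "v - y \<in> Fix g" for v y
  proof -
    have "q v - y \<in> Perp g" using q(1) that by (intro V.subspace_diff Perp_subspace)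
    moreover have "(v - y) - (v - q v) \<in> Fix g" 
      by (rule V.subspace_diff [OF Fix_subspace [OF g] that(2) q(2)])
    ultimately show ?thesis using Fix_Perp [of "q v - y" g] by simp
  qed
  have q_add: "q (x + y) = q x + q y" for x y
  proof (rule q_unique)
    show "q x + q y \<in> Perp g" by (intro V.subspace_add Perp_subspace q)
    have "(x - q x) + (y - q y) \<in> Fix g" by (intro V.subspace_add Fix_subspace g q)
    then show "x + y - (q x + q y) \<in> Fix g" by (simp add: algebra_simps)
  qed
  have q_scale: "q (scale c x) = scale c (q x)" for c x
  proof (rule q_unique)
    show "scale c (q x) \<in> Perp g" by (intro V.subspace_scale Perp_subspace q)
    have "scale c (x - q x) \<in> Fix g" by (intro V.subspace_scale Fix_subspace g q)
    then show "scale c x - scale c (q x) \<in> Fix g" by (simp add: V.scale_right_diff_distrib)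
  qed
  have q_Perp: "q v = v" if "v \<in> Perp g" for v
    using that V.subspace_0 [OF Fix_subspace [OF g]] by (intro q_unique) simp_all
  have q_Fix: "q v = 0" if "v \<in> Fix g" for v
    using that V.subspace_0 [OF Perp_subspace] by (intro q_unique) simp_all
  have qspan: "q v \<in> V.span W" for v using q(1) W(3) by blast
  define \<chi> where "\<chi> i v = V.representation W (q v) (b i)" for i v
  have expand: "q v = (\<Sum>i<c. scale (\<chi> i v) (b i))" for v
  proof -
    have "(\<Sum>i<c. scale (\<chi> i v) (b i)) = (\<Sum>w\<in>W. scale (V.representation W (q v) w) w)"
      unfolding \<chi>_def by (rule sum.reindex_bij_betw [OF b])
    also have "\<dots> = q v" by (rule V.sum_representation_eq [OF W(2) qspan finW order_refl])
    finally show ?thesis ..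
  qed
  have bW: "b i \<in> W" if "i < c" for i using b that by (auto simp: bij_betw_def)
  have dual: "\<chi> i \<in> dual_vanishing_on scale (Fix g)" for i
  proof -
    have "\<chi> i \<in> dual_space scale"
      by (rule dual_spaceI)
        (simp_all add: \<chi>_def q_add q_scale V.representation_add V.representation_scale W(2) qspan)
    moreover have "\<chi> i v = 0" if "v \<in> Fix g" for v
      by (simp add: \<chi>_def q_Fix [OF that] V.representation_zero)
    ultimately show ?thesis by (simp add: dual_vanishing_on_def)
  qed
  have delta: "\<chi> i (b j) = (if i = j then 1 else 0)" if i: "i < c" and j: "j < c" for i j
  proof -
    have "q (b j) = b j" using bW [OF j] W(1) q_Perp by blast
    moreover have "b i = b j \<longleftrightarrow> i = j" using b i j by (auto simp: bij_betw_def inj_on_def)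
    ultimately show ?thesis
      by (simp add: \<chi>_def V.representation_basis [OF W(2) bW [OF j]])
  qed
  show ?thesis
  proof (intro exI [of _ b] exI [of _ \<chi>] conjI allI impI ballI)
    fix v
    show "v - (\<Sum>i<c. scale (\<chi> i v) (b i)) \<in> Fix g" unfolding expand [symmetric] by (rule q)
    show "v = (\<Sum>i<c. scale (\<chi> i v) (b i))" if "v \<in> Perp g"
      using expand [of v] q_Perp [OF that] by simp
  qed (rule dual, rule delta)
qed

text \<open>Linearity in the second argument comes from skewness. Vanishing on lists that are not
  pairs matches the convention of \<open>wedge\<close>, so that equality of forms can be tested on
  pairs.\<close>

definition alternating_2form :: "('v list \<Rightarrow> complex) \<Rightarrow> bool" where
  "alternating_2form \<omega> \<longleftrightarrow> (\<forall>vs. length vs \<noteq> 2 \<longrightarrow> \<omega> vs = 0) \<and>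
     (\<forall>x y v. \<omega> [x + y, v] = \<omega> [x, v] + \<omega> [y, v]) \<and>
     (\<forall>c x v. \<omega> [scale c x, v] = c * \<omega> [x, v]) \<and>
     (\<forall>x y. \<omega> [x, y] = - \<omega> [y, x])"

lemma alternating_2formI:
  assumes "\<And>vs. length vs \<noteq> 2 \<Longrightarrow> \<omega> vs = 0" "\<And>x y v. \<omega> [x + y, v] = \<omega> [x, v] + \<omega> [y, v]"
    "\<And>c x v. \<omega> [scale c x, v] = c * \<omega> [x, v]" "\<And>x y. \<omega> [x, y] = - \<omega> [y, x]"
  shows "alternating_2form \<omega>"
  using assms unfolding alternating_2form_def by blast

lemma alternating_2formD:
  assumes "alternating_2form \<omega>"
  shows "length vs \<noteq> 2 \<Longrightarrow> \<omega> vs = 0" "\<omega> [x + y, v] = \<omega> [x, v] + \<omega> [y, v]"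
    "\<omega> [scale c x, v] = c * \<omega> [x, v]" "\<omega> [x, y] = - \<omega> [y, x]"
  using assms unfolding alternating_2form_def by blast+

definition form_jacobi :: "'g \<Rightarrow> ('v list \<Rightarrow> complex) \<Rightarrow> bool" where
  "form_jacobi g \<omega> \<longleftrightarrow> (\<forall>u v w. scale (\<omega> [u, v]) (\<rho> g w - w) + scale (\<omega> [v, w]) (\<rho> g u - u) +
      scale (\<omega> [w, u]) (\<rho> g v - v) = 0)"

lemma form_subspace: "fs.subspace {\<omega>. alternating_2form \<omega> \<and> form_jacobi g \<omega>}"
  unfolding fs.subspace_def
proof (intro conjI allI ballI)
  show "0 \<in> {\<omega>. alternating_2form \<omega> \<and> form_jacobi g \<omega>}"
    by (simp add: alternating_2form_def form_jacobi_def zero_fun_apply)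
next
  fix \<omega> \<eta> assume *: "\<omega> \<in> {\<omega>. alternating_2form \<omega> \<and> form_jacobi g \<omega>}" "\<eta> \<in> {\<omega>. alternating_2form \<omega> \<and> form_jacobi g \<omega>}"
  have "form_jacobi g (\<omega> + \<eta>)"
    unfolding form_jacobi_def
  proof (intro allI)
    fix u v w
    have "(scale (\<omega> [u, v]) (\<rho> g w - w) + scale (\<omega> [v, w]) (\<rho> g u - u) + scale (\<omega> [w, u]) (\<rho> g v - v)) +
      (scale (\<eta> [u, v]) (\<rho> g w - w) + scale (\<eta> [v, w]) (\<rho> g u - u) + scale (\<eta> [w, u]) (\<rho> g v - v)) = 0"
      using * by (simp add: form_jacobi_def)
    then show "scale ((\<omega> + \<eta>) [u, v]) (\<rho> g w - w) + scale ((\<omega> + \<eta>) [v, w]) (\<rho> g u - u) +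
      scale ((\<omega> + \<eta>) [w, u]) (\<rho> g v - v) = 0"
      by (simp only: plus_fun_apply V.scale_left_distrib add_ac)
  qed
  moreover have \<omega>: "alternating_2form \<omega>" and \<eta>: "alternating_2form \<eta>" using * by simp_all
  have "alternating_2form (\<omega> + \<eta>)"
  proof (rule alternating_2formI, goal_cases)
    case (4 x y)
    show ?case using alternating_2formD(4) [OF \<omega>, of x y] alternating_2formD(4) [OF \<eta>, of x y]
      by (simp add: plus_fun_apply)
  qed (simp_all add: plus_fun_apply alternating_2formD(1-3) [OF \<omega>] alternating_2formD(1-3) [OF \<eta>]
      distrib_left)
  ultimately show "\<omega> + \<eta> \<in> {\<omega>. alternating_2form \<omega> \<and> form_jacobi g \<omega>}" by simp
next
  fix c \<omega> assume *: "\<omega> \<in> {\<omega>. alternating_2form \<omega> \<and> form_jacobi g \<omega>}"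
  have "form_jacobi g (fun_scale c \<omega>)"
    unfolding form_jacobi_def
  proof (intro allI)
    fix u v w
    have "scale c (scale (\<omega> [u, v]) (\<rho> g w - w) + scale (\<omega> [v, w]) (\<rho> g u - u) + scale (\<omega> [w, u]) (\<rho> g v - v)) = 0"
      using * by (simp add: form_jacobi_def)
    then show "scale (fun_scale c \<omega> [u, v]) (\<rho> g w - w) + scale (fun_scale c \<omega> [v, w]) (\<rho> g u - u) +
      scale (fun_scale c \<omega> [w, u]) (\<rho> g v - v) = 0"
      by (simp add: fun_scale_def V.scale_right_distrib)
  qed
  moreover have \<omega>: "alternating_2form \<omega>" using * by simp
  have "alternating_2form (fun_scale c \<omega>)"
  proof (rule alternating_2formI, goal_cases)
    case (4 x y)
    show ?case using alternating_2formD(4) [OF \<omega>, of x y] by (simp add: fun_scale_def)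
  qed (simp_all add: fun_scale_def alternating_2formD(1-3) [OF \<omega>] distrib_left)
  ultimately show "fun_scale c \<omega> \<in> {\<omega>. alternating_2form \<omega> \<and> form_jacobi g \<omega>}" by simp
qed

lemma wedge_alternating:
  assumes "\<phi> \<in> dual_space scale" "\<psi> \<in> dual_space scale"
  shows "alternating_2form (wedge [\<phi>, \<psi>])"
  by (rule alternating_2formI)
    (simp_all add: wedge_pair wedge_length dual_linear [OF assms(1)] dual_linear [OF assms(2)] algebra_simps)

lemma alternating_2form_eqI:
  assumes "alternating_2form \<omega>" "\<And>vs. length vs \<noteq> 2 \<Longrightarrow> \<eta> vs = 0" "\<And>a b. \<omega> [a, b] = \<eta> [a, b]"
  shows "\<omega> = \<eta>"
proof
  fix vs
  show "\<omega> vs = \<eta> vs"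
  proof (cases "length vs = 2")
    case True
    then show ?thesis using length_2_list assms(3) by blast
  next
    case False
    then show ?thesis using alternating_2formD(1) [OF assms(1)] assms(2) by simp
  qed
qed

lemma alternating_expand:
  assumes \<omega>: "alternating_2form \<omega>"
  shows "\<omega> [x, v] = (\<Sum>b\<in>B. coord b x * \<omega> [b, v])"
proof -
  have "(\<lambda>x. \<omega> [x, v]) \<in> dual_space scale"
    by (intro dual_spaceI alternating_2formD [OF \<omega>])
  note lin = dual_linear [OF this]
  have "x = (\<Sum>b\<in>B. scale (coord b x) b)"
    unfolding coord_def
    by (rule V.sum_representation_eq [symmetric])
      (simp_all add: V.independent_Basis V.span_Basis V.finite_Basis)
  then have "\<omega> [x, v] = \<omega> [\<Sum>b\<in>B. scale (coord b x) b, v]" by simp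
  also have "\<dots> = (\<Sum>b\<in>B. coord b x * \<omega> [b, v])" by (simp only: lin)
  finally show ?thesis .
qed

text \<open>In coordinates \<open>\<chi>\<^sub>i\<close> of \<open>V / V\<^sup>g\<close> the Jacobi condition says \<open>\<omega> \<and> \<chi>\<^sub>i = 0\<close> for every \<open>i\<close>.\<close>

lemma form_jacobi_iff:
  fixes c :: nat
  assumes g: "g \<in> carrier G"
    and \<chi>: "\<And>i. i < c \<Longrightarrow> \<chi> i \<in> dual_vanishing_on scale (Fix g)"
      "\<And>i j. i < c \<Longrightarrow> j < c \<Longrightarrow> \<chi> i (b j) = (if i = j then 1 else 0)"
      "\<And>v. v - (\<Sum>i<c. scale (\<chi> i v) (b i)) \<in> Fix g"
  shows "form_jacobi g \<omega> \<longleftrightarrow>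
    (\<forall>i<c. \<forall>u v w. \<omega> [u, v] * \<chi> i w + \<omega> [v, w] * \<chi> i u + \<omega> [w, u] * \<chi> i v = 0)"
proof -
  \<comment> \<open>\<open>N\<close> is the operator g - 1. Its kernel is the fixed space, so it
    depends on the coordinates alone.\<close>
  define N where "N v = \<rho> g v - v" for v
  have N_add: "N (x + y) = N x + N y" and N_scale: "N (scale a x) = scale a (N x)" for x y a
    by (simp_all add: N_def rho_add [OF g] rho_scale [OF g] V.scale_right_diff_distrib)
  have N_0: "N 0 = 0" by (simp add: N_def rho_zero [OF g])
  have N_sum: "N (\<Sum>i\<in>A. f i) = (\<Sum>i\<in>A. N (f i))" for A :: "nat set" and f
    by (induction A rule: infinite_finite_induct) (simp_all add: N_add N_0)
  have N_Fix: "v \<in> Fix g \<longleftrightarrow> N v = 0" for v by (simp add: N_def fixed_space_def)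
  have N_diff: "N (x - y) = N x - N y" for x y using N_add [of "x - y" y] by simp
  have N: "N v = (\<Sum>i<c. scale (\<chi> i v) (N (b i)))" for v
    using \<chi>(3) [of v] unfolding N_Fix N_diff N_sum N_scale by simp
  define d where "d i u v w = \<omega> [u, v] * \<chi> i w + \<omega> [v, w] * \<chi> i u + \<omega> [w, u] * \<chi> i v" for i u v w
  have expand: "scale (\<omega> [u, v]) (N w) + scale (\<omega> [v, w]) (N u) + scale (\<omega> [w, u]) (N v) =
    N (\<Sum>i<c. scale (d i u v w) (b i))" for u v w
    by (subst N [of w], subst N [of u], subst N [of v])
      (simp add: d_def N_add N_sum N_scale V.scale_sum_right V.scale_left_distrib sum.distrib)
  \<comment> \<open>A combination of the \<open>b i\<close> killed by \<open>N\<close> is fixed by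
    g; the coordinates vanish on fixed vectors, so all its coefficients are 0.\<close>
  have "N (\<Sum>i<c. scale (d i u v w) (b i)) = 0 \<longleftrightarrow> (\<forall>i<c. d i u v w = 0)" for u v w
  proof
    assume "N (\<Sum>i<c. scale (d i u v w) (b i)) = 0"
    then have in_Fix: "(\<Sum>i<c. scale (d i u v w) (b i)) \<in> Fix g" by (simp add: N_Fix)
    show "\<forall>i<c. d i u v w = 0"
    proof (intro allI impI)
      fix j assume j: "j < c"
      have "\<chi> j \<in> dual_space scale" "\<chi> j (\<Sum>i<c. scale (d i u v w) (b i)) = 0"
        using \<chi>(1) [OF j] in_Fix by (auto simp: dual_vanishing_on_def)
      then have "0 = (\<Sum>i<c. d i u v w * \<chi> j (b i))" by (simp add: dual_linear)
      also have "\<dots> = (\<Sum>i<c. if i = j then d j u v w else 0)"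
        using j by (intro sum.cong) (auto simp: \<chi>(2))
      also have "\<dots> = d j u v w" using j by simp
      finally show "d j u v w = 0" ..
    qed
  qed (simp add: N_0)
  then show ?thesis
    unfolding form_jacobi_def N_def [symmetric] expand d_def by blast
qed

text \<open>Putting \<open>b i\<close> for one variable in
  \<open>\<omega> \<and> \<chi> i = 0\<close> exhibits \<omega> as a wedge product with
  \<open>\<chi> i\<close> as a factor (\<open>div\<close>). With no coordinate \<omega> is
  unrestricted, with one it has that factor, with two it is a multiple of
  \<open>\<chi> 0 \<and> \<chi> 1\<close>, and with three it vanishes, which matches the exterior
  powers in degrees \<open>2 - c\<close> and \<open>c\<close>.\<close>

lemma cocycle_component_iff:
  assumes g: "g \<in> carrier G"
  shows "\<omega> \<in> cocycle_component scale \<rho> ip g \<longleftrightarrow> alternating_2form \<omega> \<and> form_jacobi g \<omega>"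
proof -
  define c where "c = codim scale (Fix g)"
  obtain b \<chi> where *: "(\<forall>i<c. \<chi> i \<in> dual_vanishing_on scale (Fix g)) \<and>
    (\<forall>i<c. \<forall>j<c. \<chi> i (b j) = (if i = j then 1 else 0)) \<and>
    (\<forall>v. v - (\<Sum>i<c. scale (\<chi> i v) (b i)) \<in> Fix g) \<and>
    (\<forall>v\<in>Perp g. v = (\<Sum>i<c. scale (\<chi> i v) (b i)))"
    using Perp_coordinates [OF g, folded c_def] by (elim exE) (rule that)
  have \<chi>: "\<And>i. i < c \<Longrightarrow> \<chi> i \<in> dual_vanishing_on scale (Fix g)"
      "\<And>i j. i < c \<Longrightarrow> j < c \<Longrightarrow> \<chi> i (b j) = (if i = j then 1 else 0)"
      "\<And>v. v - (\<Sum>i<c. scale (\<chi> i v) (b i)) \<in> Fix g"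
      "\<And>v. v \<in> Perp g \<Longrightarrow> v = (\<Sum>i<c. scale (\<chi> i v) (b i))"
    using * by blast+
  note jac = form_jacobi_iff [OF g \<chi>(1-3)]
  have dual: "\<phi> \<in> dual_space scale" if "\<phi> \<in> dual_vanishing_on scale X" for \<phi> X
    using that by (simp add: dual_vanishing_on_def)
  have vanish: "\<psi> v = (\<Sum>i<c. \<psi> (b i) * \<chi> i v)" if \<psi>: "\<psi> \<in> dual_vanishing_on scale (Fix g)" for \<psi> v
  proof -
    have "\<psi> (v - (\<Sum>i<c. scale (\<chi> i v) (b i))) = 0" using \<psi> \<chi>(3) by (simp add: dual_vanishing_on_def)
    then show ?thesis by (simp add: dual_linear [OF dual [OF \<psi>]] mult.commute)
  qed
  let ?E = "{wedge (\<phi>s @ \<psi>s) |\<phi>s \<psi>s. length \<phi>s = 2 - c \<and> set \<phi>s \<subseteq> dual_vanishing_on scale (Perp g) \<and>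
    length \<psi>s = c \<and> set \<psi>s \<subseteq> dual_vanishing_on scale (Fix g)}"
  have comp: "cocycle_component scale \<rho> ip g = (if c \<le> 2 then fs.span ?E else {0})"
    by (simp add: cocycle_component_def wedge_product_space_def Let_def c_def)
  show ?thesis
  proof
    assume \<omega>: "\<omega> \<in> cocycle_component scale \<rho> ip g"
    show "alternating_2form \<omega> \<and> form_jacobi g \<omega>"
    proof (cases "c \<le> 2")
      case False
      then have "\<omega> = 0" using \<omega> by (simp add: comp)
      then show ?thesis using fs.subspace_0 [OF form_subspace [of g]] by simp
    next
      case True
      have "alternating_2form \<eta> \<and> form_jacobi g \<eta>" if \<eta>: "\<eta> \<in> ?E" for \<eta>
      proof -
        obtain \<phi>s \<psi>s where *: "\<eta> = wedge (\<phi>s @ \<psi>s)" "length \<phi>s = 2 - c" "length \<psi>s = c"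
          "set \<phi>s \<subseteq> dual_vanishing_on scale (Perp g)" "set \<psi>s \<subseteq> dual_vanishing_on scale (Fix g)"
          using \<eta> by blast
        have "length (\<phi>s @ \<psi>s) = 2" using * True by simp
        then obtain \<phi> \<psi> where eq: "\<phi>s @ \<psi>s = [\<phi>, \<psi>]" using length_2_list by blast
        have "set [\<phi>, \<psi>] \<subseteq> dual_space scale" unfolding eq [symmetric] using * dual by auto
        then have alt: "alternating_2form \<eta>" unfolding * eq by (intro wedge_alternating) simp_all
        consider "c = 0" | "c = 1" | "c = 2" using True by linarith
        \<comment> \<open>For \<open>c = 1\<close> the factor \<psi> is a multiple of
          \<open>\<chi> 0\<close>; for \<open>c = 2\<close> the three functionals \<phi>, \<psi>,
          \<open>\<chi> i\<close> lie in the span of two. In both cases the triple wedge product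
          vanishes.\<close>
        then have "\<forall>i<c. \<forall>u v w. \<eta> [u, v] * \<chi> i w + \<eta> [v, w] * \<chi> i u + \<eta> [w, u] * \<chi> i v = 0"
        proof cases
          case 2
          then have "\<psi>s = [\<psi>]" using eq *(2,3) by (auto simp: length_Suc_conv)
          then have "\<psi> v = \<psi> (b 0) * \<chi> 0 v" for v using vanish [of \<psi> v] *(5) 2 by simp
          then obtain p where "\<psi> v = p * \<chi> 0 v" for v by blast
          then show ?thesis unfolding * eq wedge_pair using 2 by (simp add: algebra_simps)
        next
          case 3
          then have "\<psi>s = [\<phi>, \<psi>]" using eq *(2,3) by simp
          then have "\<phi> v = \<phi> (b 0) * \<chi> 0 v + \<phi> (b 1) * \<chi> 1 v" "\<psi> v = \<psi> (b 0) * \<chi> 0 v + \<psi> (b 1) * \<chi> 1 v" for v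
            using vanish [of \<phi> v] vanish [of \<psi> v] *(5) 3 by (simp_all add: numeral_2_eq_2)
          then obtain p q r s where "\<phi> v = p * \<chi> 0 v + q * \<chi> 1 v" "\<psi> v = r * \<chi> 0 v + s * \<chi> 1 v" for v by metis
          then show ?thesis unfolding * eq wedge_pair using 3 by (auto simp: less_2_cases_iff algebra_simps)
        qed simp
        then show ?thesis using alt jac by simp
      qed
      then have "fs.span ?E \<subseteq> {\<omega>. alternating_2form \<omega> \<and> form_jacobi g \<omega>}"
        by (intro fs.span_minimal form_subspace) auto
      then show ?thesis using \<omega> True by (auto simp: comp)
    qed
  next
    assume "alternating_2form \<omega> \<and> form_jacobi g \<omega>"
    then have alt: "alternating_2form \<omega>" and "form_jacobi g \<omega>" by simp_all
    then have J: "\<omega> [u, v] * \<chi> i w + \<omega> [v, w] * \<chi> i u + \<omega> [w, u] * \<chi> i v = 0" if "i < c" for i u v w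
      using jac that by blast
    have skew: "\<omega> [x, y] = - \<omega> [y, x]" for x y using alt by (rule alternating_2formD)
    have self: "\<omega> [x, x] = 0" for x using skew [of x x] by simp
    have lin: "\<omega> [x + y, v] = \<omega> [x, v] + \<omega> [y, v]" "\<omega> [scale a x, v] = a * \<omega> [x, v]" for x y v a
      using alt by (rule alternating_2formD)+
    have lin2: "\<omega> [v, x + y] = \<omega> [v, x] + \<omega> [v, y]" "\<omega> [v, scale a x] = a * \<omega> [v, x]" for x y v a
      unfolding skew [of v] by (simp_all add: lin)
    have div: "\<omega> [u, v] = \<omega> [b i, v] * \<chi> i u - \<omega> [b i, u] * \<chi> i v" if "i < c" for i u v
      using J [OF that, of u v "b i"] skew [of v "b i"] \<chi>(2) [OF that that] by (simp add: algebra_simps)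
    have two: "\<omega> [u, v] = \<omega> [b 0, b 1] * (\<chi> 0 u * \<chi> 1 v - \<chi> 0 v * \<chi> 1 u)" if "2 \<le> c" for u v
    proof -
      have b0: "\<omega> [b 0, x] = \<omega> [b 0, b 1] * \<chi> 1 x" for x
        using div [of 1 "b 0" x] skew [of "b 1" "b 0"] \<chi>(2) [of 1 0] that by simp
      have "\<omega> [u, v] = \<omega> [b 0, v] * \<chi> 0 u - \<omega> [b 0, u] * \<chi> 0 v" using div [of 0 u v] that by simp
      then show ?thesis unfolding b0 [of u] b0 [of v] by (simp add: algebra_simps)
    qed
    consider "c = 0" | "c = 1" | "c = 2" | "3 \<le> c" by linarith
    then show "\<omega> \<in> cocycle_component scale \<rho> ip g"
    proof cases
      case 1
      have "\<phi> \<in> dual_vanishing_on scale (Perp g)" if "\<phi> \<in> dual_space scale" for \<phi>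
        using that \<chi>(4) 1 dual_linear(3) [OF that] by (auto simp: dual_vanishing_on_def)
      then have E: "wedge [coord x, coord y] \<in> fs.span ?E" for x y
        using 1 coord_dual by (intro fs.span_base CollectI exI [of _ "[coord x, coord y]"] exI [of _ "[]"]) simp
      \<comment> \<open>The sum runs over ordered pairs, so each wedge of two basis functionals is
        counted twice; hence the factor 1/2.\<close>
      let ?\<eta> = "\<Sum>x\<in>B. \<Sum>y\<in>B. fun_scale (\<omega> [x, y] / 2) (wedge [coord x, coord y])"
      have "\<omega> = ?\<eta>"
      proof (rule alternating_2form_eqI [OF alt])
        fix u v
        have 1: "\<omega> [u, v] = (\<Sum>x\<in>B. \<Sum>y\<in>B. coord x u * coord y v * \<omega> [x, y])" for u v
        proof -
          have "\<omega> [x, v] = (\<Sum>y\<in>B. coord y v * \<omega> [x, y])" for x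
            unfolding skew [of x] alternating_expand [OF alt, of v x] by (simp add: sum_negf)
          then show ?thesis by (subst alternating_expand [OF alt]) (simp add: sum_distrib_left mult.assoc)
        qed
        have "?\<eta> [u, v] = (\<Sum>x\<in>B. \<Sum>y\<in>B. coord x u * coord y v * \<omega> [x, y] / 2) -
            (\<Sum>x\<in>B. \<Sum>y\<in>B. coord x v * coord y u * \<omega> [x, y] / 2)"
          by (simp add: sum_fun_apply fun_scale_def wedge_pair algebra_simps sum_subtractf diff_divide_distrib)
        also have "\<dots> = \<omega> [u, v] / 2 - \<omega> [v, u] / 2" by (simp add: 1 [of u v] 1 [of v u] sum_divide_distrib)
        also have "\<dots> = \<omega> [u, v]" using skew [of v u] by simp
        finally show "\<omega> [u, v] = ?\<eta> [u, v]" ..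
      qed (simp add: sum_fun_apply fun_scale_def wedge_length)
      also have "\<dots> \<in> fs.span ?E" by (intro fs.span_sum fs.span_scale E)
      finally show ?thesis using 1 by (simp add: comp)
    next
      case 2
      \<comment> \<open>The sign is due to the order of the factors: \<open>div\<close> has
        \<open>\<chi> 0\<close> on the left, while \<open>cocycle_component\<close> puts functionals
        that vanish on the fixed space on the right.\<close>
      define \<mu> where "\<mu> v = - \<omega> [b 0, v]" for v
      have \<mu>: "\<mu> \<in> dual_space scale"
        by (intro dual_spaceI) (simp_all add: \<mu>_def lin2)
      moreover have "\<mu> v = 0" if "v \<in> Perp g" for v
      proof -
        have "v = scale (\<chi> 0 v) (b 0)" using \<chi>(4) [OF that] 2 by simp
        then have "\<mu> v = \<chi> 0 v * \<mu> (b 0)" using dual_linear(2) [OF \<mu>] by metis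
        then show ?thesis by (simp add: \<mu>_def self)
      qed
      ultimately have "\<mu> \<in> dual_vanishing_on scale (Perp g)" by (simp add: dual_vanishing_on_def)
      then have "wedge ([\<mu>] @ [\<chi> 0]) \<in> fs.span ?E"
        using 2 \<chi>(1) [of 0] by (intro fs.span_base CollectI exI [of _ "[\<mu>]"] exI [of _ "[\<chi> 0]"]) simp
      moreover have "\<omega> = wedge ([\<mu>] @ [\<chi> 0])"
      proof (rule alternating_2form_eqI [OF alt])
        show "\<omega> [u, v] = wedge ([\<mu>] @ [\<chi> 0]) [u, v]" for u v
          using div [of 0 u v] 2 by (simp add: wedge_pair \<mu>_def algebra_simps)
      qed (simp add: wedge_length)
      ultimately show ?thesis using 2 by (simp add: comp)
    next
      case 3
      have "wedge ([] @ [\<chi> 0, \<chi> 1]) \<in> fs.span ?E"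
        using 3 \<chi>(1) by (intro fs.span_base CollectI exI [of _ "[]"] exI [of _ "[\<chi> 0, \<chi> 1]"]) simp
      then have "fun_scale (\<omega> [b 0, b 1]) (wedge [\<chi> 0, \<chi> 1]) \<in> fs.span ?E" by (intro fs.span_scale) simp
      moreover have "\<omega> = fun_scale (\<omega> [b 0, b 1]) (wedge [\<chi> 0, \<chi> 1])"
      proof (rule alternating_2form_eqI [OF alt])
        show "\<omega> [u, v] = fun_scale (\<omega> [b 0, b 1]) (wedge [\<chi> 0, \<chi> 1]) [u, v]" for u v
          using two [of u v] 3 by (simp add: wedge_pair fun_scale_def)
      qed (simp add: wedge_length fun_scale_def)
      ultimately show ?thesis using 3 by (simp add: comp)
    next
      case 4
      \<comment> \<open>Divisibility by the third coordinate is tested on \<open>b 0\<close> and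
        \<open>b 1\<close>, where \<open>\<chi> 2\<close> vanishes; the value there is the only
        coefficient that \<open>two\<close> leaves.\<close>
      have "\<omega> [b 0, b 1] = 0"
        using div [of 2 "b 0" "b 1"] \<chi>(2) [of 2 0] \<chi>(2) [of 2 1] 4 by simp
      then have "\<omega> [u, v] = 0" for u v using two [of u v] 4 by simp
      then have "\<omega> = 0" by (intro alternating_2form_eqI [OF alt]) (simp_all add: zero_fun_apply)
      then show ?thesis using 4 by (simp add: comp)
    qed
  qed
qed

end


section \<open>The parameter space\<close>

lemma cochain_vector_space: "vector_space (\<lambda>c (\<alpha> :: 'g \<Rightarrow> 'w \<Rightarrow> complex) g vs. c * \<alpha> g vs)"
  by unfold_locales (auto simp: fun_eq_iff plus_fun_apply algebra_simps)

lemma form_vector_space: "vector_space (\<lambda>c (\<kappa> :: 'v \<Rightarrow> 'v \<Rightarrow> 'g \<Rightarrow> complex) v w g. c * \<kappa> v w g)"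
  by unfold_locales (auto simp: fun_eq_iff plus_fun_apply algebra_simps)

lemma eval_wedge_linear:
  "Vector_Spaces.linear (\<lambda>c \<alpha> g vs. c * \<alpha> g vs) (\<lambda>c \<kappa> v w g. c * \<kappa> v w g)
     (eval_wedge :: ('g \<Rightarrow> 'v list \<Rightarrow> complex) \<Rightarrow> 'v \<Rightarrow> 'v \<Rightarrow> 'g \<Rightarrow> complex)"
  unfolding Vector_Spaces.linear_iff
  using cochain_vector_space form_vector_space
  by (auto simp: eval_wedge_def fun_eq_iff plus_fun_apply)

lemma cocycle_algebra_eq: "cocycle_algebra G scale \<rho> \<alpha> = hecke_quotient G scale \<rho> (eval_wedge \<alpha>)"
  by (simp add: cocycle_algebra_def hecke_quotient_def hecke_ideal_def)

section \<open>Transfer between constant cocycles and parameters\<close>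

context hermitian_rep
begin

text \<open>Restates cocycles by the identities that characterise parameters. Outside the carrier
  the component is 0, which is alternating, so this clause may range over all g.\<close>

lemma constant_cocycles_iff:
  "\<alpha> \<in> constant_cocycles G scale \<rho> ip \<longleftrightarrow>
    (\<forall>g. alternating_2form (\<alpha> g)) \<and> (\<forall>g\<in>carrier G. form_jacobi g (\<alpha> g)) \<and>
    (\<forall>g. g \<notin> carrier G \<longrightarrow> \<alpha> g = 0) \<and>
    (\<forall>h\<in>carrier G. \<forall>g\<in>carrier G. \<forall>v w. \<alpha> (h \<otimes> g \<otimes> inv h) [\<rho> h v, \<rho> h w] = \<alpha> g [v, w])"
    (is "_ \<longleftrightarrow> ?alt \<and> ?jac \<and> ?out \<and> ?inv")
proof -
  have alt_0: "alternating_2form 0"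
    using fs.subspace_0 [OF form_subspace] by simp
  have comp: "(\<forall>g\<in>carrier G. \<alpha> g \<in> cocycle_component scale \<rho> ip g) \<and> ?out \<longleftrightarrow> ?alt \<and> ?jac \<and> ?out"
    using cocycle_component_iff alt_0 by metis
  have "(\<forall>h\<in>carrier G. cochain_act G \<rho> h \<alpha> = \<alpha>) \<longleftrightarrow> ?inv" if alt: ?alt and out: ?out
  proof
    assume *: "\<forall>h\<in>carrier G. cochain_act G \<rho> h \<alpha> = \<alpha>"
    show ?inv
    proof (intro ballI allI)
      fix h g v w assume h: "h \<in> carrier G" and g: "g \<in> carrier G"
      have "inv h \<otimes> (h \<otimes> g \<otimes> inv h) \<otimes> h = g"
        using h g by (simp add: m_assoc) (simp flip: m_assoc)
      moreover have "\<alpha> (h \<otimes> g \<otimes> inv h) [\<rho> h v, \<rho> h w] =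
          cochain_act G \<rho> h \<alpha> (h \<otimes> g \<otimes> inv h) [\<rho> h v, \<rho> h w]"
        using * h by simp
      ultimately show "\<alpha> (h \<otimes> g \<otimes> inv h) [\<rho> h v, \<rho> h w] = \<alpha> g [v, w]"
        using h g by (simp add: cochain_act_def rho_inv)
    qed
  next
    assume inv: ?inv
    show "\<forall>h\<in>carrier G. cochain_act G \<rho> h \<alpha> = \<alpha>"
    proof
      fix h assume h: "h \<in> carrier G"
      show "cochain_act G \<rho> h \<alpha> = \<alpha>"
      proof (intro ext)
        fix g and vs :: "'v list"
        \<comment> \<open>Off the carrier and off pairs both sides are 0, so invariance is decided
          on pairs of vectors.\<close>
        consider "g \<notin> carrier G" | "g \<in> carrier G" "length vs \<noteq> 2"
          | v w where "g \<in> carrier G" "vs = [v, w]"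
          using length_2_list by blast
        then show "cochain_act G \<rho> h \<alpha> g vs = \<alpha> g vs"
        proof cases
          case 1
          then show ?thesis using out by (simp add: cochain_act_def zero_fun_apply)
        next
          case 2
          have "\<alpha> k us = 0" if "length us \<noteq> 2" for k us
            using alternating_2formD(1) [OF alt [rule_format] that] .
          then show ?thesis using 2 by (simp add: cochain_act_def)
        next
          case 3
          then show ?thesis
            using inv [rule_format, of "inv h" g v w] h by (simp add: cochain_act_def)
        qed
      qed
    qed
  qed
  then show ?thesis using comp unfolding constant_cocycles_def by blast
qed

text \<open>From here on a statement about all splittings is replaced by two identities for
  \<kappa>, which can be compared with those for cocycles one group element at a time.\<close>

lemma parameter_space_iff:
  "\<kappa> \<in> parameter_space G scale \<rho> \<longleftrightarrow> hecke_pbw_form G scale B \<rho> \<kappa>"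
proof
  assume \<kappa>: "\<kappa> \<in> parameter_space G scale \<rho>"
  then interpret hecke_form G scale B \<rho> \<kappa>
    by unfold_locales (simp add: parameter_space_def)
  have pbw: "pbw_property G scale \<rho> \<kappa>" using \<kappa> by (simp add: parameter_space_def)
  show "hecke_pbw_form G scale B \<rho> \<kappa>"
    by unfold_locales (rule pbw_invariant [OF pbw] pbw_jacobi [OF pbw]; assumption)+
next
  assume "hecke_pbw_form G scale B \<rho> \<kappa>"
  then interpret hecke_pbw_form G scale B \<rho> \<kappa> .
  show "\<kappa> \<in> parameter_space G scale \<rho>" using kappa pbw by (simp add: parameter_space_def)
qed

lemma eval_wedge_parameter:
  assumes "\<alpha> \<in> constant_cocycles G scale \<rho> ip"
  shows "eval_wedge \<alpha> \<in> parameter_space G scale \<rho>"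
  unfolding parameter_space_iff
proof unfold_locales
  have \<alpha>: "\<And>g. alternating_2form (\<alpha> g)" "\<And>g. g \<in> carrier G \<Longrightarrow> form_jacobi g (\<alpha> g)"
    "\<And>g. g \<notin> carrier G \<Longrightarrow> \<alpha> g = 0"
    "\<And>h g v w. h \<in> carrier G \<Longrightarrow> g \<in> carrier G \<Longrightarrow> \<alpha> (h \<otimes> g \<otimes> inv h) [\<rho> h v, \<rho> h w] = \<alpha> g [v, w]"
    using assms unfolding constant_cocycles_iff by blast+
  have lin: "\<alpha> g [x + y, w] = \<alpha> g [x, w] + \<alpha> g [y, w]" "\<alpha> g [scale c x, w] = c * \<alpha> g [x, w]" for g x y w c
    using \<alpha>(1) by (rule alternating_2formD)+
  have skew: "\<alpha> g [v, w] = - \<alpha> g [w, v]" for g v w using \<alpha>(1) by (rule alternating_2formD)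
  have lin2: "\<alpha> g [w, x + y] = \<alpha> g [w, x] + \<alpha> g [w, y]" "\<alpha> g [w, scale c x] = c * \<alpha> g [w, x]" for g x y w c
    unfolding skew [of g w] by (simp_all add: lin)
  show "bilinear_skew G scale (eval_wedge \<alpha>)"
    unfolding bilinear_skew_def
  proof (intro conjI allI)
    show "eval_wedge \<alpha> v w \<in> group_algebra_carrier G" for v w
      by (simp add: group_algebra_carrier_def eval_wedge_def \<alpha>(3) zero_fun_apply)
    show "Vector_Spaces.linear scale fun_scale (\<lambda>v. eval_wedge \<alpha> v w)"
      "Vector_Spaces.linear scale fun_scale (\<lambda>v. eval_wedge \<alpha> w v)" for w
      by (simp_all add: Vector_Spaces.linear_iff V.vector_space_axioms fs.vector_space_axioms
          eval_wedge_def lin lin2 fun_eq_iff plus_fun_apply fun_scale_def)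
    show "eval_wedge \<alpha> v w = - eval_wedge \<alpha> w v" for v w
      unfolding eval_wedge_def fun_Compl_def using skew [of _ v w] by blast
  qed
  show "eval_wedge \<alpha> (\<rho> h v) (\<rho> h w) (h \<otimes> g \<otimes> inv h) = eval_wedge \<alpha> v w g"
    if "g \<in> carrier G" "h \<in> carrier G" for g h v w
    using \<alpha>(4) [OF that(2,1)] by (simp add: eval_wedge_def)
  show "scale (eval_wedge \<alpha> u v g) (\<rho> g w - w) + scale (eval_wedge \<alpha> v w g) (\<rho> g u - u) +
      scale (eval_wedge \<alpha> w u g) (\<rho> g v - v) = 0" if "g \<in> carrier G" for g u v w
    using \<alpha>(2) [OF that] unfolding form_jacobi_def eval_wedge_def by blast
qed

lemma parameter_eval_wedge:
  assumes "\<kappa> \<in> parameter_space G scale \<rho>"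
  obtains \<alpha> where "\<alpha> \<in> constant_cocycles G scale \<rho> ip" "\<kappa> = eval_wedge \<alpha>"
proof -
  interpret hecke_pbw_form G scale B \<rho> \<kappa> using assms unfolding parameter_space_iff .
  \<comment> \<open>The extension by zero is the one built into \<open>wedge\<close>; any other
    would leave the space of alternating forms.\<close>
  define \<alpha> where "\<alpha> g vs = (if length vs = 2 then \<kappa> (vs ! 0) (vs ! 1) g else 0)" for g vs
  have \<alpha>: "\<alpha> g [v, w] = \<kappa> v w g" for g v w by (simp add: \<alpha>_def)
  have "\<alpha> \<in> constant_cocycles G scale \<rho> ip"
    unfolding constant_cocycles_iff
  proof (intro conjI allI ballI impI)
    show "alternating_2form (\<alpha> g)" for g
    proof (rule alternating_2formI)
      show "\<alpha> g [x, y] = - \<alpha> g [y, x]" for x y unfolding \<alpha> by (rule kappa_skew)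
    qed (simp_all add: \<alpha> kappa_linear, simp add: \<alpha>_def)
    show "form_jacobi g (\<alpha> g)" if "g \<in> carrier G" for g
      unfolding form_jacobi_def \<alpha> using jacobi [OF that] by blast
    show "\<alpha> g = 0" if "g \<notin> carrier G" for g
      using kappa_outside [OF that] by (simp add: \<alpha>_def fun_eq_iff zero_fun_apply)
    show "\<alpha> (h \<otimes> g \<otimes> inv h) [\<rho> h v, \<rho> h w] = \<alpha> g [v, w]"
      if "h \<in> carrier G" "g \<in> carrier G" for h g v w
      unfolding \<alpha> by (rule invariant [OF that(2,1)])
  qed
  moreover have "\<kappa> = eval_wedge \<alpha>" by (simp add: eval_wedge_def \<alpha> fun_eq_iff)
  ultimately show ?thesis by (rule that)
qed

lemma bij_eval_wedge:
  "bij_betw eval_wedge (constant_cocycles G scale \<rho> ip) (parameter_space G scale \<rho>)"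
  unfolding bij_betw_def
proof
  show "inj_on eval_wedge (constant_cocycles G scale \<rho> ip)"
  proof (rule inj_onI)
    fix \<alpha> \<beta> assume \<alpha>: "\<alpha> \<in> constant_cocycles G scale \<rho> ip" and \<beta>: "\<beta> \<in> constant_cocycles G scale \<rho> ip"
      and eq: "eval_wedge \<alpha> = eval_wedge \<beta>"
    have alt: "alternating_2form (\<alpha> g)" "alternating_2form (\<beta> g)" for g
      using \<alpha> \<beta> unfolding constant_cocycles_iff by blast+
    have "\<alpha> g = \<beta> g" for g
    proof (rule alternating_2form_eqI [OF alt(1)])
      show "\<beta> g vs = 0" if "length vs \<noteq> 2" for vs by (rule alternating_2formD(1) [OF alt(2) that])
      show "\<alpha> g [a, b] = \<beta> g [a, b]" for a b
        using fun_cong [OF fun_cong [OF fun_cong [OF eq]], of a b g] by (simp add: eval_wedge_def)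
    qed
    then show "\<alpha> = \<beta>" by blast
  qed
  show "eval_wedge ` constant_cocycles G scale \<rho> ip = parameter_space G scale \<rho>"
    using eval_wedge_parameter parameter_eval_wedge by (auto elim: parameter_eval_wedge)
qed

lemma constant_cocycles_subspace:
  "module.subspace (\<lambda>c \<alpha> g vs. c * \<alpha> g vs) (constant_cocycles G scale \<rho> ip)"
proof -
  interpret C: vector_space "\<lambda>c (\<alpha> :: 'g \<Rightarrow> 'v list \<Rightarrow> complex) g vs. c * \<alpha> g vs"
    by (rule cochain_vector_space)
  have comp: "fs.subspace (cocycle_component scale \<rho> ip g)" if "g \<in> carrier G" for g
  proof -
    have "cocycle_component scale \<rho> ip g = {\<omega>. alternating_2form \<omega> \<and> form_jacobi g \<omega>}"
      using cocycle_component_iff [OF that] by blast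
    then show ?thesis using form_subspace by simp
  qed
  have act: "cochain_act G \<rho> h 0 = 0" "cochain_act G \<rho> h (\<alpha> + \<beta>) = cochain_act G \<rho> h \<alpha> + cochain_act G \<rho> h \<beta>"
    "cochain_act G \<rho> h (\<lambda>g. fun_scale c (\<alpha> g)) = (\<lambda>g. fun_scale c (cochain_act G \<rho> h \<alpha> g))" for h \<alpha> \<beta> c
    by (auto simp: cochain_act_def fun_eq_iff plus_fun_apply zero_fun_apply fun_scale_def)
  have sc: "(\<lambda>vs. c * \<omega> vs) = fun_scale c \<omega>" for c and \<omega> :: "'v list \<Rightarrow> complex"
    by (simp add: fun_scale_def)
  show ?thesis
    unfolding C.subspace_def constant_cocycles_def
    using fs.subspace_0 [OF comp] fs.subspace_add [OF comp] fs.subspace_scale [OF comp]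
    by (simp add: act sc) (simp add: plus_fun_apply zero_fun_apply)
qed

text \<open>The PBW property is not visibly linear in \<kappa>. Linearity is inherited from the
  cocycles, as the parameter space is their image under a linear map.\<close>

lemma parameter_space_subspace:
  "module.subspace (\<lambda>c \<kappa> v w g. c * \<kappa> v w g) (parameter_space G scale \<rho>)"
proof -
  have "module_hom (\<lambda>c \<alpha> g vs. c * \<alpha> g vs) (\<lambda>c \<kappa> v w g. c * \<kappa> v w g)
     (eval_wedge :: ('g \<Rightarrow> 'v list \<Rightarrow> complex) \<Rightarrow> 'v \<Rightarrow> 'v \<Rightarrow> 'g \<Rightarrow> complex)"
    using eval_wedge_linear by (simp only: module_hom_iff_linear)
  from module_hom.subspace_image [OF this constant_cocycles_subspace]
  show ?thesis using bij_eval_wedge by (simp add: bij_betw_def)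
qed

end

theorem proposition11p5:
  fixes G :: "('g, 'm) monoid_scheme"
    and scale :: "complex \<Rightarrow> 'v::ab_group_add \<Rightarrow> 'v"
    and B :: "'v set"
    and \<rho> :: "'g \<Rightarrow> 'v \<Rightarrow> 'v"
    and ip :: "'v \<Rightarrow> 'v \<Rightarrow> complex"
  assumes "group G" and "finite (carrier G)"
    and "finite_dimensional_vector_space scale B"
    and "linear_rep G scale \<rho>"
    and "invariant_inner_product G scale \<rho> ip"
  shows "(\<forall>\<alpha>\<in>constant_cocycles G scale \<rho> ip.
            cocycle_algebra G scale \<rho> \<alpha> \<in> graded_hecke_algebras G scale \<rho> \<and>
            cocycle_algebra G scale \<rho> \<alpha> = hecke_quotient G scale \<rho> (eval_wedge \<alpha>)) \<and>
         module.subspace (\<lambda>c \<alpha> g vs. c * \<alpha> g vs) (constant_cocycles G scale \<rho> ip) \<and>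
         module.subspace (\<lambda>c \<kappa> v w g. c * \<kappa> v w g) (parameter_space G scale \<rho>) \<and>
         Vector_Spaces.linear (\<lambda>c \<alpha> g vs. c * \<alpha> g vs) (\<lambda>c \<kappa> v w g. c * \<kappa> v w g)
           (eval_wedge :: ('g \<Rightarrow> 'v list \<Rightarrow> complex) \<Rightarrow> 'v \<Rightarrow> 'v \<Rightarrow> 'g \<Rightarrow> complex) \<and>
         bij_betw eval_wedge (constant_cocycles G scale \<rho> ip) (parameter_space G scale \<rho>)"
proof -
  interpret hermitian_rep G scale B \<rho> ip
    using assms by (simp add: hermitian_rep_def hermitian_rep_axioms_def group_rep_def group_rep_axioms_def)
  show ?thesis
    using constant_cocycles_subspace parameter_space_subspace eval_wedge_linear bij_eval_wedge
      eval_wedge_parameter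
    by (auto simp: graded_hecke_algebras_def cocycle_algebra_eq)
qed

end
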